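(* Given $1\le p<q$ with $p,q$ relatively prime, let $T(p,q)$ denote the $(p,q)$-torus knot and $\pi$ its knot group. For every $1\le n\le p$ and each $\mu_0\in\mathbb{C}^*$ with $\mu_0\neq1$ there is a degree $n$ irreducible KCH representation of $\pi$ with $\mu_0$ as the (non-$1$) eigenvalue of the meridian $m$. In fact, $$\widetilde{A}_{T(p,q)}(\lambda,\mu)=\bigl(\lambda\mu^{pq-q}+(-1)^p\bigr)\prod_{n=1}^{p-1}\bigl(\lambda^n\mu^{(n-1)pq}-1\bigr)$$ (equality of polynomials defined up to units in $\mathbb{C}[\lambda^{\pm1},\mu^{\pm1}]$).
   Context: $\mathbb{C}^*=\mathbb{C}\setminus\{0\}$. The knot group of $T(p,q)$ is $\pi\cong\langle x,y\mid x^p=y^q\rangle$, with a meridian $m=x^sy^r$, where $r,s$ are integers with $rp+sq=1$, and $0$-framed longitude $\ell=x^pm^{-pq}$, which commutes with $m$. For a knot $K$ with group $\pi_K$, meridian $m$ and $0$-framed longitude $\ell$: a homomorphism $\rho:\pi_K\to\mathrm{GL}(V)$, $\dim_{\mathbb C}V=n$, is a KCH representation of degree $n$ if $\rho(m)$ is diagonalizable and has $1$ as an eigenvalue with multiplicity exactly $n-1$. Let $e_1$ be an eigenvector of $\rho(m)$ for the remaining eigenvalue $\mu_0\ne1$. Since $\ell$ commutes with $m$, $e_1$ is an eigenvector of $\rho(\ell)$; let $\lambda_0$ be the corresponding eigenvalue. Let $U_K^n\subset(\mathbb{C}^* )^2$ be the set of all pairs $(\lambda_0,\mu_0)$ arising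 from KCH representations of degree $n$. The $n$-dimensional $A$-polynomial $A_K^n(\lambda,\mu)$ is the reduced polynomial (no repeated factors), defined up to a unit, whose zero locus is the 1-dimensional part of the closure of $U_K^n$ (it is defined when there is no 2-dimensional component). The polynomials $A_K^n$ are independent of $n$ for all sufficiently large $n$, and the stable $A$-polynomial $\widetilde{A}_K(\lambda,\mu)$ is this stable value.
   Formalization: The existence of a degree n irreducible KCH representation excludes the cases n = p ≥ 2, q = p+1, (−μ_0)^q = 1, μ_0 ≠ −1, where it fails (e.g. the trefoil with n = 2, μ_0^2 − μ_0 + 1 = 0); the A-polynomial formula is unrestricted. *)

theory Defs
  imports
    "Jordan_Normal_Form.Char_Poly"
    "Jordan_Normal_Form.VS_Connect"
    "HOL-Library.Poly_Mapping"
    "HOL-Library.Product_Plus"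
    "HOL-Library.Extended_Nat"
    "HOL-Computational_Algebra.Squarefree"
    "HOL-Analysis.Abstract_Topology"
begin

section \<open>Groups given by generators and relators\<close>

text \<open>The letter \<open>(g, True)\<close> stands for the generator \<open>g\<close> and \<open>(g, False)\<close> for its inverse.\<close>

type_synonym 'g word = "('g \<times> bool) list"

inductive pres_eq :: "'g word set \<Rightarrow> 'g word \<Rightarrow> 'g word \<Rightarrow> bool" for R where
  refl: "pres_eq R w w"
| sym: "pres_eq R u v \<Longrightarrow> pres_eq R v u"
| trans: "pres_eq R u v \<Longrightarrow> pres_eq R v w \<Longrightarrow> pres_eq R u w"
| cancel: "pres_eq R (u @ [(g, b), (g, \<not> b)] @ v) (u @ v)"
| relator: "r \<in> R \<Longrightarrow> pres_eq R (u @ r @ v) (u @ v)"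

definition pres_rel :: "'g word set \<Rightarrow> ('g word \<times> 'g word) set" where
  "pres_rel R = {(u, v). pres_eq R u v}"

definition presented_group :: "'g word set \<Rightarrow> 'g word set monoid" where
  "presented_group R = \<lparr>
     carrier = UNIV // pres_rel R,
     monoid.mult = (\<lambda>A B. \<Union>u\<in>A. \<Union>v\<in>B. pres_rel R `` {u @ v}),
     one = pres_rel R `` {[]}\<rparr>"

definition pres_gen :: "'g word set \<Rightarrow> 'g \<Rightarrow> 'g word set" where
  "pres_gen R g = pres_rel R `` {[(g, True)]}"

lemma equiv_pres_rel: "equiv UNIV (pres_rel R)"
  by (rule equivI)
    (auto simp: pres_rel_def intro: refl_onI symI transI pres_eq.refl pres_eq.sym pres_eq.trans)

lemma pres_eq_append_left: "pres_eq R u v \<Longrightarrow> pres_eq R (w @ u) (w @ v)"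
proof (induction rule: pres_eq.induct)
  case (trans u v z)
  then show ?case by (blast intro: pres_eq.trans)
next
  case (cancel u g b v)
  show ?case using pres_eq.cancel[of R "w @ u" g b v] by simp
next
  case (relator r u v)
  then show ?case using pres_eq.relator[of r R "w @ u" v] by simp
qed (auto intro: pres_eq.refl pres_eq.sym)

lemma pres_eq_append_right: "pres_eq R u v \<Longrightarrow> pres_eq R (u @ w) (v @ w)"
proof (induction rule: pres_eq.induct)
  case (trans u v z)
  then show ?case by (blast intro: pres_eq.trans)
next
  case (cancel u g b v)
  show ?case using pres_eq.cancel[of R u g b "v @ w"] by simp
next
  case (relator r u v)
  then show ?case using pres_eq.relator[of r R u "v @ w"] by simp
qed (auto intro: pres_eq.refl pres_eq.sym)

lemma pres_class_mult:
  "(pres_rel R `` {u}) \<otimes>\<^bsub>presented_group R\<^esub> (pres_rel R `` {v}) = pres_rel R `` {u @ v}"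
proof -
  have c: "congruent2 (pres_rel R) (pres_rel R) (\<lambda>u v. pres_rel R `` {u @ v})"
  proof (rule congruent2I')
    fix u u' v v' assume "(u, u') \<in> pres_rel R" "(v, v') \<in> pres_rel R"
    then have "pres_eq R (u @ v) (u' @ v')"
      unfolding pres_rel_def
      by (auto intro: pres_eq.trans[OF pres_eq_append_left pres_eq_append_right])
    then show "pres_rel R `` {u @ v} = pres_rel R `` {u' @ v'}"
      by (intro equiv_class_eq[OF equiv_pres_rel]) (simp add: pres_rel_def)
  qed
  show ?thesis
    using UN_equiv_class2[OF equiv_pres_rel equiv_pres_rel c, of u v]
    by (simp add: presented_group_def)
qed

lemma pres_carrierE:
  assumes "a \<in> carrier (presented_group R)"
  obtains u where "a = pres_rel R `` {u}"
  using assms by (auto simp: presented_group_def quotient_def)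

lemma pres_class_carrier [simp]: "pres_rel R `` {u} \<in> carrier (presented_group R)"
  by (auto simp: presented_group_def quotient_def)

lemma pres_one: "\<one>\<^bsub>presented_group R\<^esub> = pres_rel R `` {[]}"
  by (simp add: presented_group_def)

lemma pres_eq_inverse:
  "pres_eq R (rev (map (\<lambda>(g, b). (g, \<not> b)) w) @ w) []"
proof (induction w)
  case (Cons a w)
  obtain g b where a: "a = (g, b)" by force
  have "pres_eq R (rev (map (\<lambda>(g, b). (g, \<not> b)) w) @ [(g, \<not> b), (g, \<not> \<not> b)] @ w)
    (rev (map (\<lambda>(g, b). (g, \<not> b)) w) @ w)"
    by (rule pres_eq.cancel)
  with Cons a show ?case by (auto intro: pres_eq.trans)
qed (simp add: pres_eq.refl)

lemma group_presented_group: "group (presented_group R)"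
proof (rule groupI)
  fix a assume "a \<in> carrier (presented_group R)"
  then obtain u where u: "a = pres_rel R `` {u}" by (rule pres_carrierE)
  have "pres_rel R `` {rev (map (\<lambda>(g, b). (g, \<not> b)) u)} \<otimes>\<^bsub>presented_group R\<^esub> a
      = \<one>\<^bsub>presented_group R\<^esub>"
    unfolding u pres_class_mult pres_one
    by (rule equiv_class_eq[OF equiv_pres_rel]) (simp add: pres_rel_def pres_eq_inverse)
  then show "\<exists>b\<in>carrier (presented_group R).
      b \<otimes>\<^bsub>presented_group R\<^esub> a = \<one>\<^bsub>presented_group R\<^esub>"
    using pres_class_carrier by blast
qed (auto elim!: pres_carrierE simp: pres_class_mult pres_one)

lemma pres_gen_carrier [simp]: "pres_gen R g \<in> carrier (presented_group R)"
  by (simp add: pres_gen_def)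

lemma pres_inv_gen:
  "inv\<^bsub>presented_group R\<^esub> pres_gen R g = pres_rel R `` {[(g, False)]}"
proof -
  interpret group "presented_group R" by (rule group_presented_group)
  have "pres_eq R [(g, False), (g, True)] []"
    using pres_eq.cancel[of R "[]" g False "[]"] by simp
  then have "pres_rel R `` {[(g, False)]} \<otimes>\<^bsub>presented_group R\<^esub> pres_gen R g
      = \<one>\<^bsub>presented_group R\<^esub>"
    unfolding pres_gen_def pres_class_mult pres_one
    by (intro equiv_class_eq[OF equiv_pres_rel]) (simp add: pres_rel_def)
  then show ?thesis by (intro inv_equality) auto
qed

lemma pres_class_replicate:
  "pres_rel R `` {replicate k a} = (pres_rel R `` {[a]}) [^]\<^bsub>presented_group R\<^esub> (k :: nat)"
proof -
  interpret group "presented_group R" by (rule group_presented_group)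
  show ?thesis
  proof (induction k)
    case 0
    show ?case by (simp add: pres_one)
  next
    case (Suc k)
    have "replicate (Suc k) a = replicate k a @ [a]"
      by (simp add: replicate_append_same)
    then show ?case using Suc by (metis nat_pow_Suc pres_class_mult)
  qed
qed


section \<open>Torus knots\<close>

datatype torus_gen = X | Y

definition torus_relators :: "nat \<Rightarrow> nat \<Rightarrow> torus_gen word set" where
  "torus_relators p q = {replicate p (X, True) @ replicate q (Y, False)}"

definition torus_knot_group :: "nat \<Rightarrow> nat \<Rightarrow> torus_gen word set monoid" where
  "torus_knot_group p q = presented_group (torus_relators p q)"

definition torus_meridian :: "nat \<Rightarrow> nat \<Rightarrow> int \<Rightarrow> int \<Rightarrow> torus_gen word set" where
  "torus_meridian p q r s =
     pres_gen (torus_relators p q) X [^]\<^bsub>torus_knot_group p q\<^esub> s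
       \<otimes>\<^bsub>torus_knot_group p q\<^esub> pres_gen (torus_relators p q) Y [^]\<^bsub>torus_knot_group p q\<^esub> r"

definition torus_longitude :: "nat \<Rightarrow> nat \<Rightarrow> int \<Rightarrow> int \<Rightarrow> torus_gen word set" where
  "torus_longitude p q r s =
     pres_gen (torus_relators p q) X [^]\<^bsub>torus_knot_group p q\<^esub> p
       \<otimes>\<^bsub>torus_knot_group p q\<^esub>
         torus_meridian p q r s [^]\<^bsub>torus_knot_group p q\<^esub> (- (int p * int q))"

lemma torus_relation:
  "pres_gen (torus_relators p q) X [^]\<^bsub>torus_knot_group p q\<^esub> p
   = pres_gen (torus_relators p q) Y [^]\<^bsub>torus_knot_group p q\<^esub> q"
proof -
  let ?R = "torus_relators p q" and ?G = "torus_knot_group p q"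
  interpret group ?G unfolding torus_knot_group_def by (rule group_presented_group)
  have c: "pres_gen ?R g \<in> carrier ?G" for g by (simp add: torus_knot_group_def)
  have "pres_eq ?R (replicate p (X, True) @ replicate q (Y, False)) []"
    using pres_eq.relator[of "replicate p (X, True) @ replicate q (Y, False)" ?R "[]" "[]"]
    by (simp add: torus_relators_def)
  then have "pres_rel ?R `` {replicate p (X, True) @ replicate q (Y, False)} = \<one>\<^bsub>?G\<^esub>"
    unfolding torus_knot_group_def pres_one
    by (intro equiv_class_eq[OF equiv_pres_rel]) (simp add: pres_rel_def)
  then have "pres_gen ?R X [^]\<^bsub>?G\<^esub> p \<otimes>\<^bsub>?G\<^esub> (inv\<^bsub>?G\<^esub> pres_gen ?R Y) [^]\<^bsub>?G\<^esub> q = \<one>\<^bsub>?G\<^esub>"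
    by (simp add: pres_class_mult[symmetric] pres_class_replicate torus_knot_group_def
        pres_inv_gen pres_gen_def[of _ X])
  then have "pres_gen ?R X [^]\<^bsub>?G\<^esub> p \<otimes>\<^bsub>?G\<^esub> inv\<^bsub>?G\<^esub> (pres_gen ?R Y [^]\<^bsub>?G\<^esub> q) = \<one>\<^bsub>?G\<^esub>"
    using c by (simp add: nat_pow_inv)
  then show ?thesis using c by (metis inv_equality inv_inv nat_pow_closed inv_closed)
qed

section \<open>KCH representations\<close>

abbreviation GL :: "nat \<Rightarrow> complex mat monoid" where
  "GL n \<equiv> units_of (ring_mat TYPE(complex) n ())"

definition diagonalizable :: "complex mat \<Rightarrow> bool" where
  "diagonalizable A \<longleftrightarrow> (\<exists>D. diagonal_mat D \<and> similar_mat A D)"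

text \<open>
  Below, \<open>G\<close> is the knot group, \<open>m\<close> the meridian and \<open>l\<close> the longitude.
  For a diagonalizable matrix the multiplicity of an eigenvalue as a root of the characteristic
  polynomial is the dimension of its eigenspace.
\<close>

definition KCH_rep :: "('g, 'b) monoid_scheme \<Rightarrow> 'g \<Rightarrow> nat \<Rightarrow> ('g \<Rightarrow> complex mat) \<Rightarrow> bool" where
  "KCH_rep G m n \<rho> \<longleftrightarrow>
     n \<ge> 1 \<and> \<rho> \<in> hom G (GL n) \<and> diagonalizable (\<rho> m) \<and> Polynomial.order 1 (char_poly (\<rho> m)) = n - 1"

definition irreducible_rep :: "('g, 'b) monoid_scheme \<Rightarrow> nat \<Rightarrow> ('g \<Rightarrow> complex mat) \<Rightarrow> bool" where
  "irreducible_rep G n \<rho> \<longleftrightarrow>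
     n \<ge> 1 \<and>
     (\<forall>W. VectorSpace.subspace class_ring W (module_vec TYPE(complex) n) \<longrightarrow>
          (\<forall>g\<in>carrier G. \<forall>w\<in>W. \<rho> g *\<^sub>v w \<in> W) \<longrightarrow>
          W = {0\<^sub>v n} \<or> W = carrier_vec n)"

definition KCH_pairs ::
    "('g, 'b) monoid_scheme \<Rightarrow> 'g \<Rightarrow> 'g \<Rightarrow> nat \<Rightarrow> (complex \<times> complex) set" where
  "KCH_pairs G m l n =
     {(lam0, \<mu>0). \<exists>\<rho> e1. KCH_rep G m n \<rho> \<and> \<mu>0 \<noteq> 1 \<and>
        eigenvector (\<rho> m) e1 \<mu>0 \<and> eigenvector (\<rho> l) e1 lam0}"

section \<open>Laurent polynomials in two variables and the Zariski topology on the torus\<close>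

text \<open>
  The group algebra of \<open>\<int>\<^sup>2\<close>: the key \<open>(a, b)\<close> is the exponent vector of
  \<open>\<lambda>\<^sup>a \<mu>\<^sup>b\<close>.
\<close>

type_synonym laurent2 = "(int \<times> int) \<Rightarrow>\<^sub>0 complex"

definition lam :: laurent2 where "lam = Poly_Mapping.single (1, 0) 1"

definition mu :: laurent2 where "mu = Poly_Mapping.single (0, 1) 1"

definition laurent_eval :: "laurent2 \<Rightarrow> complex \<times> complex \<Rightarrow> complex" where
  "laurent_eval F z =
     (\<Sum>k\<in>Poly_Mapping.keys F. Poly_Mapping.lookup F k * fst z powi fst k * snd z powi snd k)"

definition torus2 :: "(complex \<times> complex) set" where
  "torus2 = (UNIV - {0}) \<times> (UNIV - {0})"

definition zero_locus :: "laurent2 set \<Rightarrow> (complex \<times> complex) set" where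
  "zero_locus S = {z \<in> torus2. \<forall>F\<in>S. laurent_eval F z = 0}"

definition zariski :: "(complex \<times> complex) topology" where
  "zariski = topology (\<lambda>U. \<exists>S. U = torus2 - zero_locus S)"

lemma laurent_eval_superset:
  assumes "finite A" "Poly_Mapping.keys F \<subseteq> A"
  shows "laurent_eval F z =
    (\<Sum>k\<in>A. Poly_Mapping.lookup F k * fst z powi fst k * snd z powi snd k)"
  unfolding laurent_eval_def
  by (rule sum.mono_neutral_left) (use assms in \<open>auto simp: in_keys_iff\<close>)

lemma laurent_eval_add: "laurent_eval (F + G) z = laurent_eval F z + laurent_eval G z"
proof -
  let ?A = "Poly_Mapping.keys F \<union> Poly_Mapping.keys G"
  have "finite ?A" "Poly_Mapping.keys (F + G) \<subseteq> ?A"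
    using keys_add[of F G] by auto
  then show ?thesis
    by (simp add: laurent_eval_superset[of ?A] lookup_add algebra_simps sum.distrib)
qed

lemma laurent_eval_single:
  "laurent_eval (Poly_Mapping.single k c) z = c * fst z powi fst k * snd z powi snd k"
  by (simp add: laurent_eval_superset[of "{k}"])

lemma laurent_eval_0 [simp]: "laurent_eval 0 z = 0"
  by (simp add: laurent_eval_def)

lemma laurent_eval_1: "laurent_eval 1 z = 1"
  using laurent_eval_single[of 0 1 z] by simp

lemma laurent_induct [case_names zero add]:
  fixes F :: laurent2
  assumes "P 0" "\<And>k c F. P F \<Longrightarrow> P (Poly_Mapping.single k c + F)"
  shows "P F"
proof (induction F rule: update_induct)
  case (update F a b)
  have "Poly_Mapping.update a b F = Poly_Mapping.single a b + F"
    using update(1)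
    by (intro poly_mapping_eqI) (auto simp: lookup_update lookup_add lookup_single in_keys_iff when_def)
  then show ?case using assms(2) update by simp
qed (use assms in auto)

lemma laurent_eval_mult:
  assumes "z \<in> torus2"
  shows "laurent_eval (F * G) z = laurent_eval F z * laurent_eval G z"
proof (induction F rule: laurent_induct)
  case (add k c F)
  have "laurent_eval (Poly_Mapping.single k c * G) z
      = c * fst z powi fst k * snd z powi snd k * laurent_eval G z"
  proof (induction G rule: laurent_induct)
    case (add l d G)
    then show ?case using assms
      by (auto simp: distrib_left laurent_eval_add mult_single laurent_eval_single power_int_add
          torus2_def algebra_simps)
  qed auto
  with add show ?case by (simp add: distrib_right laurent_eval_add laurent_eval_single)
qed auto

lemma openin_zariski: "openin zariski U \<longleftrightarrow> (\<exists>S. U = torus2 - zero_locus S)"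
proof -
  have "istopology (\<lambda>U. \<exists>S. U = torus2 - zero_locus S)"
    unfolding istopology_def
  proof (intro conjI allI impI)
    fix U V assume "\<exists>S. U = torus2 - zero_locus S" "\<exists>S. V = torus2 - zero_locus S"
    then obtain S T where "U = torus2 - zero_locus S" "V = torus2 - zero_locus T" by blast
    then have "U \<inter> V = torus2 - zero_locus {F * G | F G. F \<in> S \<and> G \<in> T}"
    proof -
      have "z \<in> zero_locus {F * G | F G. F \<in> S \<and> G \<in> T} \<longleftrightarrow> z \<in> zero_locus S \<or> z \<in> zero_locus T"
        if z: "z \<in> torus2" for z
      proof -
        have "z \<in> zero_locus {F * G | F G. F \<in> S \<and> G \<in> T}
            \<longleftrightarrow> (\<forall>F\<in>S. \<forall>G\<in>T. laurent_eval F z * laurent_eval G z = 0)"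
          unfolding zero_locus_def using z laurent_eval_mult[OF z] by fastforce
        also have "\<dots> \<longleftrightarrow> z \<in> zero_locus S \<or> z \<in> zero_locus T"
          unfolding zero_locus_def using z by (simp add: mult_eq_0_iff)
        finally show ?thesis .
      qed
      with \<open>U = _\<close> \<open>V = _\<close> show ?thesis by blast
    qed
    then show "\<exists>S. U \<inter> V = torus2 - zero_locus S" by blast
  next
    fix \<K> :: "(complex \<times> complex) set set"
    assume "\<forall>K\<in>\<K>. \<exists>S. K = torus2 - zero_locus S"
    then obtain S where S: "\<And>K. K \<in> \<K> \<Longrightarrow> K = torus2 - zero_locus (S K)" by metis
    have "\<Union>\<K> = (\<Union>K\<in>\<K>. torus2 - zero_locus (S K))" using S by auto
    also have "\<dots> = torus2 - zero_locus (\<Union>K\<in>\<K>. S K)" by (auto simp: zero_locus_def)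
    finally show "\<exists>S. \<Union>\<K> = torus2 - zero_locus S" by blast
  qed
  then show ?thesis by (simp add: zariski_def)
qed

lemma topspace_zariski: "topspace zariski = torus2"
proof -
  have "openin zariski torus2"
    unfolding openin_zariski by (rule exI[of _ "{1}"])
      (auto simp: zero_locus_def laurent_eval_1)
  then show ?thesis unfolding topspace_def openin_zariski by (auto simp: zero_locus_def)
qed

definition irreducible_closed :: "'a topology \<Rightarrow> 'a set \<Rightarrow> bool" where
  "irreducible_closed T Z \<longleftrightarrow> closedin T Z \<and> Z \<noteq> {} \<and>
     (\<forall>A B. closedin T A \<longrightarrow> closedin T B \<longrightarrow> Z = A \<union> B \<longrightarrow> Z = A \<or> Z = B)"

definition krull_dim :: "'a topology \<Rightarrow> 'a set \<Rightarrow> enat" where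
  "krull_dim T Z = Sup {enat k | k. \<exists>C :: nat \<Rightarrow> 'a set.
     (\<forall>i\<le>k. irreducible_closed T (C i) \<and> C i \<subseteq> Z) \<and> (\<forall>i<k. C i \<subset> C (Suc i))}"

definition irreducible_component :: "'a topology \<Rightarrow> 'a set \<Rightarrow> 'a set \<Rightarrow> bool" where
  "irreducible_component T S Z \<longleftrightarrow> irreducible_closed T Z \<and> Z \<subseteq> S \<and>
     (\<forall>Z'. irreducible_closed T Z' \<longrightarrow> Z' \<subseteq> S \<longrightarrow> Z \<subseteq> Z' \<longrightarrow> Z' = Z)"

definition dim_part :: "'a topology \<Rightarrow> enat \<Rightarrow> 'a set \<Rightarrow> 'a set" where
  "dim_part T d S = \<Union>{Z. irreducible_component T S Z \<and> krull_dim T Z = d}"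

section \<open>A-polynomials\<close>

text \<open>
  A-polynomials are defined up to units, that is, up to factors \<open>c \<lambda>\<^sup>a \<mu>\<^sup>b\<close> with \<open>c \<noteq> 0\<close>;
  the predicates below hold of every representative.
\<close>

definition is_A_polynomial ::
    "('g, 'b) monoid_scheme \<Rightarrow> 'g \<Rightarrow> 'g \<Rightarrow> nat \<Rightarrow> laurent2 \<Rightarrow> bool" where
  "is_A_polynomial G m l n F \<longleftrightarrow>
     (let V = zariski closure_of KCH_pairs G m l n in
       dim_part zariski 2 V = {} \<and> squarefree F \<and> zero_locus {F} = dim_part zariski 1 V)"

definition is_stable_A_polynomial ::
    "('g, 'b) monoid_scheme \<Rightarrow> 'g \<Rightarrow> 'g \<Rightarrow> laurent2 \<Rightarrow> bool" where
  "is_stable_A_polynomial G m l F \<longleftrightarrow> (\<forall>\<^sub>F n in sequentially. is_A_polynomial G m l n F)"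

definition unit_equiv :: "laurent2 \<Rightarrow> laurent2 \<Rightarrow> bool" where
  "unit_equiv F F' \<longleftrightarrow> (\<exists>u. u dvd 1 \<and> F = u * F')"

section \<open>The exceptional meridian eigenvalues\<close>

text \<open>
  The existence of an irreducible KCH representation of degree \<open>n \<le> p\<close> with prescribed meridian
  eigenvalue \<open>\<mu>0 \<noteq> 1\<close> fails in one family of cases, which has to be excluded.  In an irreducible
  representation of degree \<open>p \<ge> 2\<close>, \<open>x\<close> has all \<open>p\<close>-th roots of the scalar \<open>c = x\<^sup>p = y\<^sup>q\<close> as
  eigenvalues, whence \<open>c = (-1)\<^sup>p\<^sup>-\<^sup>1 \<mu>0\<^sup>q\<close>, and the eigenvalues of \<open>y\<close> are \<open>p\<close> distinct
  \<open>q\<close>-th roots of \<open>c\<close> with product \<open>\<mu>0\<^sup>p\<close>.  If \<open>c = 1\<close>, the eigenvalue \<open>1\<close> of \<open>x\<close> must not be an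
  eigenvalue of \<open>y\<close>.  For \<open>q = p + 1\<close> this leaves all non-trivial \<open>q\<close>-th roots of unity as the
  eigenvalues of \<open>y\<close>, with product \<open>(-1)\<^sup>p\<close>; together with \<open>c = 1\<close> this forces \<open>\<mu>0 = -1\<close>.  The smallest
  instance, the trefoil with \<open>\<mu>0\<close> a root of its Alexander polynomial, is worked out in
  \<open>trefoil_no_irreducible_KCH_rep\<close> below.
\<close>

definition exceptional_eigenvalue :: "nat \<Rightarrow> nat \<Rightarrow> nat \<Rightarrow> complex \<Rightarrow> bool" where
  "exceptional_eigenvalue p q n \<mu>0 \<longleftrightarrow>
     n = p \<and> 2 \<le> p \<and> q = p + 1 \<and> (- \<mu>0) ^ q = 1 \<and> \<mu>0 \<noteq> - 1"

lemma det_mat2: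
  assumes A: "A \<in> carrier_mat 2 2"
  shows "det A = A $$ (0,0) * A $$ (1,1) - A $$ (0,1) * (A $$ (1,0) :: complex)"
proof -
  have d: "mat_delete A 0 j \<in> carrier_mat 1 1" if "j < 2" for j
    using A by (auto simp: mat_delete_def)
  have s: "{..<2::nat} = {0,1}" by auto
  show ?thesis
    unfolding laplace_expansion_row[OF A, of 0, simplified] s
    using d[of 0] d[of 1] A
    by (simp add: cofactor_def det_single mat_delete_def)
qed

lemma mat2_mult:
  fixes A B :: "complex mat"
  assumes "A \<in> carrier_mat 2 2" "B \<in> carrier_mat 2 2" "i < 2" "j < 2"
  shows "(A * B) $$ (i,j) = A $$ (i,0) * B $$ (0,j) + A $$ (i,1) * B $$ (1,j)"
  using assms by (simp add: scalar_prod_def numeral_2_eq_2)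

lemma mat2_eq_iff:
  assumes "A \<in> carrier_mat 2 2" "B \<in> carrier_mat 2 2"
  shows "A = B \<longleftrightarrow> A $$ (0,0) = B $$ (0,0) \<and> A $$ (0,1) = B $$ (0,1)
    \<and> A $$ (1,0) = B $$ (1,0) \<and> A $$ (1,1) = B $$ (1,1)"
proof
  assume e: "A $$ (0,0) = B $$ (0,0) \<and> A $$ (0,1) = B $$ (0,1)
    \<and> A $$ (1,0) = B $$ (1,0) \<and> A $$ (1,1) = B $$ (1,1)"
  show "A = B"
  proof (rule eq_matI)
    fix i j assume "i < dim_row B" "j < dim_col B"
    then have "(i = 0 \<or> i = 1) \<and> (j = 0 \<or> j = 1)" using assms by auto
    with e show "A $$ (i,j) = B $$ (i,j)" by auto
  qed (use assms in auto)
qed simp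

lemma not_irreducible_kernel:
  fixes K :: "complex mat"
  assumes K: "K \<in> carrier_mat n n" "K \<noteq> 0\<^sub>m n n" "det K = 0"
    and \<rho>: "\<And>g. g \<in> carrier G \<Longrightarrow> \<rho> g \<in> carrier_mat n n"
    and T: "\<And>g. g \<in> carrier G \<Longrightarrow> \<exists>T\<in>carrier_mat n n. K * \<rho> g = T * K"
  shows "\<not> irreducible_rep G n \<rho>"
proof
  assume irr: "irreducible_rep G n \<rho>"
  let ?W = "{w \<in> carrier_vec n. K *\<^sub>v w = 0\<^sub>v n}"
  have "VectorSpace.subspace class_ring ?W (module_vec TYPE(complex) n)"
    unfolding VectorSpace.subspace_def LinearCombinations.submodule_def
    using K(1) vec_vs[where 'a = complex, of n] vec_module[where 'a = complex, of n]
    by (auto simp: module_vec_simps class_ring_simps mult_add_distrib_mat_vec mult_mat_vec)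
  moreover have "\<forall>g\<in>carrier G. \<forall>w\<in>?W. \<rho> g *\<^sub>v w \<in> ?W"
  proof (intro ballI)
    fix g w assume g: "g \<in> carrier G" and w: "w \<in> ?W"
    from T[OF g] obtain T where T: "T \<in> carrier_mat n n" "K * \<rho> g = T * K" by blast
    have w': "w \<in> carrier_vec n" "K *\<^sub>v w = 0\<^sub>v n" using w by auto
    have "K *\<^sub>v (\<rho> g *\<^sub>v w) = T *\<^sub>v (K *\<^sub>v w)"
      using assoc_mult_mat_vec[OF K(1) \<rho>[OF g] w'(1)] assoc_mult_mat_vec[OF T(1) K(1) w'(1)] T(2)
      by simp
    also have "\<dots> = 0\<^sub>v n" unfolding w'(2) using T(1) by (intro eq_vecI) auto
    finally show "\<rho> g *\<^sub>v w \<in> ?W" using \<rho>[OF g] w'(1) by simp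
  qed
  ultimately have "?W = {0\<^sub>v n} \<or> ?W = carrier_vec n"
    using irr unfolding irreducible_rep_def by blast
  moreover have "?W \<noteq> {0\<^sub>v n}"
    using det_0_iff_vec_prod_zero[OF K(1)] K(3) by auto
  moreover have "?W \<noteq> carrier_vec n"
  proof
    assume W: "?W = carrier_vec n"
    have "K = 0\<^sub>m n n"
    proof (rule eq_matI)
      fix i j assume ij: "i < dim_row (0\<^sub>m n n :: complex mat)" "j < dim_col (0\<^sub>m n n :: complex mat)"
      have "unit_vec n j \<in> ?W" unfolding W by simp
      then have "K *\<^sub>v unit_vec n j = 0\<^sub>v n" by blast
      then have "(K *\<^sub>v unit_vec n j) $ i = 0" using ij by simp
      then show "K $$ (i,j) = 0\<^sub>m n n $$ (i,j)" using ij K(1) by simp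
    qed (use K in auto)
    with K(2) show False by simp
  qed
  ultimately show False by blast
qed

lemma GL_D:
  assumes "A \<in> carrier (GL n)"
  shows "A \<in> carrier_mat n n"
    "\<exists>B. B \<in> carrier (GL n) \<and> A * B = 1\<^sub>m n \<and> B * A = 1\<^sub>m n"
  using assms by (auto simp: units_of_def Units_def ring_mat_simps)

lemma intertwine_presented:
  assumes \<rho>: "\<rho> \<in> hom (presented_group R) (GL n)"
    and K: "K \<in> carrier_mat n n"
    and gen: "\<And>g. \<exists>T\<in>carrier (GL n). K * \<rho> (pres_gen R g) = T * K"
    and a: "a \<in> carrier (presented_group R)"
  shows "\<exists>T\<in>carrier_mat n n. K * \<rho> a = T * K"
proof -
  let ?G = "presented_group R"
  interpret group ?G by (rule group_presented_group)
  have c: "\<rho> g \<in> carrier_mat n n" if "g \<in> carrier ?G" for g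
    using hom_in_carrier[OF \<rho> that] GL_D(1) by blast
  have mult: "\<rho> (g \<otimes>\<^bsub>?G\<^esub> h) = \<rho> g * \<rho> h" if "g \<in> carrier ?G" "h \<in> carrier ?G" for g h
    using hom_mult[OF \<rho> that] by (simp add: units_of_def ring_mat_simps)
  have GLgrp: "group (GL n)"
    using ring_mat[where 'a = complex and n = n and b = "()"] by (intro monoid.units_group) (simp add: ring.is_monoid)
  have one: "\<rho> \<one>\<^bsub>?G\<^esub> = 1\<^sub>m n"
    using hom_one[OF \<rho> is_group GLgrp] by (simp add: units_of_def ring_mat_simps)
  have letter: "\<exists>T\<in>carrier_mat n n. K * \<rho> (pres_rel R `` {[(g, b)]}) = T * K" for g b
  proof (cases b)
    case True
    then show ?thesis using gen[of g] GL_D(1) unfolding pres_gen_def by fastforce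
  next
    case False
    let ?g = "pres_gen R g"
    let ?A = "\<rho> ?g" and ?B = "\<rho> (inv\<^bsub>?G\<^esub> ?g)"
    obtain T where T: "T \<in> carrier (GL n)" "K * ?A = T * K" using gen by blast
    from GL_D[OF T(1)] obtain T' where T': "T \<in> carrier_mat n n" "T' \<in> carrier_mat n n" "T' * T = 1\<^sub>m n"
      using GL_D(1) by blast
    have AB: "?A * ?B = 1\<^sub>m n" using mult[of ?g "inv\<^bsub>?G\<^esub> ?g"] one by simp
    have cA: "?A \<in> carrier_mat n n" "?B \<in> carrier_mat n n" by (auto intro: c)
    have "T' * K = T' * (K * (?A * ?B))" using K AB by simp
    also have "\<dots> = T' * ((K * ?A) * ?B)" using K cA by (simp add: assoc_mult_mat[of _ n n _ n _ n])
    also have "\<dots> = T' * (T * (K * ?B))" unfolding T(2) using assoc_mult_mat[OF T'(1) K cA(2)] by simp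
    also have "\<dots> = (T' * T) * (K * ?B)" using assoc_mult_mat[OF T'(2) T'(1), of "K * ?B" n] K cA by simp
    also have "\<dots> = K * ?B" unfolding T'(3) using K cA by simp
    finally have "K * ?B = T' * K" ..
    then show ?thesis using False T'(2) by (auto simp: pres_inv_gen)
  qed
  from a obtain w where a: "a = pres_rel R `` {w}" by (rule pres_carrierE)
  show ?thesis unfolding a
  proof (induction w)
    case Nil
    show ?case using one K by (auto simp: pres_one[symmetric] intro!: bexI[of _ "1\<^sub>m n"])
  next
    case (Cons x w)
    obtain T where T: "T \<in> carrier_mat n n" "K * \<rho> (pres_rel R `` {[x]}) = T * K"
      using letter[of "fst x" "snd x"] by auto
    obtain T' where T': "T' \<in> carrier_mat n n" "K * \<rho> (pres_rel R `` {w}) = T' * K"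
      using Cons by blast
    let ?A = "\<rho> (pres_rel R `` {[x]})" and ?B = "\<rho> (pres_rel R `` {w})"
    have cA: "?A \<in> carrier_mat n n" "?B \<in> carrier_mat n n" by (auto intro: c)
    have "\<rho> (pres_rel R `` {x # w}) = ?A * ?B"
      using mult[of "pres_rel R `` {[x]}" "pres_rel R `` {w}"] by (simp add: pres_class_mult)
    then have "K * \<rho> (pres_rel R `` {x # w}) = (K * ?A) * ?B"
      using K cA by (simp add: assoc_mult_mat[of _ n n _ n _ n])
    also have "\<dots> = T * (K * ?B)" unfolding T(2) using K cA T by (simp add: assoc_mult_mat[of _ n n _ n _ n])
    also have "\<dots> = (T * T') * K" unfolding T'(2) using K T T' by (simp add: assoc_mult_mat[of _ n n _ n _ n])
    finally show ?case using T T' by (intro bexI[of _ "T * T'"]) auto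
  qed
qed

lemma trefoil_matrices:
  fixes x1 x2 x3 x4 y1 y2 y3 y4 e f g h \<mu> :: complex
  assumes \<mu>: "\<mu>^2 - \<mu> + 1 = 0"
    and M: "e * h - f * g = \<mu>" "e + h = 1 + \<mu>"
    and X: "x1 = e * y1 + f * y3" "x2 = e * y2 + f * y4" "x3 = g * y1 + h * y3" "x4 = g * y2 + h * y4"
    and D: "y1 * y4 - y2 * y3 \<noteq> 0"
    and rel: "x1*x1+x2*x3 = (y1*y1+y2*y3)*y1 + (y1*y2+y2*y4)*y3"
      "x1*x2+x2*x4 = (y1*y1+y2*y3)*y2 + (y1*y2+y2*y4)*y4"
      "x3*x1+x4*x3 = (y3*y1+y4*y3)*y1 + (y3*y2+y4*y4)*y3"
      "x3*x2+x4*x4 = (y3*y1+y4*y3)*y2 + (y3*y2+y4*y4)*y4"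
  shows "(x2*y3 - y2*x3) * (x3*y2 - y3*x2)
    = (x1*y2+x2*y4 - y1*x2 - y2*x4) * (x3*y1+x4*y3 - y3*x1 - y4*x3)"
proof -
  define dY tY dX tX where d: "dY = y1 * y4 - y2 * y3" "tY = y1 + y4" "dX = x1 * x4 - x2 * x3" "tX = x1 + x4"
  have dX: "dX = \<mu> * dY" unfolding d X M(1)[symmetric] by (simp add: algebra_simps)
  have "dX ^ 2 = (x1*x1+x2*x3) * (x3*x2+x4*x4) - (x1*x2+x2*x4) * (x3*x1+x4*x3)"
    unfolding d by (simp add: algebra_simps power2_eq_square)
  also have "\<dots> = dY ^ 3"
    unfolding rel d by (simp add: algebra_simps power3_eq_cube)
  finally have "dX ^ 2 = dY ^ 3" .
  then have "dY ^ 2 * (dY - \<mu>^2) = 0"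
    unfolding dX by (auto simp add: algebra_simps power2_eq_square power3_eq_cube)
  then have dY: "dY = \<mu>^2" using D by (simp add: d)
  have "\<mu>^3 + 1 = (\<mu> + 1) * (\<mu>^2 - \<mu> + 1)"
    by (simp add: algebra_simps power2_eq_square power3_eq_cube)
  then have mu3: "\<mu>^3 = -1" using \<mu> by (simp add: eq_neg_iff_add_eq_0)
  have dX': "dX = -1" using dX dY mu3 by (simp add: power2_eq_square power3_eq_cube mult.assoc)
  have tM: "tX * tY - (x1*y1+x2*y3+x3*y2+x4*y4) = dY * (1 + \<mu>)"
    unfolding d X M(2)[symmetric] by (simp add: algebra_simps)
  show ?thesis
  proof (cases "tX = 0")
    case False
    have "tX * (x2*y3 - y2*x3) = (x1*x2+x2*x4) * y3 - y2 * (x3*x1+x4*x3)"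
      unfolding d by (simp add: algebra_simps)
    also have "\<dots> = 0" unfolding rel by (simp add: algebra_simps)
    finally have 1: "x2*y3 - y2*x3 = 0" using False by simp
    have "tX * (x1*y2+x2*y4 - y1*x2 - y2*x4)
        = (x1*x1+x2*x3)*y2 + (x1*x2+x2*x4)*y4 - y1*(x1*x2+x2*x4) - y2*(x3*x2+x4*x4)"
      unfolding d by (simp add: algebra_simps)
    also have "\<dots> = 0" unfolding rel by (simp add: algebra_simps)
    finally have 2: "x1*y2+x2*y4 - y1*x2 - y2*x4 = 0" using False by simp
    show ?thesis using 1 2 by simp
  next
    case True
    have x4: "x4 = - x1" using True unfolding d by (simp add: eq_neg_iff_add_eq_0 add.commute)
    have "x1*x1+x2*x3 = - dX" unfolding d x4 by simp
    then have x: "x1*x1+x2*x3 = 1" unfolding dX' by simp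
    have "(tY^2 - dY) * y2 = x1*x2+x2*x4" "(tY^2 - dY) * y3 = x3*x1+x4*x3"
      "(tY^2 - dY) * (y1 - y4) = (x1*x1+x2*x3) - (x3*x2+x4*x4)"
      unfolding d rel by (simp_all add: algebra_simps power2_eq_square)
    then have c: "(tY^2 - dY) * y2 = 0" "(tY^2 - dY) * y3 = 0" "(tY^2 - dY) * (y1 - y4) = 0"
      unfolding x4 by (simp_all add: algebra_simps)
    show ?thesis
    proof (cases "tY^2 = dY")
      case False
      then have "y2 = 0" "y3 = 0" "y1 = y4" using c by auto
      then show ?thesis by simp
    next
      case t2: True
      define w where "w = x1*y1+x2*y3+x3*y2+x4*y4"
      have w: "w = - (dY * (1 + \<mu>))" using tM True unfolding w_def by (metis minus_equation_iff mult_zero_left diff_0)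
      have "w^2 + 3 * dY = \<mu>^4 * (\<mu>^2 - \<mu> + 1) + 3 * \<mu>^2 * (\<mu>^3 + 1)"
        unfolding w dY by (simp add: algebra_simps power2_eq_square power3_eq_cube power4_eq_xxxx)
      also have "\<dots> = 0" using \<mu> mu3 by simp
      finally have w2: "w^2 + 3 * dY = 0" .
      have "(x2*y3 - y2*x3) * (x3*y2 - y3*x2)
          - (x1*y2+x2*y4 - y1*x2 - y2*x4) * (x3*y1+x4*y3 - y3*x1 - y4*x3)
        = (x1*x1+x2*x3) * (tY^2 - 4 * dY) - w^2"
        unfolding w_def d x4 by (simp add: algebra_simps power2_eq_square)
      also have "\<dots> = - (w^2 + 3 * dY)" unfolding x t2 by (simp add: algebra_simps)
      finally show ?thesis unfolding w2 by simp
    qed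
  qed
qed


lemma (in monoid) pow2: "x \<in> carrier G \<Longrightarrow> x [^] (2::nat) = x \<otimes> x"
  by (simp add: numeral_2_eq_2)

lemma (in monoid) pow3: "x \<in> carrier G \<Longrightarrow> x [^] (3::nat) = (x \<otimes> x) \<otimes> x"
  by (simp add: numeral_3_eq_3)

lemma one_less2: "(1::nat) < 2" by simp

lemmas mat2_mult4 = mat2_mult[OF _ _ pos2 pos2] mat2_mult[OF _ _ pos2 one_less2]
  mat2_mult[OF _ _ one_less2 pos2] mat2_mult[OF _ _ one_less2 one_less2]

lemma mat2_commutator:
  fixes A B Z :: "complex mat"
  assumes AB: "A \<in> carrier_mat 2 2" "B \<in> carrier_mat 2 2" and Z: "Z = A \<or> Z = B" "det Z \<noteq> 0"
  shows "\<exists>T\<in>carrier (GL 2). (A * B - B * A) * Z = T * (A * B - B * A)"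
proof -
  let ?C = "A * B - B * A"
  let ?T = "(Z $$ (0,0) + Z $$ (1,1)) \<cdot>\<^sub>m 1\<^sub>m 2 - Z"
  have cZ: "Z \<in> carrier_mat 2 2" using AB Z by auto
  have c: "?T \<in> carrier_mat 2 2" "?C \<in> carrier_mat 2 2" using cZ AB by auto
  have T: "?T $$ (0,0) = Z $$ (1,1)" "?T $$ (1,1) = Z $$ (0,0)"
    "?T $$ (0,1) = - Z $$ (0,1)" "?T $$ (1,0) = - Z $$ (1,0)"
    using cZ by auto
  have C: "?C $$ (i,j) = A $$ (i,0) * B $$ (0,j) + A $$ (i,1) * B $$ (1,j)
      - (B $$ (i,0) * A $$ (0,j) + B $$ (i,1) * A $$ (1,j))" if "i < 2" "j < 2" for i j
    using that AB mat2_mult[OF AB that] mat2_mult[OF AB(2,1) that] by simp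
  note C4 = C[OF pos2 pos2] C[OF pos2 one_less2] C[OF one_less2 pos2] C[OF one_less2 one_less2]
  have c': "?C * Z \<in> carrier_mat 2 2" "?T * ?C \<in> carrier_mat 2 2"
    using mult_carrier_mat[OF c(2) cZ] mult_carrier_mat[OF c] .
  have "?C * Z = ?T * ?C"
    unfolding mat2_eq_iff[OF c'] mat2_mult4[OF c(2) cZ] mat2_mult4[OF c] T C4
    using Z(1) by (elim disjE) (simp_all add: algebra_simps)
  moreover have "det ?T \<noteq> 0"
    using Z(2) unfolding det_mat2[OF c(1)] det_mat2[OF cZ] T by (simp add: algebra_simps)
  then have "?T \<in> carrier (GL 2)"
    using det_non_zero_imp_unit[OF c(1), of "()"] by (simp add: units_of_def)
  ultimately show ?thesis by blast
qed

theorem trefoil_no_irreducible_KCH_rep: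
  fixes \<mu>0 :: complex
  assumes \<mu>: "\<mu>0 ^ 2 - \<mu>0 + 1 = 0"
  shows "\<not> (\<exists>\<rho>. KCH_rep (torus_knot_group 2 3) (torus_meridian 2 3 (- 1) 1) 2 \<rho> \<and>
            irreducible_rep (torus_knot_group 2 3) 2 \<rho> \<and>
            eigenvalue (\<rho> (torus_meridian 2 3 (- 1) 1)) \<mu>0)"
proof
  let ?G = "torus_knot_group 2 3" and ?m = "torus_meridian 2 3 (- 1) 1"
  let ?R = "torus_relators 2 3"
  let ?x = "pres_gen ?R X" and ?y = "pres_gen ?R Y"
  have G: "?G = presented_group ?R" by (simp add: torus_knot_group_def)
  interpret group ?G unfolding G by (rule group_presented_group)
  have GLgrp: "group (GL 2)"
    using ring_mat[where 'a = complex and n = 2 and b = "()"] by (intro monoid.units_group) (simp add: ring.is_monoid)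
  assume "\<exists>\<rho>. KCH_rep ?G ?m 2 \<rho> \<and> irreducible_rep ?G 2 \<rho> \<and> eigenvalue (\<rho> ?m) \<mu>0"
  then obtain \<rho> where kch: "KCH_rep ?G ?m 2 \<rho>" and irr: "irreducible_rep ?G 2 \<rho>"
    and ev: "eigenvalue (\<rho> ?m) \<mu>0" by blast
  from kch have \<rho>: "\<rho> \<in> hom ?G (GL 2)" and ord: "Polynomial.order 1 (char_poly (\<rho> ?m)) = 1"
    by (simp_all add: KCH_rep_def)
  have c: "\<rho> g \<in> carrier_mat 2 2" if "g \<in> carrier ?G" for g
    using hom_in_carrier[OF \<rho> that] GL_D(1) by blast
  have mult: "\<rho> (g \<otimes>\<^bsub>?G\<^esub> h) = \<rho> g * \<rho> h" if "g \<in> carrier ?G" "h \<in> carrier ?G" for g h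
    using hom_mult[OF \<rho> that] by (simp add: units_of_def ring_mat_simps)
  have gc: "?x \<in> carrier ?G" "?y \<in> carrier ?G" by (simp_all add: G)
  have m: "?m = ?x \<otimes>\<^bsub>?G\<^esub> inv\<^bsub>?G\<^esub> ?y"
    using gc unfolding torus_meridian_def by (simp add: int_pow_neg_int int_pow_1 int_pow_neg)
  then have mc: "?m \<in> carrier ?G" using gc by simp
  have xm: "?x = ?m \<otimes>\<^bsub>?G\<^esub> ?y" unfolding m using gc by (simp add: m_assoc)
  define M A B where defs: "M = \<rho> ?m" "A = \<rho> ?x" "B = \<rho> ?y"
  have cM: "M \<in> carrier_mat 2 2" "A \<in> carrier_mat 2 2" "B \<in> carrier_mat 2 2"
    using c gc mc by (auto simp: defs)
  have A: "A = M * B" using mult[OF mc gc(2)] xm by (simp add: defs)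
  have "?x [^]\<^bsub>?G\<^esub> (2::nat) = ?y [^]\<^bsub>?G\<^esub> (3::nat)" by (rule torus_relation)
  then have "?x \<otimes>\<^bsub>?G\<^esub> ?x = (?y \<otimes>\<^bsub>?G\<^esub> ?y) \<otimes>\<^bsub>?G\<^esub> ?y"
    using gc by (simp only: pow2 pow3)
  then have rel: "A * A = (B * B) * B" using gc mult by (metis defs(2,3) m_closed)
  have dets: "det A \<noteq> 0" "det B \<noteq> 0"
  proof -
    have "det (\<rho> g) \<noteq> 0" if g: "g \<in> carrier ?G" for g
    proof -
      from GL_D(2)[OF hom_in_carrier[OF \<rho> g]] obtain T where T: "T \<in> carrier_mat 2 2" "\<rho> g * T = 1\<^sub>m 2"
        using GL_D(1) by blast
      from arg_cong[OF T(2), of det] show ?thesis using det_mult[OF c[OF g] T(1)] by auto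
    qed
    then show "det A \<noteq> 0" "det B \<noteq> 0" using gc by (simp_all add: defs)
  qed
  have root: "(M $$ (0,0) - k) * (M $$ (1,1) - k) - M $$ (0,1) * M $$ (1,0) = 0" if "eigenvalue M k" for k
    using that cM unfolding eigenvalue_det[OF cM(1)]
    by (subst (asm) det_mat2) (auto simp: char_matrix_def)
  have "poly (char_poly M) 1 = 0"
    using ord order_root[of "char_poly M" 1] by (auto simp: defs)
  then have ev1: "eigenvalue M 1" using eigenvalue_root_char_poly[OF cM(1)] by simp
  have ev\<mu>: "eigenvalue M \<mu>0" using ev by (simp add: defs)
  have ne1: "\<mu>0 \<noteq> 1" using \<mu> by auto
  note r1 = root[OF ev1] and r2 = root[OF ev\<mu>]
  have "(\<mu>0 - 1) * (M $$ (0,0) + M $$ (1,1) - (1 + \<mu>0))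
     = ((M $$ (0,0) - 1) * (M $$ (1,1) - 1) - M $$ (0,1) * M $$ (1,0))
       - ((M $$ (0,0) - \<mu>0) * (M $$ (1,1) - \<mu>0) - M $$ (0,1) * M $$ (1,0))"
    by (simp add: algebra_simps)
  then have tr: "M $$ (0,0) + M $$ (1,1) = 1 + \<mu>0" using r1 r2 ne1 by simp
  have "M $$ (0,0) * M $$ (1,1) - M $$ (0,1) * M $$ (1,0)
     = ((M $$ (0,0) - 1) * (M $$ (1,1) - 1) - M $$ (0,1) * M $$ (1,0)) + (M $$ (0,0) + M $$ (1,1)) - 1"
    by (simp add: algebra_simps)
  then have dM: "M $$ (0,0) * M $$ (1,1) - M $$ (0,1) * M $$ (1,0) = \<mu>0"
    unfolding r1 tr by simp
  have AB: "A * B \<in> carrier_mat 2 2" "B * A \<in> carrier_mat 2 2" "A * A \<in> carrier_mat 2 2"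
     "B * B \<in> carrier_mat 2 2" "B * B * B \<in> carrier_mat 2 2" using cM by auto
  note ent = mat2_mult4[OF cM(2) cM(2)] mat2_mult4[OF cM(3) cM(3)] mat2_mult4[OF AB(4) cM(3)]
  note relent = rel[unfolded mat2_eq_iff[OF AB(3) AB(5)] ent]
  have Aent: "A $$ (i,j) = M $$ (i,0) * B $$ (0,j) + M $$ (i,1) * B $$ (1,j)" if "i < 2" "j < 2" for i j
    unfolding A using mat2_mult[OF cM(1) cM(3) that] .
  define C where "C = A * B - B * A"
  have cC: "C \<in> carrier_mat 2 2" unfolding C_def by (rule minus_carrier_mat[OF AB(2)])
  have "(A $$ (0,1) * B $$ (1,0) - B $$ (0,1) * A $$ (1,0)) * (A $$ (1,0) * B $$ (0,1) - B $$ (1,0) * A $$ (0,1))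
    = (A $$ (0,0) * B $$ (0,1) + A $$ (0,1) * B $$ (1,1) - B $$ (0,0) * A $$ (0,1) - B $$ (0,1) * A $$ (1,1))
     * (A $$ (1,0) * B $$ (0,0) + A $$ (1,1) * B $$ (1,0) - B $$ (1,0) * A $$ (0,0) - B $$ (1,1) * A $$ (1,0))"
    by (rule trefoil_matrices[OF \<mu> dM tr])
      (use relent dets(2)[unfolded det_mat2[OF cM(3)]] in \<open>auto simp: Aent\<close>)
  moreover have C: "C $$ (i,j) = A $$ (i,0) * B $$ (0,j) + A $$ (i,1) * B $$ (1,j)
      - (B $$ (i,0) * A $$ (0,j) + B $$ (i,1) * A $$ (1,j))" if "i < 2" "j < 2" for i j
    using that cM mat2_mult[OF cM(2,3) that] mat2_mult[OF cM(3,2) that] by (simp add: C_def)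
  note C4 = C[OF pos2 pos2] C[OF pos2 one_less2] C[OF one_less2 pos2] C[OF one_less2 one_less2]
  ultimately have detC: "det C = 0"
    unfolding det_mat2[OF cC] C4 by (simp add: algebra_simps)
  show False
  proof (cases "C = 0\<^sub>m 2 2")
    case False
    have "\<exists>T\<in>carrier (GL 2). C * \<rho> (pres_gen ?R g) = T * C" for g
    proof (cases g)
      case X
      from mat2_commutator[OF cM(2,3) _ dets(1)] show ?thesis
        unfolding X C_def[symmetric] defs(2)[symmetric] by blast
    next
      case Y
      from mat2_commutator[OF cM(2,3) _ dets(2)] show ?thesis
        unfolding Y C_def[symmetric] defs(3)[symmetric] by blast
    qed
    from intertwine_presented[OF \<rho>[unfolded G] cC this, folded G]
    have "\<exists>T\<in>carrier_mat 2 2. C * \<rho> g = T * C" if "g \<in> carrier ?G" for g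
      using that .
    from not_irreducible_kernel[OF cC False detC c this] irr show False by (rule notE)
  next
    case True
    have AB_BA: "A * B = B * A"
    proof (rule eq_matI)
      fix i j assume ij: "i < dim_row (B * A)" "j < dim_col (B * A)"
      then have "C $$ (i,j) = 0" using cM unfolding True by auto
      then show "(A * B) $$ (i,j) = (B * A) $$ (i,j)" using ij AB unfolding C_def by simp
    qed (use cM in auto)
    obtain B' where B': "B' \<in> carrier_mat 2 2" "B * B' = 1\<^sub>m 2"
      using GL_D[OF hom_in_carrier[OF \<rho> gc(2)]] GL_D(1) unfolding defs by blast
    have MBc: "M * B \<in> carrier_mat 2 2" "B * M \<in> carrier_mat 2 2" using cM by auto
    have "(M * B) * B = (B * M) * B"
      using AB_BA unfolding A assoc_mult_mat[OF cM(3,1,3)] .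
    then have "((M * B) * B) * B' = ((B * M) * B) * B'" by simp
    then have MB: "M * B = B * M"
      unfolding assoc_mult_mat[OF MBc(1) cM(3) B'(1)] assoc_mult_mat[OF MBc(2) cM(3) B'(1)] B'(2)
        right_mult_one_mat[OF MBc(1)] right_mult_one_mat[OF MBc(2)] .
    have "M * (M * B) = M * (B * M)" unfolding MB ..
    also have "\<dots> = (M * B) * M" using assoc_mult_mat[OF cM(1,3,1)] by simp
    finally have MA: "M * A = A * M" unfolding A .
    define K where "K = char_matrix M 1"
    have K: "K = M - 1\<^sub>m 2" unfolding K_def char_matrix_def using cM by (intro eq_matI) auto
    have cK: "K \<in> carrier_mat 2 2" using cM unfolding K by auto
    have detK: "det K = 0" using ev1 eigenvalue_det[OF cM(1)] by (simp add: K_def)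
    have K0: "K \<noteq> 0\<^sub>m 2 2"
    proof
      assume "K = 0\<^sub>m 2 2"
      then have "K $$ (0,0) = 0" "K $$ (1,1) = 0" by auto
      then have "M $$ (0,0) = 1" "M $$ (1,1) = 1" unfolding K using cM by auto
      with tr ne1 show False by simp
    qed
    have "\<exists>T\<in>carrier (GL 2). K * \<rho> (pres_gen ?R g) = T * K" for g
    proof -
      have "K * Z = Z * K" if "M * Z = Z * M" "Z \<in> carrier_mat 2 2" for Z
        unfolding K using that cM by (simp add: minus_mult_distrib_mat[of _ 2 2] mult_minus_distrib_mat[of _ 2 2])
      then have "K * \<rho> (pres_gen ?R g) = \<rho> (pres_gen ?R g) * K"
        using MA MB cM by (cases g) (auto simp: defs)
      moreover have "\<rho> (pres_gen ?R g) \<in> carrier (GL 2)"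
        using hom_in_carrier[OF \<rho>] gc by (cases g) auto
      ultimately show ?thesis by blast
    qed
    from intertwine_presented[OF \<rho>[unfolded G] cK this, folded G]
    have "\<exists>T\<in>carrier_mat 2 2. K * \<rho> g = T * K" if "g \<in> carrier ?G" for g
      using that .
    from not_irreducible_kernel[OF cK K0 detK c this] irr show False by (rule notE)
  qed
qed

lemma trefoil_exceptional:
  "exceptional_eigenvalue 2 3 2 \<mu>0 \<longleftrightarrow> \<mu>0 ^ 2 - \<mu>0 + 1 = 0"
proof -
  have "(- \<mu>0) ^ 3 - 1 = - ((\<mu>0 + 1) * (\<mu>0 ^ 2 - \<mu>0 + 1))"
    by (simp add: algebra_simps power2_eq_square power3_eq_cube)
  then have "(- \<mu>0) ^ 3 = 1 \<longleftrightarrow> \<mu>0 = - 1 \<or> \<mu>0 ^ 2 - \<mu>0 + 1 = 0"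
    by (metis eq_iff_diff_eq_0 eq_neg_iff_add_eq_0 mult_eq_0_iff neg_equal_0_iff_equal)
  moreover have "\<mu>0 \<noteq> - 1" if "\<mu>0 ^ 2 - \<mu>0 + 1 = 0" using that by auto
  ultimately show ?thesis unfolding exceptional_eigenvalue_def by auto
qed

end

theory Submission
  imports Defs
    "HOL-Computational_Algebra.Polynomial_FPS"
    "HOL-Computational_Algebra.Polynomial_Factorial"
    "HOL-Computational_Algebra.Field_as_Ring"
begin

text \<open>
  Put \<open>A = \<rho>(x\<^sup>s)\<close> and \<open>B = \<rho>(y\<^sup>-\<^sup>r)\<close>, so that \<open>\<rho>(m) = A B\<^sup>-\<^sup>1\<close>.  For a KCH representation, \<open>A - B\<close> has
  rank one with image spanned by the eigenvector \<open>e\<close>, and the central element \<open>x\<^sup>p = y\<^sup>q\<close> acts on \<open>e\<close> by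
  \<open>c = \<lambda> \<mu>\<^sup>p\<^sup>q\<close>.  Hence the rational function \<open>det (t - B) / det (t - A)\<close>, restricted to the submodule
  generated by \<open>e\<close>, is a quotient of products of \<open>k\<close> factors whose roots satisfy \<open>b\<^sup>q = c\<^sup>-\<^sup>r\<close> and
  \<open>a\<^sup>p = c\<^sup>s\<close>, with \<open>1 \<le> k \<le> p\<close>; its value \<open>1 / \<mu>\<close> at \<open>0\<close> gives \<open>c\<^sup>k = \<mu>\<^sup>p\<^sup>q\<close>, and
  \<open>c = (-1)\<^sup>p\<^sup>-\<^sup>1 \<mu>\<^sup>q\<close> if \<open>k = p\<close>.

  Conversely, prescribe disjoint sets of \<open>n\<close> such roots \<open>a\<^sub>i\<close> and \<open>b\<^sub>j\<close>.  Conjugating \<open>diag(b)\<close> by the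
  Cauchy matrix \<open>1 / (a\<^sub>i - b\<^sub>j)\<close> yields a matrix that differs from \<open>diag(a)\<close> by rank one, and an irreducible
  KCH representation of degree \<open>n\<close> with \<open>\<mu> = \<Prod> a\<^sub>i / b\<^sub>i\<close>.  Adding trivial summands realises all but
  finitely many points of the curves in every degree \<open>N \<ge> p\<close>.

  The curves \<open>\<lambda>\<^sup>n \<mu>\<^sup>m = \<kappa>\<close> with \<open>n\<close> and \<open>m\<close> coprime are parametrised by \<open>\<complex>\<^sup>*\<close>, so a Laurent polynomial
  vanishing at infinitely many points of one of them vanishes on it and is divisible by its equation.
\<close>

text \<open>The powers \<open>x^s\<close> and \<open>y^-r\<close> replace \<open>x\<close> and
  \<open>y\<close> because their quotient is the meridian, and nothing is lost:
  \<open>rp + sq = 1\<close> recovers \<open>x\<close> from \<open>x^s\<close> and the central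
  element. The same identity produces the exponents: if \<mu> is the quotient of \<open>k\<close>
  factors \<open>a\<close> by \<open>k\<close> factors \<open>b\<close>, then \<mu>^(pq) = c^(k(sq +
  rp)) = c^k. For k = p all p-th roots of c^s occur, so their product is known and a q-th power
  suffices.

  A KCH representation need not be irreducible. The moments of \<open>A\<close> and \<open>B\<close>
  at \<open>e\<close> only see the submodule generated by \<open>e\<close>, so nothing has to be
  decomposed and one argument serves all degrees.

  Two obstacles shape the rest. A factor \<lambda>^n \<mu>^((n-1)pq) - 1 is reducible when n and pq
  have a common factor, so it is split into binomials with coprime exponents before irreducibility
  is used. And the construction must keep 1 from being a common eigenvalue of \<open>x\<close> and
  \<open>y\<close>, which is automatic for c \<noteq> 1; on the curves c = 1 makes \<mu> a root of
  unity, so at most finitely many points are missed.\<close>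

section \<open>Roots of unity\<close>

text \<open>As polynomials in \<open>z\<close>, both sides are monic of degree \<open>n\<close> and
  agree at the \<open>n\<close> roots of \<open>c\<close>.\<close>

lemma prod_nth_roots:
  fixes c z :: complex
  assumes "n > 0" "c \<noteq> 0"
  shows "(\<Prod>w\<in>{w. w ^ n = c}. z - w) = z ^ n - c"
proof -
  let ?A = "{w. w ^ n = c}"
  have fin: "finite ?A" and card: "card ?A = n"
    using assms by (auto intro: finite_nth_roots card_nth_roots)
  have deg: "degree (\<Prod>w\<in>?A. [:- w, 1:]) = n"
    by (subst degree_prod_eq_sum_degree) (auto simp: card)
  have lead: "coeff (\<Prod>w\<in>?A. [:- w, 1:]) n = 1"
    using lead_coeff_prod[of "\<lambda>w. [:- w, 1:]" ?A] deg by simp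
  have deg': "degree (monom 1 n - [:c:]) \<le> n"
    by (intro degree_diff_le) (auto simp: degree_monom_le)
  have "(\<Prod>w\<in>?A. [:- w, 1:]) = monom 1 n - [:c:]"
  proof (rule poly_eqI_degree_lead_coeff[where n = n and A = ?A])
    show "coeff (\<Prod>w\<in>?A. [:- w, 1:]) n = coeff (monom 1 n - [:c:]) n"
      using lead assms by (auto simp: coeff_pCons split: nat.splits)
    fix x assume "x \<in> ?A"
    then show "poly (\<Prod>w\<in>?A. [:- w, 1:]) x = poly (monom 1 n - [:c:]) x"
      using fin by (auto simp: poly_prod poly_monom)
  qed (use card deg deg' in auto)
  from arg_cong[OF this, of "\<lambda>P. poly P z"] show ?thesis
    by (simp add: poly_prod poly_monom)
qed

lemma prod_roots_unity:
  assumes "n > 0"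
  shows "(\<Prod>w\<in>{w::complex. w ^ n = 1}. w) = (-1) ^ (n - 1)"
proof -
  have "(\<Prod>w\<in>{w::complex. w ^ n = 1}. - 1 * w) = - 1"
    using prod_nth_roots[of n 1 0] assms by (simp add: power_0_left)
  then have "(-1) ^ n * (\<Prod>w\<in>{w::complex. w ^ n = 1}. w) = - 1"
    using assms by (simp only: prod.distrib prod_constant card_roots_unity_eq)
  then have "(-1) ^ n * ((-1) ^ n * (\<Prod>w\<in>{w::complex. w ^ n = 1}. w)) = (-1) ^ n * - 1"
    by simp
  then show ?thesis using assms by (cases n) (auto simp flip: mult.assoc power_add)
qed

text \<open>The sums of \<open>k\<close>-element subsets fill the whole interval between the least
  and the greatest one. In the inductive step the new element \<open>m\<close> is left out while the
  target is within reach of subsets of \<open>{..<m}\<close>, and taken otherwise.\<close>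

lemma ex_subset_sum:
  fixes k m t :: nat
  assumes "k \<le> m" "t \<le> k * (m - k)"
  shows "\<exists>S\<subseteq>{..<m}. card S = k \<and> \<Sum>S = \<Sum>{..<k} + t"
  using assms
proof (induction m arbitrary: k t)
  case (Suc m)
  show ?case
  proof (cases "k = Suc m")
    case True
    with Suc.prems show ?thesis by (intro exI[of _ "{..<Suc m}"]) auto
  next
    case False
    then have k: "k \<le> m" using Suc.prems by simp
    show ?thesis
    proof (cases "t \<le> k * (m - k)")
      case True
      from Suc.IH[OF k True] obtain S where "S \<subseteq> {..<m}" "card S = k" "\<Sum>S = \<Sum>{..<k} + t" by blast
      then show ?thesis by (intro exI[of _ S]) auto
    next
      case False
      have "k \<noteq> 0" using False Suc.prems by (cases "k = 0") auto
      then obtain k' where k': "k = Suc k'" by (cases k) auto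
      obtain d where d: "m = k + d" using k le_Suc_ex by blast
      have t1: "k * d < t" using False d by simp
      have t2: "t \<le> k * d + k" using Suc.prems(2) d by (simp add: Suc_diff_le algebra_simps)
      have "d \<le> k * d" using k' by simp
      then have t3: "Suc d \<le> t" using t1 by linarith
      \<comment> \<open>\<open>Suc d\<close> is \<open>m - k'\<close>, the amount by which
        \<open>m\<close> exceeds the element \<open>k'\<close> that it replaces in the minimal
        subset \<open>{..<k}\<close>.\<close>
      have "t - Suc d \<le> k' * (m - k')" using t2 k' d by (simp add: algebra_simps)
      from Suc.IH[OF _ this] obtain S where S: "S \<subseteq> {..<m}" "card S = k'" "\<Sum>S = \<Sum>{..<k'} + (t - Suc d)"
        using d k' by auto
      have fin: "finite S" "m \<notin> S" using S(1) finite_subset by auto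
      have "\<Sum>(insert m S) = \<Sum>{..<k} + t" using S(3) fin t3 d k' by (simp add: lessThan_Suc)
      then show ?thesis using S fin k' by (intro exI[of _ "insert m S"]) auto
    qed
  qed
qed auto

text \<open>Only the sum of the exponents modulo \<open>q\<close> matters, and the bound on
  \<open>q - 1\<close> provides \<open>q\<close> consecutive sums, hence every residue.\<close>

lemma ex_subset_prod:
  fixes \<omega> :: complex
  assumes n: "n \<le> m" "q - 1 \<le> n * (m - n)" and q: "q > 0" and \<omega>: "\<omega> ^ q = 1"
  shows "\<exists>S\<subseteq>{..<m}. card S = n \<and> (\<Prod>i\<in>S. \<omega> ^ i) = \<omega> ^ e"
proof -
  define s where "s = \<Sum>{..<n}"
  \<comment> \<open>\<open>q * s - s\<close> is a natural number congruent to \<open>- s\<close>, so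
    \<open>t\<close> is the residue of \<open>e - s\<close>.\<close>
  define t where "t = (e + (q * s - s)) mod q"
  have mod: "\<omega> ^ i = \<omega> ^ (i mod q)" for i
    using \<omega> by (metis mod_mult_div_eq mult.right_neutral power_add power_mult power_one)
  have "t < q" using q by (simp add: t_def)
  then have "t \<le> n * (m - n)" using n by simp
  from ex_subset_sum[OF n(1) this] obtain S where
    S: "S \<subseteq> {..<m}" "card S = n" "\<Sum>S = s + t" unfolding s_def by blast
  have "(s + t) mod q = (s + (e + (q * s - s))) mod q" unfolding t_def by (simp add: mod_add_right_eq)
  also have "s + (e + (q * s - s)) = e + q * s"
    using q by (cases q) auto
  finally have "(s + t) mod q = e mod q" by simp
  then have "\<omega> ^ \<Sum>S = \<omega> ^ e" using mod S(3) by metis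
  then show ?thesis using S by (intro exI[of _ S]) (simp add: power_sum[symmetric])
qed

lemma primitive_root:
  fixes q :: nat assumes "q > 0"
  obtains \<omega> :: complex where "\<omega> ^ q = 1" "inj_on (\<lambda>i. \<omega> ^ i) {..<q}" "{w. w ^ q = 1} = (\<lambda>i. \<omega> ^ i) ` {..<q}"
proof
  let ?w = "cis (2 * pi / q)"
  have w: "?w ^ i = cis (2 * pi * i / q)" for i by (simp add: DeMoivre field_simps)
  have b: "bij_betw (\<lambda>i. ?w ^ i) {..<q} {z. z ^ q = 1}"
    unfolding w by (rule bij_betw_roots_unity[OF assms])
  show "?w ^ q = 1" using assms by (simp add: w cis_2pi)
  show "inj_on (\<lambda>i. ?w ^ i) {..<q}" "{z. z ^ q = 1} = (\<lambda>i. ?w ^ i) ` {..<q}"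
    using b by (auto simp: bij_betw_def)
qed

lemma ex_roots_unity_prod:
  fixes \<eta> :: complex
  assumes "1 \<le> n" "n < q" "\<eta> ^ q = 1"
  shows "\<exists>S. S \<subseteq> {w. w ^ q = 1} \<and> card S = n \<and> \<Prod>S = \<eta>"
proof -
  have q: "q > 0" using assms by simp
  obtain \<omega> :: complex where \<omega>: "\<omega> ^ q = 1" "inj_on (\<lambda>i. \<omega> ^ i) {..<q}"
      "{w. w ^ q = 1} = (\<lambda>i. \<omega> ^ i) ` {..<q}"
    using primitive_root[OF q] .
  obtain e where e: "\<eta> = \<omega> ^ e" using \<omega>(3) assms(3) by auto
  obtain d where d: "q = n + Suc d" using assms(2) less_iff_Suc_add by auto
  \<comment> \<open>The difference of the two sides is \<open>(n - 1) * (q - n - 1)\<close>.\<close>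
  have "q - 1 \<le> n * (q - n)" using assms(1) d by (cases n) auto
  from ex_subset_prod[OF _ this q \<omega>(1), of e] assms obtain S where
    S: "S \<subseteq> {..<q}" "card S = n" "(\<Prod>i\<in>S. \<omega> ^ i) = \<omega> ^ e" by auto
  have inj: "inj_on (\<lambda>i. \<omega> ^ i) S" using \<omega>(2) S(1) inj_on_subset by blast
  show ?thesis using S \<omega>(3) e
    by (intro exI[of _ "(\<lambda>i. \<omega> ^ i) ` S"]) (auto simp: card_image[OF inj] prod.reindex[OF inj])
qed

text \<open>Needed for \<open>c = 1\<close>, where 1 is an eigenvalue of \<open>x\<close> and has to
  be avoided for \<open>y\<close>. Exponents between 1 and \<open>q - 1\<close> come from shifting a
  subset of \<open>{..<q - 1}\<close>, and \<open>n + 2 < q\<close> leaves room for all residues.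
  The smaller values of \<open>q\<close> are treated in \<open>torus_data_special\<close>.\<close>

lemma ex_nontrivial_roots_unity_prod:
  fixes \<eta> :: complex
  assumes "2 \<le> n" "n + 2 < q" "\<eta> ^ q = 1"
  shows "\<exists>S. S \<subseteq> {w. w ^ q = 1} - {1} \<and> card S = n \<and> \<Prod>S = \<eta>"
proof -
  have q: "q > 0" using assms by simp
  obtain \<omega> :: complex where \<omega>: "\<omega> ^ q = 1" "inj_on (\<lambda>i. \<omega> ^ i) {..<q}"
      "{w. w ^ q = 1} = (\<lambda>i. \<omega> ^ i) ` {..<q}"
    using primitive_root[OF q] .
  obtain e where e: "\<eta> = \<omega> ^ e" using \<omega>(3) assms(3) by auto
  obtain d where d: "q = n + 3 + d" using assms(2) by (metis Suc_eq_plus1 add_2_eq_Suc' less_eq_Suc_le nat_le_iff_add numeral_3_eq_3 add_Suc_right numeral_2_eq_2)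
  obtain n' where n': "n = 2 + n'" using assms(1) le_Suc_ex by blast
  have le: "q - 1 \<le> n * (q - 1 - n)" using d n' by (simp add: algebra_simps)
  have wn: "\<omega> ^ (q * n) = 1" using \<omega>(1) by (simp add: power_mult)
  \<comment> \<open>The shift by one multiplies the product by \<open>\<omega> ^ n\<close>, so the
    target exponent is \<open>e - n\<close>; adding \<open>q * n\<close> keeps it a natural
    number.\<close>
  have "\<exists>S\<subseteq>{..<q - 1}. card S = n \<and> (\<Prod>i\<in>S. \<omega> ^ i) = \<omega> ^ (e + (q * n - n))"
    by (rule ex_subset_prod[OF _ le q \<omega>(1)]) (use assms in simp)
  then obtain S where
    S: "S \<subseteq> {..<q - 1}" "card S = n" "(\<Prod>i\<in>S. \<omega> ^ i) = \<omega> ^ (e + (q * n - n))" by blast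
  have sub: "Suc ` S \<subseteq> {..<q}" using S(1) by auto
  have inj: "inj_on (\<lambda>i. \<omega> ^ Suc i) S"
    using comp_inj_on[of Suc S "\<lambda>i. \<omega> ^ i", OF _ inj_on_subset[OF \<omega>(2) sub]]
    by (simp add: comp_def)
  have "\<omega> ^ Suc i \<noteq> 1" if "i \<in> S" for i
    using inj_onD[OF \<omega>(2), of "Suc i" 0] sub that q by auto
  moreover have "(\<Prod>i\<in>S. \<omega> ^ Suc i) = \<omega> ^ n * (\<Prod>i\<in>S. \<omega> ^ i)"
    using S(2) by (simp add: prod.distrib)
  then have "(\<Prod>i\<in>S. \<omega> ^ Suc i) = \<omega> ^ (n + (e + (q * n - n)))" using S(3) by (simp only: power_add)
  moreover have "n + (e + (q * n - n)) = e + q * n"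
    using q by (cases q) auto
  ultimately have "(\<Prod>i\<in>S. \<omega> ^ Suc i) = \<eta>"
    using wn e by (simp only: power_add mult_1_right)
  moreover have "\<omega> ^ Suc i \<in> {w. w ^ q = 1}" if "i \<in> S" for i
    unfolding \<omega>(3) using sub that by blast
  ultimately show ?thesis using S(2) \<open>\<And>i. i \<in> S \<Longrightarrow> \<omega> ^ Suc i \<noteq> 1\<close>
    by (intro exI[of _ "(\<lambda>i. \<omega> ^ Suc i) ` S"])
      (auto simp only: card_image[OF inj] prod.reindex[OF inj] comp_def)
qed

section \<open>Moments of rank one perturbations\<close>

text \<open>The quotient of the extreme coefficients is the product of the negated reciprocals of
  the roots, and each of these has the \<open>p\<close>-th power \<open>(-1) ^ p * u\<close>. Only
  the number of roots enters, not which roots occur.\<close>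

lemma lead_coeff_dvd_root_poly:
  fixes h :: "complex poly"
  assumes "h dvd 1 - monom u p" "p > 0" "u \<noteq> 0"
  shows "\<exists>\<rho>. lead_coeff h = \<rho> * poly h 0 \<and> \<rho> ^ p = ((-1) ^ p * u) ^ degree h"
proof -
  obtain as where as: "Polynomial.smult (lead_coeff h) (\<Prod>a\<leftarrow>as. [:- a, 1:]) = h" "length as = degree h"
    using fundamental_theorem_algebra_factorized by blast
  have root: "u * a ^ p = 1" if "a \<in> set as" for a
  proof -
    have "poly h a = 0" using that by (subst as(1)[symmetric]) (auto simp: poly_prod_list prod_list_zero_iff image_iff)
    then have "poly (1 - monom u p) a = 0" using assms(1) by (metis dvdE mult_zero_left poly_mult)
    then show ?thesis by (simp add: poly_monom)
  qed
  define \<rho> where "\<rho> = (\<Prod>a\<leftarrow>as. - inverse a)"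
  have "(\<Prod>a\<leftarrow>as. - inverse a) * (\<Prod>a\<leftarrow>as. - a) = 1"
    using root
  proof (induction as)
    case (Cons a as)
    have "a \<noteq> 0" using Cons.prems[of a] assms(2) by (auto simp: power_0_left)
    with Cons show ?case by (simp add: algebra_simps)
  qed simp
  moreover have "poly h 0 = lead_coeff h * (\<Prod>a\<leftarrow>as. - a)"
    by (subst (1) as(1)[symmetric]) (simp add: poly_prod_list comp_def)
  ultimately have "lead_coeff h = \<rho> * poly h 0" by (simp add: \<rho>_def algebra_simps)
  moreover have "(\<Prod>a\<leftarrow>as. - inverse a) ^ p = ((-1) ^ p * u) ^ length as"
    using root
  proof (induction as)
    case (Cons a as)
    have "u * a ^ p = 1" using Cons.prems by simp
    then have "inverse a ^ p = u" using assms(3) by (metis inverse_unique mult.commute power_inverse)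
    then have "(- inverse a) ^ p = (-1) ^ p * u" by (subst power_minus) simp
    moreover have "(\<Prod>b\<leftarrow>a # as. - inverse b) ^ p = (- inverse a) ^ p * (\<Prod>b\<leftarrow>as. - inverse b) ^ p"
      unfolding list.map prod_list.Cons power_mult_distrib ..
    moreover have "(\<Prod>b\<leftarrow>as. - inverse b) ^ p = ((-1) ^ p * u) ^ length as"
      using Cons by simp
    ultimately show ?case by (simp only: length_Cons power_Suc)
  qed simp
  ultimately show ?thesis using as(2) \<rho>_def by auto
qed

lemma fps_eventually_0_imp_poly:
  fixes S :: "'a :: comm_ring_1 fps"
  assumes "\<And>n. n > p \<Longrightarrow> fps_nth S n = 0"
  shows "\<exists>P. fps_of_poly P = S \<and> degree P \<le> p"
proof (intro exI conjI)
  let ?P = "\<Sum>i\<le>p. monom (fps_nth S i) i"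
  have "coeff ?P n = fps_nth S n" for n
    using assms[of n] by (cases "n \<le> p") (auto simp: coeff_sum)
  then show "fps_of_poly ?P = S" by (intro fps_ext) simp
  show "degree ?P \<le> p" by (intro degree_sum_le) (auto intro: order.trans[OF degree_monom_le])
qed

text \<open>Applied to the moments \<open>f i = \<psi> (A\<^sup>i e)\<close> and \<open>g i = \<psi> (B\<^sup>i e)\<close> of operators with
  \<open>A = B + e \<psi>\<close>: the recurrence says that \<open>1 + \<Sum> f i X\<^sup>i\<^sup>+\<^sup>1\<close> is inverse to \<open>1 - \<Sum> g i X\<^sup>i\<^sup>+\<^sup>1\<close>,
  which is the rank one perturbation formula for \<open>det (1 - X B) / det (1 - X A)\<close>.  The periodicity makes
  both series rational with known denominators, and \<open>k\<close> is the number of poles of the first one.\<close>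

lemma moment_constraint:
  fixes f g :: "nat \<Rightarrow> complex"
  assumes p: "p > 0" and q: "q > 0" and u: "u \<noteq> 0" and v: "v \<noteq> 0" and \<mu>: "\<mu> \<noteq> 0" "\<mu> \<noteq> 1"
    and rec: "\<And>i. f i = g i + (\<Sum>l<i. f l * g (i - 1 - l))"
    and perf: "\<And>i. f (i + p) = u * f i" and perg: "\<And>i. g (i + q) = v * g i"
    and last: "f (p - 1) = u * (1 - 1 / \<mu>)"
  shows "\<exists>k. 1 \<le> k \<and> k \<le> p \<and> \<mu> ^ (p * q) * v ^ (k * p) = u ^ (k * q) \<and>
    (k = p \<longrightarrow> \<mu> ^ q * ((-1) ^ q * v) ^ p = (- u) ^ q)"
proof -
  define F where "F = 1 + fps_X * Abs_fps f"
  define G where "G = 1 - fps_X * Abs_fps g"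
  have "Abs_fps f - Abs_fps g = fps_X * (Abs_fps f * Abs_fps g)"
  proof (rule fps_ext)
    fix i show "fps_nth (Abs_fps f - Abs_fps g) i = fps_nth (fps_X * (Abs_fps f * Abs_fps g)) i"
      using rec[of i]
      by (cases i) (simp_all add: fps_X_mult_nth fps_mult_nth[of "Abs_fps f"] lessThan_Suc_atMost atLeast0AtMost)
  qed
  moreover have "F * G = 1 + fps_X * (Abs_fps f - Abs_fps g) - fps_X * (fps_X * (Abs_fps f * Abs_fps g))"
    unfolding F_def G_def by (simp add: algebra_simps)
  ultimately have FG: "F * G = 1" by simp
  have poly1: "fps_of_poly (1 - monom w n) = 1 - fps_const w * fps_X ^ n" for w :: complex and n
    by (simp add: fps_of_poly_diff fps_of_poly_monom)
  have nth: "fps_nth (S * (1 - fps_const w * fps_X ^ m)) n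
      = fps_nth S n - (if n < m then 0 else w * fps_nth S (n - m))" for S :: "complex fps" and w m n
  proof -
    have "S * (1 - fps_const w * fps_X ^ m) = S - fps_const w * (S * fps_X ^ m)"
      by (simp add: algebra_simps)
    then show ?thesis by (simp add: fps_X_power_mult_right_nth)
  qed
  have F: "fps_nth F n = (if n = 0 then 1 else f (n - 1))"
    and G: "fps_nth G n = (if n = 0 then 1 else - g (n - 1))" for n
    unfolding F_def G_def by auto
  have nthF: "fps_nth (F * (1 - fps_const u * fps_X ^ p)) n
      = (if n = 0 then 1 else f (n - 1)) - (if n < p then 0 else u * (if n = p then 1 else f (n - p - 1)))" for n
    unfolding nth F by auto
  have nthG: "fps_nth (G * (1 - fps_const v * fps_X ^ q)) n
      = (if n = 0 then 1 else - g (n - 1)) - (if n < q then 0 else v * (if n = q then 1 else - g (n - q - 1)))" for n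
    unfolding nth G by auto
  \<comment> \<open>By periodicity the coefficients of degree above \<open>p\<close> cancel, so
    \<open>F\<close> is a rational function with denominator \<open>1 - u X^p\<close>.\<close>
  obtain P where P: "fps_of_poly P = F * (1 - fps_const u * fps_X ^ p)" "degree P \<le> p"
  proof -
    have "fps_nth (F * (1 - fps_const u * fps_X ^ p)) n = 0" if "n > p" for n
      unfolding nthF using that perf[of "n - p - 1"] by simp
    from fps_eventually_0_imp_poly[of p, OF this] show ?thesis using that by blast
  qed
  obtain Q where Q: "fps_of_poly Q = G * (1 - fps_const v * fps_X ^ q)"
  proof -
    have "fps_nth (G * (1 - fps_const v * fps_X ^ q)) n = 0" if "n > q" for n
      unfolding nthG using that perg[of "n - q - 1"] by simp
    from fps_eventually_0_imp_poly[of q, OF this] show ?thesis using that by blast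
  qed
  have "fps_of_poly (P * Q) = (F * G) * ((1 - fps_const u * fps_X ^ p) * (1 - fps_const v * fps_X ^ q))"
    unfolding fps_of_poly_mult P(1) Q by (simp only: ac_simps)
  also have "\<dots> = fps_of_poly ((1 - monom u p) * (1 - monom v q))"
    unfolding FG fps_of_poly_mult poly1 by simp
  finally have "P * Q = (1 - monom u p) * (1 - monom v q)" by (simp only: fps_of_poly_eq_iff)
  then have "P dvd (1 - monom u p) * (1 - monom v q)" by (metis dvd_triv_left)
  \<comment> \<open>\<open>F1\<close> is the part of \<open>P\<close> that cancels against
    \<open>1 - u X^p\<close>; what is left of \<open>F\<close> is \<open>F2\<close> over the
    cofactor \<open>h\<close> obtained below.\<close>
  from division_decomp[OF this] obtain F1 F2 where
    F12: "P = F1 * F2" "F1 dvd 1 - monom u p" "F2 dvd 1 - monom v q" by blast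
  have P0: "poly P 0 = 1"
    using arg_cong[OF P(1), of "\<lambda>S. fps_nth S 0"] p nthF[of 0] by (simp add: poly_0_coeff_0)
  \<comment> \<open>The hypothesis \<open>last\<close> prescribes the value of \<open>F\<close> at
    infinity: the leading coefficients \<open>- u / \<mu>\<close> and \<open>- u\<close> have the
    quotient \<open>1 / \<mu>\<close>.\<close>
  have Pp: "coeff P p = - u / \<mu>"
  proof -
    have "coeff P p = f (p - 1) - u"
      using arg_cong[OF P(1), of "\<lambda>S. fps_nth S p"] p unfolding nthF by simp
    then show ?thesis unfolding last by (simp add: algebra_simps)
  qed
  then have degP: "degree P = p" using P(2) u \<mu> le_degree[of P p] by simp
  obtain h where h: "1 - monom u p = F1 * h" using F12(2) by blast
  have h0: "poly F1 0 * poly h 0 = 1"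
    using arg_cong[OF h, of "\<lambda>P. poly P 0"] p by (simp add: poly_monom power_0_left)
  have degu: "degree (1 - monom u p) = p"
    using p u by (intro antisym le_degree degree_diff_le) (auto simp: degree_monom_le)
  have leadu: "lead_coeff (1 - monom u p) = - u" unfolding degu using p by simp
  have nz: "P \<noteq> 0" "1 - monom u p \<noteq> 0"
    using P0 degu p by (auto simp del: right_minus_eq)
  define k where "k = degree F2"
  have deg: "degree F1 + k = p" "degree h = k"
    using F12(1) h degP degu nz unfolding k_def by (auto simp: degree_mult_eq)
  obtain \<rho>1 where \<rho>1: "lead_coeff F1 = \<rho>1 * poly F1 0" "\<rho>1 ^ p = ((-1) ^ p * u) ^ degree F1"
    using lead_coeff_dvd_root_poly[OF F12(2) p u] by blast
  obtain \<rho>2 where \<rho>2: "lead_coeff F2 = \<rho>2 * poly F2 0" "\<rho>2 ^ q = ((-1) ^ q * v) ^ k"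
    using lead_coeff_dvd_root_poly[OF F12(3) q v] k_def by blast
  obtain \<rho>h where \<rho>h: "lead_coeff h = \<rho>h * poly h 0" "\<rho>h ^ p = ((-1) ^ p * u) ^ k"
    using lead_coeff_dvd_root_poly[of h u p] h p u deg by (metis dvd_triv_right)
  have r1: "\<rho>1 * \<rho>2 = - u / \<mu>"
    using Pp P0 degP unfolding F12(1) by (auto simp: lead_coeff_mult \<rho>1(1) \<rho>2(1) algebra_simps)
  have r2: "\<rho>1 * \<rho>h = - u"
    using leadu h0 unfolding h lead_coeff_mult \<rho>1(1) \<rho>h(1) by (simp add: algebra_simps)
  have nz1: "\<rho>1 \<noteq> 0" using r2 u by auto
  \<comment> \<open>\<open>F2 / h\<close> is 1 at 0 and \<open>1 / \<mu>\<close> at infinity, so the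
    two root products differ by the factor \<open>\<mu>\<close>.\<close>
  have rh: "\<rho>h = \<mu> * \<rho>2" using r1 r2 nz1 \<mu> by (simp add: field_simps) (metis mult.commute mult_left_cancel mult.assoc)
  \<comment> \<open>For \<open>k = 0\<close> the function \<open>F\<close> would be the constant 1,
    against its value \<open>1 / \<mu>\<close> at infinity.\<close>
  have "k \<noteq> 0"
  proof
    assume "k = 0"
    then have "degree F2 = 0" "degree h = 0" using deg k_def by auto
    then have "lead_coeff F2 = poly F2 0" "lead_coeff h = poly h 0"
      by (auto simp: poly_0_coeff_0)
    moreover have "poly h 0 \<noteq> 0" "poly F2 0 \<noteq> 0" using h0 P0 F12(1) by auto
    ultimately have "\<rho>2 = 1" "\<rho>h = 1" using \<rho>2(1) \<rho>h(1) by auto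
    then show False using rh \<mu> by simp
  qed
  moreover have "\<mu> ^ (p * q) * v ^ (k * p) = u ^ (k * q)"
  proof -
    have "\<rho>h ^ (p * q) = (-1) ^ (p * q * k) * u ^ (k * q)"
      unfolding power_mult[of \<rho>h p] \<rho>h(2) by (simp add: power_mult_distrib power_mult[symmetric] ac_simps)
    moreover have "\<rho>2 ^ (p * q) = (-1) ^ (p * q * k) * v ^ (k * p)"
      unfolding mult.commute[of p q] power_mult[of \<rho>2 q] \<rho>2(2) by (simp add: power_mult_distrib power_mult[symmetric] ac_simps)
    ultimately show ?thesis using rh by (simp add: power_mult_distrib)
  qed
  \<comment> \<open>For \<open>k = p\<close> nothing cancels: \<open>F1\<close> is constant and
    \<open>h\<close> has all the roots of \<open>1 - u X^p\<close>, so its root product is known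
    exactly and not only up to a \<open>p\<close>-th root of unity.\<close>
  moreover have "\<mu> ^ q * ((-1) ^ q * v) ^ p = (- u) ^ q" if "k = p"
  proof -
    have "degree F1 = 0" using deg that by simp
    then have "lead_coeff F1 = poly F1 0" by (auto simp: poly_0_coeff_0)
    moreover have "poly F1 0 \<noteq> 0" using h0 by auto
    ultimately have "\<rho>1 = 1" using \<rho>1(1) by auto
    then have "\<mu> * \<rho>2 = - u" using r2 rh by simp
    then show ?thesis using \<rho>2(2) that by (metis power_mult_distrib)
  qed
  ultimately show ?thesis using deg by (intro exI[of _ k]) auto
qed

section \<open>Diagonalizable rank one perturbations of the identity\<close>

lemma order_prod_list_linear:
  "Polynomial.order x (\<Prod>a\<leftarrow>as. [:- a, 1:]) = count_list as (x :: complex)"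
proof (induction as)
  case (Cons a as)
  have nz: "(\<Prod>a\<leftarrow>as. [:- a, 1:]) \<noteq> 0" by (auto simp: prod_list_zero_iff)
  have "Polynomial.order x [:- a, 1:] = (if a = x then 1 else 0)"
  proof (cases "a = x")
    case True
    then show ?thesis using order_power_n_n[of x 1] by simp
  next
    case False
    then show ?thesis using order_root[of "[:- a, 1:]" x] by auto
  qed
  then show ?case using Cons nz by (simp add: order_mult del: mult_pCons_left)
qed simp

lemma order_char_poly_diagonal:
  fixes D :: "complex mat"
  assumes D: "D \<in> carrier_mat n n" "diagonal_mat D"
  shows "Polynomial.order x (char_poly D) = card {i. i < n \<and> D $$ (i, i) = x}"
proof -
  have "upper_triangular D" using D by (auto simp: diagonal_mat_def)
  from char_poly_upper_triangular[OF D(1) this]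
  have "char_poly D = (\<Prod>a\<leftarrow>diag_mat D. [:- a, 1:])" .
  then have "Polynomial.order x (char_poly D) = count_list (diag_mat D) x"
    by (simp add: order_prod_list_linear)
  also have "\<dots> = length (filter (\<lambda>i. D $$ (i, i) = x) [0..<n])"
    using D(1) by (simp add: diag_mat_def count_list_eq_length_filter filter_map comp_def eq_commute[of x])
  also have "\<dots> = card (set (filter (\<lambda>i. D $$ (i, i) = x) [0..<n]))"
    by (rule distinct_card[symmetric]) simp
  also have "set (filter (\<lambda>i. D $$ (i, i) = x) [0..<n]) = {i. i < n \<and> D $$ (i, i) = x}" by auto
  finally show ?thesis .
qed

text \<open>\<open>e\<close> and a basis of the kernel of \<open>\<phi>\<close> form an eigenbasis,
  since \<open>\<mu> \<noteq> 1\<close> says that \<open>\<phi>\<close> does not vanish on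
  \<open>e\<close>. A coordinate \<open>k\<close> with \<open>\<phi> k \<noteq> 0\<close> allows
  this basis and its inverse to be written down explicitly.\<close>

lemma rank_one_perturbation_diagonalizable:
  fixes M :: "complex mat"
  assumes M: "M = mat n n (\<lambda>(i, j). (if i = j then 1 else 0) + e i * \<phi> j)"
    and \<mu>: "(\<Sum>i<n. \<phi> i * e i) = \<mu> - 1" "\<mu> \<noteq> 1"
  shows "diagonalizable M \<and> Polynomial.order 1 (char_poly M) = n - 1"
proof -
  have "\<exists>k<n. \<phi> k \<noteq> 0"
  proof (rule ccontr)
    assume "\<not> (\<exists>k<n. \<phi> k \<noteq> 0)"
    then have "(\<Sum>i<n. \<phi> i * e i) = 0" by simp
    then show False using \<mu> by simp
  qed
  then obtain k where k: "k < n" "\<phi> k \<noteq> 0" by blast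
  \<comment> \<open>Column \<open>k\<close> is \<open>e\<close>; any other column \<open>j\<close>
    is the unit vector \<open>j\<close>, corrected in coordinate \<open>k\<close> so that
    \<open>\<phi>\<close> vanishes on it.\<close>
  define P where "P = mat n n (\<lambda>(i, j). if j = k then e i
      else (if i = j then 1 else 0) - (if i = k then \<phi> j / \<phi> k else 0))"
  \<comment> \<open>Row \<open>k\<close> reads off the coefficient of \<open>e\<close>; the other
    rows are coordinates of the projection onto the kernel of \<open>\<phi>\<close> along
    \<open>e\<close>.\<close>
  define Q where "Q = mat n n (\<lambda>(i, j). if i = k then \<phi> j / (\<mu> - 1)
      else (if i = j then 1 else 0) - e i * \<phi> j / (\<mu> - 1))"
  define D where "D = mat_diag n (\<lambda>i. if i = k then \<mu> else 1)"
  have c: "P \<in> carrier_mat n n" "Q \<in> carrier_mat n n" "D \<in> carrier_mat n n"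
    by (auto simp: P_def Q_def D_def)
  have \<delta>: "\<mu> - 1 \<noteq> 0" using \<mu> by simp
  have PQ: "(\<Sum>l<n. P $$ (i, l) * Q $$ (l, j)) = (if i = j then 1 else 0)" if ij: "i < n" "j < n" for i j
  proof -
    have "(\<Sum>l<n. P $$ (i, l) * Q $$ (l, j))
        = P $$ (i, k) * Q $$ (k, j) + (\<Sum>l\<in>{..<n} - {k}. P $$ (i, l) * Q $$ (l, j))"
      using k by (intro sum.remove) auto
    also have "P $$ (i, k) * Q $$ (k, j) = e i * \<phi> j / (\<mu> - 1)"
      using ij k by (simp add: P_def Q_def)
    also have "(\<Sum>l\<in>{..<n} - {k}. P $$ (i, l) * Q $$ (l, j))
        = (\<Sum>l\<in>{..<n} - {k}. ((if i = l then 1 else 0) - (if i = k then \<phi> l / \<phi> k else 0))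
            * ((if l = j then 1 else 0) - e l * \<phi> j / (\<mu> - 1)))"
      using ij k by (intro sum.cong) (auto simp: P_def Q_def)
    also have "e i * \<phi> j / (\<mu> - 1) + \<dots> = (if i = j then 1 else 0)"
    proof (cases "i = k")
      case False
      have "(\<Sum>l\<in>{..<n} - {k}. ((if i = l then 1 else 0) - (if i = k then \<phi> l / \<phi> k else 0))
            * ((if l = j then 1 else 0) - e l * \<phi> j / (\<mu> - 1)))
         = (\<Sum>l\<in>{..<n} - {k}. if i = l then (if i = j then 1 else 0) - e i * \<phi> j / (\<mu> - 1) else 0)"
        using False by (intro sum.cong) auto
      also have "\<dots> = (if i = j then 1 else 0) - e i * \<phi> j / (\<mu> - 1)"
        using False ij by (subst sum.delta') auto
      finally show ?thesis by simp
    next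
      case True
      have "(\<Sum>l\<in>{..<n} - {k}. ((if i = l then 1 else 0) - (if i = k then \<phi> l / \<phi> k else 0))
            * ((if l = j then 1 else 0) - e l * \<phi> j / (\<mu> - 1)))
         = (\<Sum>l\<in>{..<n} - {k}. - (if l = j then \<phi> j / \<phi> k else 0) + \<phi> j / (\<phi> k * (\<mu> - 1)) * (\<phi> l * e l))"
        using True k(2) \<delta> by (intro sum.cong) (auto simp: divide_simps, simp_all add: algebra_simps)
      also have "\<dots> = - (if j = k then 0 else \<phi> j / \<phi> k) + \<phi> j / (\<phi> k * (\<mu> - 1)) * (\<Sum>l\<in>{..<n} - {k}. \<phi> l * e l)"
        unfolding sum.distrib sum_distrib_left[symmetric] sum_negf using ij by simp
      also have "(\<Sum>l\<in>{..<n} - {k}. \<phi> l * e l) = (\<mu> - 1) - \<phi> k * e k"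
        using \<mu>(1) k sum.remove[of "{..<n}" k "\<lambda>l. \<phi> l * e l"] by (simp add: eq_diff_eq add.commute)
      finally have S: "(\<Sum>l\<in>{..<n} - {k}. ((if i = l then 1 else 0) - (if i = k then \<phi> l / \<phi> k else 0))
            * ((if l = j then 1 else 0) - e l * \<phi> j / (\<mu> - 1)))
          = - (if j = k then 0 else \<phi> j / \<phi> k) + \<phi> j / (\<phi> k * (\<mu> - 1)) * (\<mu> - 1 - \<phi> k * e k)" .
      have "b / (f * d) * (d - f * a) = b / f - a * b / d" if "d \<noteq> 0" "f \<noteq> 0" for a b d f :: complex
        using that by (simp add: field_simps)
      from this[OF \<delta> k(2)] show ?thesis unfolding S using True k(2) by auto
    qed
    finally show ?thesis .
  qed
  have PQ1: "P * Q = 1\<^sub>m n"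
    by (rule eq_matI) (use c PQ in \<open>auto simp: scalar_prod_def atLeast0LessThan\<close>)
  then have QP1: "Q * P = 1\<^sub>m n" using mat_mult_left_right_inverse c by blast
  have PD: "P * D = mat n n (\<lambda>(i, j). P $$ (i, j) * (if j = k then \<mu> else 1))"
    unfolding D_def by (rule mat_diag_mult_right[OF c(1)])
  have "M = P * D * Q"
  proof (rule eq_matI)
    fix i j assume "i < dim_row (P * D * Q)" "j < dim_col (P * D * Q)"
    then have ij: "i < n" "j < n" using c by auto
    have "(P * D * Q) $$ (i, j) = (\<Sum>l<n. P $$ (i, l) * (if l = k then \<mu> else 1) * Q $$ (l, j))"
      using ij c unfolding PD by (simp add: scalar_prod_def atLeast0LessThan)
    also have "\<dots> = (\<Sum>l<n. P $$ (i, l) * Q $$ (l, j) + (if l = k then (\<mu> - 1) * (P $$ (i, k) * Q $$ (k, j)) else 0))"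
      by (intro sum.cong) (auto simp: algebra_simps)
    also have "\<dots> = (if i = j then 1 else 0) + (\<mu> - 1) * (P $$ (i, k) * Q $$ (k, j))"
      using k by (simp add: sum.distrib PQ[OF ij])
    also have "P $$ (i, k) * Q $$ (k, j) = e i * \<phi> j / (\<mu> - 1)"
      using ij k by (simp add: P_def Q_def)
    finally show "M $$ (i, j) = (P * D * Q) $$ (i, j)" using ij \<delta> by (simp add: M)
  qed (use c in \<open>auto simp: M\<close>)
  moreover have "M \<in> carrier_mat n n" by (simp add: M)
  ultimately have "similar_mat_wit M D P Q"
    using c PQ1 QP1 unfolding similar_mat_wit_def Let_def by fastforce
  then have sim: "similar_mat M D" unfolding similar_mat_def by blast
  have diag: "diagonal_mat D" by (auto simp: diagonal_mat_def D_def mat_diag_def)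
  have "Polynomial.order 1 (char_poly M) = card {i. i < n \<and> D $$ (i, i) = 1}"
    using char_poly_similar[OF sim] order_char_poly_diagonal[OF c(3) diag] by simp
  also have "{i. i < n \<and> D $$ (i, i) = 1} = {..<n} - {k}"
    using \<mu>(2) by (auto simp: D_def mat_diag_def)
  finally show ?thesis using sim diag k unfolding diagonalizable_def by auto
qed

text \<open>Exactly one entry of the diagonal form differs from 1, so \<open>M - 1\<close> has a
  one-dimensional image. It contains the nonzero vector \<open>(\<mu> - 1) e\<close>, and the scalar
  between the two spanning vectors is absorbed by \<open>\<phi>\<close>.\<close>

lemma diagonalizable_rank_one_perturbation:
  fixes M :: "complex mat"
  assumes M: "M \<in> carrier_mat n n" "diagonalizable M" "n \<ge> 1" "Polynomial.order 1 (char_poly M) = n - 1"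
    and e: "eigenvector M e \<mu>" "\<mu> \<noteq> 1"
  shows "\<exists>\<phi>\<in>carrier_vec n. \<forall>v\<in>carrier_vec n. M *\<^sub>v v = v + (\<phi> \<bullet> v) \<cdot>\<^sub>v e"
proof -
  obtain D where D: "diagonal_mat D" "similar_mat M D" using M(2) diagonalizable_def by blast
  obtain P Q where PQ: "similar_mat_wit M D P Q" using D(2) similar_mat_def by blast
  have c: "D \<in> carrier_mat n n" "P \<in> carrier_mat n n" "Q \<in> carrier_mat n n"
    and PQ1: "P * Q = 1\<^sub>m n" and MPDQ: "M = P * D * Q"
    using similar_mat_witD2[OF M(1) PQ] by auto
  have ee: "e \<in> carrier_vec n" "e \<noteq> 0\<^sub>v n" "M *\<^sub>v e = \<mu> \<cdot>\<^sub>v e"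
    using e(1) M(1) by (auto simp: eigenvector_def)
  have "card {i. i < n \<and> D $$ (i, i) = 1} = n - 1"
    using M(4) char_poly_similar[OF D(2)] order_char_poly_diagonal[OF c(1) D(1)] by simp
  moreover have "{i. i < n \<and> D $$ (i, i) \<noteq> 1} = {..<n} - {i. i < n \<and> D $$ (i, i) = 1}" by auto
  ultimately have "card {i. i < n \<and> D $$ (i, i) \<noteq> 1} = 1"
    using M(3) by (simp add: card_Diff_subset subset_iff)
  then obtain k where k: "{i. i < n \<and> D $$ (i, i) \<noteq> 1} = {k}" by (metis card_1_singletonE)
  then have kn: "k < n" by auto
  define d where "d = D $$ (k, k) - 1"
  have Dw: "D *\<^sub>v w = w + (d * w $ k) \<cdot>\<^sub>v unit_vec n k" if w: "w \<in> carrier_vec n" for w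
  proof (rule eq_vecI)
    fix i assume "i < dim_vec (w + (d * w $ k) \<cdot>\<^sub>v unit_vec n k)"
    then have i: "i < n" using w by simp
    have "(D *\<^sub>v w) $ i = (\<Sum>j<n. D $$ (i, j) * w $ j)"
      using i w c by (simp add: scalar_prod_def atLeast0LessThan)
    also have "\<dots> = (\<Sum>j<n. if j = i then D $$ (i, i) * w $ i else 0)"
      using D(1) i c by (intro sum.cong) (auto simp: diagonal_mat_def)
    also have "\<dots> = D $$ (i, i) * w $ i" using i by simp
    also have "\<dots> = w $ i + (if i = k then d * w $ k else 0)"
      using k i by (auto simp: d_def algebra_simps)
    finally show "(D *\<^sub>v w) $ i = (w + (d * w $ k) \<cdot>\<^sub>v unit_vec n k) $ i"
      using i w kn by simp
  qed (use w c in auto)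
  define w0 where "w0 = P *\<^sub>v unit_vec n k"
  define \<alpha> where "\<alpha> = d \<cdot>\<^sub>v row Q k"
  have cw: "w0 \<in> carrier_vec n" "\<alpha> \<in> carrier_vec n" using c kn by (auto simp: w0_def \<alpha>_def)
  have Mv: "M *\<^sub>v v = v + (\<alpha> \<bullet> v) \<cdot>\<^sub>v w0" if v: "v \<in> carrier_vec n" for v
  proof -
    have Qv: "Q *\<^sub>v v \<in> carrier_vec n" using c v by simp
    have "M *\<^sub>v v = P *\<^sub>v (D *\<^sub>v (Q *\<^sub>v v))"
      unfolding MPDQ using c v by (simp add: assoc_mult_mat_vec[of _ n n _ n])
    also have "\<dots> = P *\<^sub>v (Q *\<^sub>v v) + (d * (Q *\<^sub>v v) $ k) \<cdot>\<^sub>v w0"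
      unfolding Dw[OF Qv] w0_def using c Qv
      by (subst mult_add_distrib_mat_vec[of _ n n]) (auto simp: mult_mat_vec[of _ n n])
    also have "P *\<^sub>v (Q *\<^sub>v v) = v"
      using assoc_mult_mat_vec[OF c(2,3) v] PQ1 v by simp
    also have "d * (Q *\<^sub>v v) $ k = \<alpha> \<bullet> v" using c kn v by (simp add: \<alpha>_def)
    finally show ?thesis .
  qed
  have eq: "\<mu> * e $ i = e $ i + (\<alpha> \<bullet> e) * w0 $ i" if "i < n" for i
    using arg_cong[OF HOL.trans[OF ee(3)[symmetric] Mv[OF ee(1)]], of "\<lambda>v. v $ i"] that ee(1) cw by simp
  have ne: "\<alpha> \<bullet> e \<noteq> 0"
  proof
    assume "\<alpha> \<bullet> e = 0"
    then have "e $ i = 0" if "i < n" for i using eq[OF that] e(2) by auto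
    then show False using ee(1,2) by (auto intro: eq_vecI)
  qed
  have w0: "w0 = ((\<mu> - 1) / (\<alpha> \<bullet> e)) \<cdot>\<^sub>v e"
    by (rule eq_vecI) (use eq ne cw ee in \<open>auto simp: field_simps\<close>)
  define \<phi> where "\<phi> = ((\<mu> - 1) / (\<alpha> \<bullet> e)) \<cdot>\<^sub>v \<alpha>"
  have "M *\<^sub>v v = v + (\<phi> \<bullet> v) \<cdot>\<^sub>v e" if v: "v \<in> carrier_vec n" for v
    unfolding Mv[OF v] \<phi>_def w0 using v cw ee
    by (intro arg_cong2[where f = "(+)"] HOL.refl) (simp add: smult_smult_assoc mult.commute)
  then show ?thesis using cw by (intro bexI[of _ \<phi>]) (auto simp: \<phi>_def)
qed

section \<open>KCH representations of torus knot groups\<close>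

lemma group_GL: "group (GL n)"
  using ring_mat[where 'a = complex and n = n and b = "()"]
  by (intro monoid.units_group) (simp add: ring.is_monoid)

lemma GL_mult: "A \<otimes>\<^bsub>GL n\<^esub> B = A * B"
  and GL_one: "\<one>\<^bsub>GL n\<^esub> = 1\<^sub>m n"
  by (simp_all add: units_of_def ring_mat_simps)

locale GL_rep = group G for G :: "('g, 'b) monoid_scheme" (structure) +
  fixes \<rho> :: "'g \<Rightarrow> complex mat" and n :: nat
  assumes hom: "\<rho> \<in> hom G (GL n)"
begin

lemma carrier_rep [simp]: "g \<in> carrier G \<Longrightarrow> \<rho> g \<in> carrier_mat n n"
  using hom_in_carrier[OF hom] GL_D(1) by blast

lemma rep_mult: "g \<in> carrier G \<Longrightarrow> h \<in> carrier G \<Longrightarrow> \<rho> (g \<otimes> h) = \<rho> g * \<rho> h"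
  using hom_mult[OF hom] by (simp add: GL_mult)

lemma rep_one: "\<rho> \<one> = 1\<^sub>m n"
  using hom_one[OF hom is_group group_GL] by (simp add: GL_one)

lemma rep_mult_vec:
  "g \<in> carrier G \<Longrightarrow> h \<in> carrier G \<Longrightarrow> v \<in> carrier_vec n \<Longrightarrow> \<rho> (g \<otimes> h) *\<^sub>v v = \<rho> g *\<^sub>v (\<rho> h *\<^sub>v v)"
  using assoc_mult_mat_vec[of "\<rho> g" n n "\<rho> h" n v] by (simp add: rep_mult)

lemma eig_nat_pow:
  assumes "g \<in> carrier G" "v \<in> carrier_vec n" "\<rho> g *\<^sub>v v = c \<cdot>\<^sub>v v"
  shows "\<rho> (g [^] (k :: nat)) *\<^sub>v v = c ^ k \<cdot>\<^sub>v v"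
proof (induction k)
  case 0
  show ?case using assms by (simp add: rep_one)
next
  case (Suc k)
  show ?case
    using assms Suc by (simp add: rep_mult_vec mult_mat_vec[of _ n n] smult_smult_assoc)
qed

lemma eig_int_pow:
  assumes "g \<in> carrier G" "v \<in> carrier_vec n" "\<rho> g *\<^sub>v v = c \<cdot>\<^sub>v v" "c \<noteq> 0"
  shows "\<rho> (g [^] (k :: int)) *\<^sub>v v = c powi k \<cdot>\<^sub>v v"
proof (cases "k \<ge> 0")
  case True
  then obtain j where "k = int j" by (metis nonneg_int_cases)
  then show ?thesis using eig_nat_pow[OF assms(1-3)] by (simp add: int_pow_int)
next
  case False
  define j where "j = nat (- k)"
  have k: "k = - int j" using False by (simp add: j_def)
  let ?h = "g [^] j"
  have h: "?h \<in> carrier G" using assms(1) by simp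
  have gk: "g [^] k = inv ?h" unfolding k by (simp add: int_pow_neg_int assms(1))
  have "v = \<rho> (inv ?h \<otimes> ?h) *\<^sub>v v" using h assms(2) by (simp add: rep_one)
  also have "\<dots> = \<rho> (inv ?h) *\<^sub>v (c ^ j \<cdot>\<^sub>v v)"
    using rep_mult_vec[OF inv_closed[OF h] h assms(2)] eig_nat_pow[OF assms(1-3)] by simp
  also have "\<dots> = c ^ j \<cdot>\<^sub>v (\<rho> (inv ?h) *\<^sub>v v)" using h assms(2) by (simp add: mult_mat_vec[of _ n n])
  finally have "inverse (c ^ j) \<cdot>\<^sub>v v = inverse (c ^ j) \<cdot>\<^sub>v (c ^ j \<cdot>\<^sub>v (\<rho> (inv ?h) *\<^sub>v v))" by simp
  also have "\<dots> = \<rho> (inv ?h) *\<^sub>v v" using assms(4) by (simp add: smult_smult_assoc)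
  finally show ?thesis unfolding gk using assms(4) by (simp add: k power_int_minus)
qed

lemma funpow_rep:
  assumes "g \<in> carrier G" "v \<in> carrier_vec n"
  shows "((\<lambda>w. \<rho> g *\<^sub>v w) ^^ k) v = \<rho> (g [^] k) *\<^sub>v v"
proof (induction k)
  case 0
  then show ?case using assms by (simp add: rep_one)
next
  case (Suc k)
  have "((\<lambda>w. \<rho> g *\<^sub>v w) ^^ Suc k) v = \<rho> g *\<^sub>v (\<rho> (g [^] k) *\<^sub>v v)"
    using Suc by simp
  then show ?case using assms by (simp only: rep_mult_vec[symmetric] nat_pow_Suc2 nat_pow_closed)
qed

end

text \<open>Here \<open>A = (1 + e \<psi>) B\<close>, so the functional that belongs to
  \<open>A - B\<close> is \<open>\<psi>\<close> after \<open>B\<close>; hence the \<open>b\<close>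
  in \<open>f\<close> and \<open>g\<close>. Replacing the factors \<open>A\<close> of
  \<open>A^i e\<close> by \<open>B\<close> one at a time, beginning next to \<open>e\<close>, splits
  off one summand each.\<close>

lemma moment_recurrence:
  fixes A B :: "complex mat" and e \<psi> :: "complex vec"
  defines "a \<equiv> (\<lambda>v. A *\<^sub>v v)" and "b \<equiv> (\<lambda>v. B *\<^sub>v v)"
  assumes c: "A \<in> carrier_mat n n" "B \<in> carrier_mat n n" "e \<in> carrier_vec n" "\<psi> \<in> carrier_vec n"
    and AB: "\<And>v. v \<in> carrier_vec n \<Longrightarrow> A *\<^sub>v v = B *\<^sub>v v + (\<psi> \<bullet> (B *\<^sub>v v)) \<cdot>\<^sub>v e"
  defines "f \<equiv> \<lambda>i. \<psi> \<bullet> b ((a ^^ i) e)" and "g \<equiv> \<lambda>i. \<psi> \<bullet> b ((b ^^ i) e)"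
  shows "f i = g i + (\<Sum>l<i. f l * g (i - 1 - l))"
proof -
  have ca: "(a ^^ i) v \<in> carrier_vec n" and cb: "(b ^^ i) v \<in> carrier_vec n" if "v \<in> carrier_vec n" for i v
    using that c by (induction i) (auto simp: a_def b_def)
  have lin1: "a (v + k \<cdot>\<^sub>v w) = a v + k \<cdot>\<^sub>v a w" "b (v + k \<cdot>\<^sub>v w) = b v + k \<cdot>\<^sub>v b w"
    if "v \<in> carrier_vec n" "w \<in> carrier_vec n" for v w k
    using that c by (simp_all add: a_def b_def mult_add_distrib_mat_vec[of _ n n] mult_mat_vec[of _ n n])
  have lin: "(a ^^ i) (v + k \<cdot>\<^sub>v w) = (a ^^ i) v + k \<cdot>\<^sub>v (a ^^ i) w"
    if "v \<in> carrier_vec n" "w \<in> carrier_vec n" for i v w k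
  proof (induction i)
    case (Suc i)
    have cv: "(a ^^ i) v \<in> carrier_vec n" "(a ^^ i) w \<in> carrier_vec n" using ca that by auto
    have "(a ^^ Suc i) (v + k \<cdot>\<^sub>v w) = a ((a ^^ i) v + k \<cdot>\<^sub>v (a ^^ i) w)" using Suc by simp
    also have "\<dots> = a ((a ^^ i) v) + k \<cdot>\<^sub>v a ((a ^^ i) w)"
      by (rule lin1[OF cv])
    finally show ?case by simp
  qed simp
  \<comment> \<open>\<open>h\<close> interpolates between \<open>h i 0 = f i\<close> and
    \<open>h 0 i = g i\<close>.\<close>
  define h where "h = (\<lambda>l j. \<psi> \<bullet> b ((a ^^ l) ((b ^^ j) e)))"
  have step: "h (Suc l) j = h l (Suc j) + g j * f l" for l j
  proof -
    let ?v = "(b ^^ j) e"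
    have v: "?v \<in> carrier_vec n" using cb c by blast
    have bv: "b ?v \<in> carrier_vec n" using v c by (simp add: b_def)
    have "(a ^^ Suc l) ?v = (a ^^ l) (a ?v)" by (simp add: funpow_swap1)
    also have "a ?v = b ?v + g j \<cdot>\<^sub>v e"
      using AB[OF v] unfolding g_def a_def b_def .
    also have "(a ^^ l) (b ?v + g j \<cdot>\<^sub>v e) = (a ^^ l) (b ?v) + g j \<cdot>\<^sub>v (a ^^ l) e"
      by (rule lin[OF bv c(3)])
    finally have eq: "(a ^^ Suc l) ?v = (a ^^ l) (b ?v) + g j \<cdot>\<^sub>v (a ^^ l) e" .
    have cc: "(a ^^ l) (b ?v) \<in> carrier_vec n" "(a ^^ l) e \<in> carrier_vec n" using ca bv c by auto
    have bcc: "b ((a ^^ l) (b ?v)) \<in> carrier_vec n" "b ((a ^^ l) e) \<in> carrier_vec n"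
      using mult_mat_vec_carrier[OF c(2) cc(1)] mult_mat_vec_carrier[OF c(2) cc(2)] by (simp_all add: b_def)
    have "\<psi> \<bullet> b ((a ^^ Suc l) ?v) = \<psi> \<bullet> b ((a ^^ l) (b ?v)) + g j * (\<psi> \<bullet> b ((a ^^ l) e))"
      unfolding eq lin1(2)[OF cc]
      using bcc c by (simp add: scalar_prod_add_distrib[of _ n])
    then show ?thesis by (simp add: h_def f_def)
  qed
  have "h l j = g (l + j) + (\<Sum>t<l. f t * g (l + j - 1 - t))" for l j
  proof (induction l arbitrary: j)
    case 0
    show ?case by (simp add: h_def g_def)
  next
    case (Suc l)
    show ?case unfolding step Suc by simp
  qed
  from this[of i 0] show ?thesis by (simp add: h_def f_def)
qed

text \<open>The exponent is \<open>(p + 1) q\<close>. It has the parity of \<open>p + 1\<close>: for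
  even \<open>q\<close>, coprimality makes \<open>p + 1\<close> even as well.\<close>

lemma minus_one_power_coprime:
  assumes "coprime p q"
  shows "(-1 :: complex) ^ (p * q + q) = - ((-1) ^ p)"
proof (cases "even q")
  case True
  then have "odd p" using assms by (metis coprime_common_divisor odd_one)
  then show ?thesis using True by simp
next
  case False
  then show ?thesis by (cases "even p") auto
qed

text \<open>The conditions hold in every degree and without irreducibility, because only the action
  of the powers of \<open>xs\<close> and \<open>yr\<close> on \<open>e\<close> enters the
  moments.\<close>

lemma torus_KCH_pair_on_curves:
  assumes p: "p \<ge> 1" and q: "q \<ge> 1" and cop: "coprime p q" and rs: "r * int p + s * int q = 1"
    and kch: "KCH_rep (torus_knot_group p q) (torus_meridian p q r s) n \<rho>" and \<mu>1: "\<mu> \<noteq> 1"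
    and em: "eigenvector (\<rho> (torus_meridian p q r s)) e \<mu>"
    and el: "eigenvector (\<rho> (torus_longitude p q r s)) e lam0"
  shows "lam0 \<noteq> 0 \<and> \<mu> \<noteq> 0 \<and> (lam0 * \<mu> ^ (p * q - q) = - ((-1) ^ p) \<or>
    (\<exists>k\<in>{1..p - 1}. lam0 ^ k * \<mu> ^ ((k - 1) * p * q) = 1))"
proof -
  define G where "G = torus_knot_group p q"
  define m where "m = torus_meridian p q r s"
  define l where "l = torus_longitude p q r s"
  define x where "x = pres_gen (torus_relators p q) X"
  define y where "y = pres_gen (torus_relators p q) Y"
  note defs = G_def m_def l_def x_def y_def
  have grp: "group G" unfolding G_def torus_knot_group_def by (rule group_presented_group)
  have \<rho>: "\<rho> \<in> hom G (GL n)" and n: "n \<ge> 1" and diag: "diagonalizable (\<rho> m)"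
    and ord: "Polynomial.order 1 (char_poly (\<rho> m)) = n - 1"
    using kch unfolding KCH_rep_def defs by auto
  interpret GL_rep G \<rho> n
    using grp \<rho> by (auto simp: GL_rep_def GL_rep_axioms_def)
  have xy: "x \<in> carrier G" "y \<in> carrier G" by (simp_all add: defs torus_knot_group_def)
  have rel: "x [^]\<^bsub>G\<^esub> p = y [^]\<^bsub>G\<^esub> q" unfolding defs by (rule torus_relation)
  have m: "m = x [^]\<^bsub>G\<^esub> s \<otimes>\<^bsub>G\<^esub> y [^]\<^bsub>G\<^esub> r" by (simp add: defs torus_meridian_def)
  have l: "l = x [^]\<^bsub>G\<^esub> p \<otimes>\<^bsub>G\<^esub> m [^]\<^bsub>G\<^esub> (- (int p * int q))" by (simp add: defs torus_longitude_def)
  have mc: "m \<in> carrier G" and lc: "l \<in> carrier G" using xy unfolding l m by auto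
  have ev: "e \<in> carrier_vec n" "e \<noteq> 0\<^sub>v n" "\<rho> m *\<^sub>v e = \<mu> \<cdot>\<^sub>v e" "\<rho> l *\<^sub>v e = lam0 \<cdot>\<^sub>v e"
    using em el carrier_rep[OF mc] carrier_rep[OF lc] unfolding eigenvector_def m_def l_def by auto
  have zero: "w \<in> carrier_vec n \<Longrightarrow> 0 \<cdot>\<^sub>v w = 0\<^sub>v n" for w :: "complex vec"
    by (intro eq_vecI) auto
  have nz: "c \<noteq> 0" if "g \<in> carrier G" "\<rho> g *\<^sub>v e = c \<cdot>\<^sub>v e" for g c
  proof
    assume "c = 0"
    have "e = \<rho> (inv\<^bsub>G\<^esub> g \<otimes>\<^bsub>G\<^esub> g) *\<^sub>v e" using that ev(1) by (simp add: rep_one)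
    also have "\<dots> = \<rho> (inv\<^bsub>G\<^esub> g) *\<^sub>v (0 \<cdot>\<^sub>v e)" using that ev(1) \<open>c = 0\<close> by (subst rep_mult_vec) auto
    also have "\<dots> = 0 \<cdot>\<^sub>v (\<rho> (inv\<^bsub>G\<^esub> g) *\<^sub>v e)" using that ev(1) by (simp add: mult_mat_vec[of _ n n])
    also have "\<dots> = 0\<^sub>v n"
      using mult_mat_vec_carrier[OF carrier_rep[OF inv_closed[OF that(1)]] ev(1)] by (rule zero)
    finally show False using ev(2) by simp
  qed
  have \<mu>0: "\<mu> \<noteq> 0" and lam0_nz: "lam0 \<noteq> 0" using nz mc lc ev by auto
  \<comment> \<open>\<open>c\<close> is the eigenvalue of the central element \<open>x^p\<close> on
    \<open>e\<close>, because \<open>x^p\<close> is the longitude times the \<open>pq\<close>-th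
    power of the meridian.\<close>
  define c where "c = lam0 * \<mu> ^ (p * q)"
  have c0: "c \<noteq> 0" using \<mu>0 lam0_nz by (simp add: c_def)
  have "x [^]\<^bsub>G\<^esub> p = l \<otimes>\<^bsub>G\<^esub> m [^]\<^bsub>G\<^esub> (p * q)"
  proof -
    have "m [^]\<^bsub>G\<^esub> (- (int p * int q)) = inv\<^bsub>G\<^esub> (m [^]\<^bsub>G\<^esub> (p * q))"
      using int_pow_neg_int[OF mc, of "p * q"] by simp
    then show ?thesis using mc xy unfolding l by (simp add: m_assoc)
  qed
  then have zp: "\<rho> (x [^]\<^bsub>G\<^esub> p) *\<^sub>v e = c \<cdot>\<^sub>v e"
    using mc lc ev eig_nat_pow[OF mc ev(1,3)]
    by (simp add: rep_mult_vec mult_mat_vec[of _ n n] smult_smult_assoc c_def mult.commute)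
  define xs where "xs = x [^]\<^bsub>G\<^esub> s"
  define yr where "yr = y [^]\<^bsub>G\<^esub> (- r)"
  have xyc: "xs \<in> carrier G" "yr \<in> carrier G" using xy by (auto simp: xs_def yr_def)
  have xs: "xs = m \<otimes>\<^bsub>G\<^esub> yr" using xy unfolding m xs_def yr_def by (simp add: m_assoc int_pow_mult[symmetric])
  define u v where "u = c powi s" and "v = c powi (- r)"
  have u0: "u \<noteq> 0" "v \<noteq> 0" using c0 by (auto simp: u_def v_def)
  have "xs [^]\<^bsub>G\<^esub> p = (x [^]\<^bsub>G\<^esub> p) [^]\<^bsub>G\<^esub> s"
    using xy unfolding xs_def int_pow_int[symmetric] by (simp add: int_pow_pow mult.commute)
  then have xsp: "\<rho> (xs [^]\<^bsub>G\<^esub> p) *\<^sub>v e = u \<cdot>\<^sub>v e"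
    using eig_int_pow[OF _ ev(1) zp c0, of s] xy by (simp add: u_def)
  have "yr [^]\<^bsub>G\<^esub> q = (y [^]\<^bsub>G\<^esub> q) [^]\<^bsub>G\<^esub> (- r)"
    using xy unfolding yr_def int_pow_int[symmetric] by (simp add: int_pow_pow mult.commute)
  then have yrq: "\<rho> (yr [^]\<^bsub>G\<^esub> q) *\<^sub>v e = v \<cdot>\<^sub>v e"
    using eig_int_pow[OF _ ev(1) zp c0, of "- r"] xy rel by (simp add: v_def)
  obtain \<phi> where \<phi>: "\<phi> \<in> carrier_vec n" "\<And>w. w \<in> carrier_vec n \<Longrightarrow> \<rho> m *\<^sub>v w = w + (\<phi> \<bullet> w) \<cdot>\<^sub>v e"
    using diagonalizable_rank_one_perturbation[OF carrier_rep[OF mc] diag n ord] em \<mu>1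
    unfolding m_def by blast
  define A B where "A = \<rho> xs" and "B = \<rho> yr"
  have cAB: "A \<in> carrier_mat n n" "B \<in> carrier_mat n n" using xyc by (simp_all add: A_def B_def)
  have AB: "A *\<^sub>v w = B *\<^sub>v w + (\<phi> \<bullet> (B *\<^sub>v w)) \<cdot>\<^sub>v e" if "w \<in> carrier_vec n" for w
  proof -
    have "A *\<^sub>v w = \<rho> m *\<^sub>v (B *\<^sub>v w)"
      unfolding A_def B_def xs using rep_mult_vec[OF mc xyc(2) that] .
    then show ?thesis using \<phi>(2) that cAB by simp
  qed
  define a b where "a = (\<lambda>w. A *\<^sub>v w)" and "b = (\<lambda>w. B *\<^sub>v w)"
  define f g where "f = (\<lambda>i. \<phi> \<bullet> b ((a ^^ i) e))" and "g = (\<lambda>i. \<phi> \<bullet> b ((b ^^ i) e))"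
  have rec: "f i = g i + (\<Sum>l<i. f l * g (i - 1 - l))" for i
    unfolding f_def g_def a_def b_def by (rule moment_recurrence[OF cAB ev(1) \<phi>(1) AB])
  have a: "(a ^^ i) w = \<rho> (xs [^]\<^bsub>G\<^esub> i) *\<^sub>v w" and b: "(b ^^ i) w = \<rho> (yr [^]\<^bsub>G\<^esub> i) *\<^sub>v w"
    if "w \<in> carrier_vec n" for i w
    unfolding a_def b_def A_def B_def using funpow_rep xyc that by auto
  have ca: "(a ^^ i) e \<in> carrier_vec n" and cb: "(b ^^ i) e \<in> carrier_vec n" for i
    using a[OF ev(1)] b[OF ev(1)] mult_mat_vec_carrier[OF carrier_rep ev(1)] xyc by simp_all
  have Blin: "\<phi> \<bullet> b (k \<cdot>\<^sub>v w) = k * (\<phi> \<bullet> b w)" if "w \<in> carrier_vec n" for w k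
    using mult_mat_vec_carrier[OF cAB(2) that] cAB that \<phi>(1) by (simp add: b_def mult_mat_vec[of _ n n])
  have perf: "f (i + p) = u * f i" for i
  proof -
    have "(a ^^ (i + p)) e = (a ^^ i) (u \<cdot>\<^sub>v e)" using a[OF ev(1), of p] xsp by (simp add: funpow_add)
    also have "\<dots> = u \<cdot>\<^sub>v (a ^^ i) e" using a ev(1) xyc by (simp add: mult_mat_vec[of _ n n])
    finally show ?thesis using Blin[OF ca] unfolding f_def by simp
  qed
  have perg: "g (i + q) = v * g i" for i
  proof -
    have "(b ^^ (i + q)) e = (b ^^ i) (v \<cdot>\<^sub>v e)" using b[OF ev(1), of q] yrq by (simp add: funpow_add)
    also have "\<dots> = v \<cdot>\<^sub>v (b ^^ i) e" using b ev(1) xyc by (simp add: mult_mat_vec[of _ n n])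
    finally show ?thesis using Blin[OF cb] unfolding g_def by simp
  qed
  \<comment> \<open>\<open>A\<close> maps \<open>z\<close> to \<open>u e\<close> and is the meridian
    after \<open>B\<close>. Since \<open>B z\<close> is \<open>(u - f (p - 1)) e\<close>, applying
    the meridian gives \<open>u = (u - f (p - 1)) \<mu>\<close>.\<close>
  have last: "f (p - 1) = u * (1 - 1 / \<mu>)"
  proof -
    define z where "z = (a ^^ (p - 1)) e"
    have z: "z \<in> carrier_vec n" unfolding z_def by (rule ca)
    have Az: "A *\<^sub>v z = u \<cdot>\<^sub>v e"
    proof -
      have "A *\<^sub>v z = (a ^^ Suc (p - 1)) e" by (simp add: z_def a_def)
      then show ?thesis using a[OF ev(1), of p] xsp p by simp
    qed
    have Bz: "B *\<^sub>v z \<in> carrier_vec n" using cAB z by simp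
    have fz: "f (p - 1) = \<phi> \<bullet> (B *\<^sub>v z)" by (simp add: f_def b_def z_def)
    have comp: "u * e $ i = (B *\<^sub>v z) $ i + f (p - 1) * e $ i" if "i < n" for i
      using arg_cong[OF HOL.trans[OF Az[symmetric] AB[OF z]], of "\<lambda>w. w $ i"] that ev(1) Bz fz cAB by simp
    have Bze: "B *\<^sub>v z = (u - f (p - 1)) \<cdot>\<^sub>v e"
      by (rule eq_vecI) (use comp ev(1) Bz cAB in \<open>auto simp: algebra_simps\<close>)
    have "u \<cdot>\<^sub>v e = \<rho> m *\<^sub>v (B *\<^sub>v z)"
      unfolding Az[symmetric] unfolding A_def B_def xs using rep_mult_vec[OF mc xyc(2) z] .
    also have "\<dots> = ((u - f (p - 1)) * \<mu>) \<cdot>\<^sub>v e"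
      unfolding Bze using ev mc by (simp add: mult_mat_vec[of _ n n] smult_smult_assoc)
    finally have eq: "u \<cdot>\<^sub>v e = ((u - f (p - 1)) * \<mu>) \<cdot>\<^sub>v e" .
    obtain i where i: "i < n" "e $ i \<noteq> 0" using ev(1,2) by (metis carrier_vecD eq_vecI index_zero_vec)
    have "u = (u - f (p - 1)) * \<mu>" using arg_cong[OF eq, of "\<lambda>w. w $ i"] i ev(1) by simp
    then show ?thesis using \<mu>0 by (simp add: field_simps)
  qed
  obtain k where k: "1 \<le> k" "k \<le> p" "\<mu> ^ (p * q) * v ^ (k * p) = u ^ (k * q)"
    "k = p \<Longrightarrow> \<mu> ^ q * ((-1) ^ q * v) ^ p = (- u) ^ q"
    using moment_constraint[OF _ _ u0 \<mu>0 \<mu>1 rec perf perg last] p q by auto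
  \<comment> \<open>\<open>s q = 1 - r p\<close> trades \<open>s\<close> for \<open>r\<close>; this
    turns the constraint between \<open>u\<close> and \<open>v\<close> into one on \<open>c\<close>
    alone.\<close>
  have up: "u ^ (j * q) = c ^ j * v ^ (j * p)" for j
  proof -
    have "u ^ (j * q) = c powi (int j * (s * int q))"
      unfolding u_def by (simp add: power_int_mult[symmetric] flip: power_int_of_nat) (simp add: ac_simps)
    also have "s * int q = 1 - r * int p" using rs by simp
    also have "c powi (int j * (1 - r * int p)) = c powi int j * c powi (- r * int (j * p))"
    proof -
      have "int j * (1 - r * int p) = int j + (- r * int (j * p))" by (simp add: algebra_simps)
      then show ?thesis using power_int_add[of c "int j" "- r * int (j * p)"] c0 by presburger
    qed
    also have "c powi (- r * int (j * p)) = v ^ (j * p)"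
      unfolding v_def power_int_mult power_int_of_nat ..
    finally show ?thesis by simp
  qed
  have "lam0 * \<mu> ^ (p * q - q) = - ((-1) ^ p) \<or> (\<exists>k\<in>{1..p - 1}. lam0 ^ k * \<mu> ^ ((k - 1) * p * q) = 1)"
  proof (cases "k = p")
    case True
    have "\<mu> ^ q * ((-1) ^ (p * q) * v ^ p) = (-1) ^ q * (c * v ^ p)"
      using k(4)[OF True] up[of 1] by (simp add: power_mult_distrib power_mult[symmetric] power_minus[of u] mult.commute[of q])
    then have "\<mu> ^ q * (-1) ^ (p * q) = (-1) ^ q * c" using u0 by simp
    also have "\<dots> = (-1) ^ q * (lam0 * \<mu> ^ (p * q - q)) * \<mu> ^ q"
      using p by (simp add: c_def power_add[symmetric])
    finally have "(-1) ^ (p * q) = (-1) ^ q * (lam0 * \<mu> ^ (p * q - q))" using \<mu>0 by simp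
    then have "(-1) ^ (p * q + q) = ((-1) ^ q * (-1) ^ q) * (lam0 * \<mu> ^ (p * q - q))" by (simp add: power_add)
    then show ?thesis using minus_one_power_coprime[OF cop] by (simp flip: power_add)
  next
    case False
    then have kp: "k \<in> {1..p - 1}" using k by simp
    have "\<mu> ^ (p * q) = c ^ k" using k(3) up[of k] u0 by simp
    also have "\<dots> = lam0 ^ k * \<mu> ^ ((k - 1) * p * q) * \<mu> ^ (p * q)"
      using k(1) by (cases k) (auto simp: c_def power_mult_distrib power_mult[symmetric] power_add algebra_simps)
    finally show ?thesis using \<mu>0 kp by auto
  qed
  then show ?thesis using \<mu>0 lam0_nz by blast
qed

section \<open>Construction of representations\<close>

definition word_eval :: "('a, 'b) monoid_scheme \<Rightarrow> ('g \<Rightarrow> 'a) \<Rightarrow> 'g word \<Rightarrow> 'a" where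
  "word_eval H f w = foldr (\<lambda>(g, b) z. (if b then f g else inv\<^bsub>H\<^esub> f g) \<otimes>\<^bsub>H\<^esub> z) w \<one>\<^bsub>H\<^esub>"

lemma presented_group_hom:
  assumes H: "group H" and f: "\<And>g. f g \<in> carrier H"
    and rel: "\<And>w. w \<in> R \<Longrightarrow> word_eval H f w = \<one>\<^bsub>H\<^esub>"
  shows "\<exists>\<rho>\<in>hom (presented_group R) H. \<forall>g. \<rho> (pres_gen R g) = f g"
proof -
  interpret H: group H by (rule H)
  have cl: "word_eval H f w \<in> carrier H" for w
    by (induction w) (auto simp: word_eval_def f)
  have app: "word_eval H f (u @ v) = word_eval H f u \<otimes>\<^bsub>H\<^esub> word_eval H f v" for u v
  proof (induction u)
    case Nil
    show ?case using cl by (simp add: word_eval_def[of _ _ "[]"])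
  next
    case (Cons x u)
    show ?case using Cons cl f by (cases x) (auto simp: word_eval_def H.m_assoc)
  qed
  have pair: "word_eval H f [(g, b), (g, \<not> b)] = \<one>\<^bsub>H\<^esub>" for g b
    using f by (cases b) (auto simp: word_eval_def)
  have eq: "pres_eq R u v \<Longrightarrow> word_eval H f u = word_eval H f v" for u v
  proof (induction rule: pres_eq.induct)
    case (cancel u g b v)
    show ?case unfolding app pair using cl by simp
  next
    case (relator r u v)
    show ?case unfolding app rel[OF relator] using cl by simp
  qed auto
  \<comment> \<open>Evaluation is constant on each class of words, so the image of a class is a
    singleton and \<open>the_elem\<close> extracts the value.\<close>
  define \<rho> where "\<rho> = (\<lambda>A. the_elem (word_eval H f ` A))"
  have \<rho>: "\<rho> (pres_rel R `` {u}) = word_eval H f u" for u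
  proof -
    have "word_eval H f ` (pres_rel R `` {u}) = {word_eval H f u}"
    proof (intro equalityI subsetI)
      fix z assume "z \<in> word_eval H f ` (pres_rel R `` {u})"
      then obtain v where "pres_eq R u v" "z = word_eval H f v" unfolding pres_rel_def by blast
      then show "z \<in> {word_eval H f u}" using eq[of u v] by simp
    next
      fix z assume "z \<in> {word_eval H f u}"
      moreover have "u \<in> pres_rel R `` {u}" by (simp add: pres_rel_def pres_eq.refl)
      ultimately show "z \<in> word_eval H f ` (pres_rel R `` {u})" by blast
    qed
    then show ?thesis by (simp add: \<rho>_def)
  qed
  have "\<rho> \<in> hom (presented_group R) H"
    by (rule homI) (auto elim!: pres_carrierE simp: \<rho> cl app pres_class_mult)
  moreover have "\<rho> (pres_gen R g) = f g" for g
    using f by (simp add: pres_gen_def \<rho> word_eval_def)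
  ultimately show ?thesis by blast
qed

lemma torus_knot_group_hom:
  assumes H: "group H" and AB: "A \<in> carrier H" "B \<in> carrier H" "A [^]\<^bsub>H\<^esub> p = B [^]\<^bsub>H\<^esub> q"
  shows "\<exists>\<rho>\<in>hom (torus_knot_group p q) H.
    \<rho> (pres_gen (torus_relators p q) X) = A \<and> \<rho> (pres_gen (torus_relators p q) Y) = B"
proof -
  interpret H: group H by (rule H)
  define f where "f = (\<lambda>g. case g of X \<Rightarrow> A | Y \<Rightarrow> B)"
  have f: "f g \<in> carrier H" for g using AB by (cases g) (auto simp: f_def)
  have rep: "foldr (\<lambda>(g, b) z. (if b then f g else inv\<^bsub>H\<^esub> f g) \<otimes>\<^bsub>H\<^esub> z) (replicate k (g, b)) z
      = (if b then f g else inv\<^bsub>H\<^esub> f g) [^]\<^bsub>H\<^esub> k \<otimes>\<^bsub>H\<^esub> z" if "z \<in> carrier H" for k g b z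
    using that f by (induction k) (auto simp: H.m_assoc[symmetric] H.nat_pow_Suc2[symmetric] simp del: H.nat_pow_Suc)
  have "word_eval H f w = \<one>\<^bsub>H\<^esub>" if "w \<in> torus_relators p q" for w
  proof -
    have w: "w = replicate p (X, True) @ replicate q (Y, False)" using that by (simp add: torus_relators_def)
    have "word_eval H f w = A [^]\<^bsub>H\<^esub> p \<otimes>\<^bsub>H\<^esub> (inv\<^bsub>H\<^esub> B) [^]\<^bsub>H\<^esub> q"
      using AB f by (simp add: word_eval_def w rep del: foldr_replicate) (simp add: f_def)
    then show ?thesis using AB by (simp add: H.nat_pow_inv)
  qed
  then have "\<exists>\<rho>\<in>hom (presented_group (torus_relators p q)) H. \<forall>g. \<rho> (pres_gen (torus_relators p q) g) = f g"
    by (intro presented_group_hom H f) blast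
  then obtain \<rho> where \<rho>: "\<rho> \<in> hom (presented_group (torus_relators p q)) H"
    "\<And>g. \<rho> (pres_gen (torus_relators p q) g) = f g" by blast
  show ?thesis
    unfolding torus_knot_group_def by (rule bexI[OF _ \<rho>(1)]) (simp add: \<rho>(2) f_def)
qed

section \<open>Powers of diagonalized matrices\<close>

definition conj_diag :: "nat \<Rightarrow> complex mat \<Rightarrow> complex mat \<Rightarrow> (nat \<Rightarrow> complex) \<Rightarrow> complex mat" where
  "conj_diag N P Q z = P * mat_diag N z * Q"

context
  fixes P Q :: "complex mat" and N :: nat
  assumes PQ: "P \<in> carrier_mat N N" "Q \<in> carrier_mat N N" "P * Q = 1\<^sub>m N" "Q * P = 1\<^sub>m N"
begin

lemma conj_diag_carrier: "conj_diag N P Q z \<in> carrier_mat N N"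
  using PQ by (simp add: conj_diag_def mult_carrier_mat[of _ N N] mat_diag_dim)

lemma conj_diag_mult: "conj_diag N P Q z * conj_diag N P Q w = conj_diag N P Q (\<lambda>i. z i * w i)"
proof -
  have d: "mat_diag N u \<in> carrier_mat N N" for u by (simp add: mat_diag_dim)
  have Pd: "P * mat_diag N u \<in> carrier_mat N N" for u by (rule mult_carrier_mat[OF PQ(1) d])
  have "conj_diag N P Q z * conj_diag N P Q w = (P * mat_diag N z) * (Q * ((P * mat_diag N w) * Q))"
    unfolding conj_diag_def by (rule assoc_mult_mat[OF Pd PQ(2) mult_carrier_mat[OF Pd PQ(2)]])
  also have "Q * ((P * mat_diag N w) * Q) = (Q * (P * mat_diag N w)) * Q"
    by (rule assoc_mult_mat[symmetric, OF PQ(2) Pd PQ(2)])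
  also have "Q * (P * mat_diag N w) = mat_diag N w"
    using assoc_mult_mat[OF PQ(2,1) d[of w]] PQ(4) d[of w] by simp
  also have "(P * mat_diag N z) * (mat_diag N w * Q) = ((P * mat_diag N z) * mat_diag N w) * Q"
    by (rule assoc_mult_mat[symmetric, OF Pd d PQ(2)])
  also have "(P * mat_diag N z) * mat_diag N w = P * (mat_diag N z * mat_diag N w)"
    by (rule assoc_mult_mat[OF PQ(1) d d])
  finally show ?thesis by (simp add: conj_diag_def mat_diag_diag)
qed

lemma conj_diag_one: "conj_diag N P Q (\<lambda>i. 1) = 1\<^sub>m N"
  using PQ by (simp add: conj_diag_def mat_diag_one)

lemma conj_diag_GL:
  assumes "\<And>i. z i \<noteq> 0"
  shows "conj_diag N P Q z \<in> carrier (GL N)"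
proof -
  have "conj_diag N P Q (\<lambda>i. inverse (z i)) * conj_diag N P Q z = 1\<^sub>m N"
    "conj_diag N P Q z * conj_diag N P Q (\<lambda>i. inverse (z i)) = 1\<^sub>m N"
    unfolding conj_diag_mult using assms by (simp_all add: conj_diag_one)
  then show ?thesis using conj_diag_carrier by (auto simp: units_of_def Units_def ring_mat_simps)
qed

lemma conj_diag_nat_pow:
  "(\<And>i. z i \<noteq> 0) \<Longrightarrow> conj_diag N P Q z [^]\<^bsub>GL N\<^esub> (k :: nat) = conj_diag N P Q (\<lambda>i. z i ^ k)"
proof (induction k)
  case 0
  show ?case by (simp add: GL_one conj_diag_one)
next
  case (Suc k)
  have "conj_diag N P Q z [^]\<^bsub>GL N\<^esub> Suc k = conj_diag N P Q z [^]\<^bsub>GL N\<^esub> k * conj_diag N P Q z"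
    by (simp add: GL_mult)
  then show ?case using Suc by (simp add: conj_diag_mult mult.commute)
qed

lemma conj_diag_int_pow:
  assumes z: "\<And>i. z i \<noteq> 0"
  shows "conj_diag N P Q z [^]\<^bsub>GL N\<^esub> (k :: int) = conj_diag N P Q (\<lambda>i. z i powi k)"
proof -
  interpret GL: group "GL N" by (rule group_GL)
  show ?thesis
  proof (cases "k \<ge> 0")
    case True
    then obtain j where "k = int j" by (metis nonneg_int_cases)
    then show ?thesis using conj_diag_nat_pow[of z j, OF z] by (simp add: int_pow_int)
  next
    case False
    define j where "j = nat (- k)"
    have k: "k = - int j" using False by (simp add: j_def)
    have "conj_diag N P Q z [^]\<^bsub>GL N\<^esub> k = inv\<^bsub>GL N\<^esub> conj_diag N P Q (\<lambda>i. z i ^ j)"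
      unfolding k using GL.int_pow_neg_int[OF conj_diag_GL[of z, OF z]] conj_diag_nat_pow[of z j, OF z] by simp
    also have "\<dots> = conj_diag N P Q (\<lambda>i. z i powi k)"
    proof (rule GL.inv_equality)
      show "conj_diag N P Q (\<lambda>i. z i powi k) \<otimes>\<^bsub>GL N\<^esub> conj_diag N P Q (\<lambda>i. z i ^ j) = \<one>\<^bsub>GL N\<^esub>"
        unfolding GL_mult conj_diag_mult GL_one k using z by (simp add: power_int_minus conj_diag_one)
    qed (use z in \<open>auto intro!: conj_diag_GL simp: power_int_not_zero\<close>)
    finally show ?thesis .
  qed
qed

end

text \<open>The numerator of the partial fraction sum of the \<open>v j / (t - b j)\<close> over the
  common denominator, the product of all \<open>t - b k\<close>.\<close>

definition cauchy_poly :: "nat \<Rightarrow> (nat \<Rightarrow> complex) \<Rightarrow> (nat \<Rightarrow> complex) \<Rightarrow> complex poly" where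
  "cauchy_poly n b v = (\<Sum>j<n. Polynomial.smult (v j) (\<Prod>k\<in>{..<n} - {j}. [:- b k, 1:]))"

lemma degree_cauchy_poly: "n > 0 \<Longrightarrow> degree (cauchy_poly n b v) < n"
proof -
  assume n: "n > 0"
  have "degree (\<Prod>k\<in>{..<n} - {j}. [:- b k, 1:]) = n - 1" if "j < n" for j
    by (subst degree_prod_eq_sum_degree) (use that in auto)
  then have "degree (cauchy_poly n b v) \<le> n - 1"
    unfolding cauchy_poly_def by (intro degree_sum_le order.trans[OF degree_smult_le]) auto
  then show ?thesis using n by simp
qed

lemma poly_cauchy_poly:
  assumes "\<And>k. k < n \<Longrightarrow> t \<noteq> b k"
  shows "poly (cauchy_poly n b v) t = (\<Prod>k<n. t - b k) * (\<Sum>j<n. v j / (t - b j))"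
proof -
  have "v j * (\<Prod>k\<in>{..<n} - {j}. t - b k) = (\<Prod>k<n. t - b k) * (v j / (t - b j))" if "j < n" for j
    using that assms[OF that] prod.remove[of "{..<n}" j "\<lambda>k. t - b k"] by simp
  then show ?thesis by (simp add: cauchy_poly_def poly_sum poly_prod sum_distrib_left)
qed

lemma poly_cauchy_poly_node:
  assumes "j < n"
  shows "poly (cauchy_poly n b v) (b j) = v j * (\<Prod>k\<in>{..<n} - {j}. b j - b k)"
proof -
  have "poly (cauchy_poly n b v) (b j) = (\<Sum>i<n. v i * (\<Prod>k\<in>{..<n} - {i}. b j - b k))"
    by (simp add: cauchy_poly_def poly_sum poly_prod)
  also have "\<dots> = (\<Sum>i<n. if i = j then v j * (\<Prod>k\<in>{..<n} - {j}. b j - b k) else 0)"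
    using assms by (intro sum.cong) auto
  finally show ?thesis using assms by simp
qed

text \<open>A kernel vector of the Cauchy matrix yields a numerator of degree below \<open>n\<close>
  with the \<open>n\<close> zeros \<open>a i\<close>, hence 0; its value at \<open>b j\<close> is a
  nonzero multiple of \<open>v j\<close>.\<close>

lemma cauchy_kernel:
  fixes a b v :: "nat \<Rightarrow> complex"
  assumes "inj_on a {..<n}" "inj_on b {..<n}" and ab: "\<And>i j. i < n \<Longrightarrow> j < n \<Longrightarrow> a i \<noteq> b j"
    and v: "\<And>i. i < n \<Longrightarrow> (\<Sum>j<n. v j / (a i - b j)) = 0" and j: "j < n"
  shows "v j = 0"
proof -
  have "cauchy_poly n b v = 0"
  proof (rule poly_eqI_degree[of "a ` {..<n}"])
    show "degree (cauchy_poly n b v) < card (a ` {..<n})" "degree 0 < card (a ` {..<n})"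
      using degree_cauchy_poly[of n b v] j by (simp_all add: card_image[OF assms(1)])
    fix t assume "t \<in> a ` {..<n}"
    then obtain i where i: "i < n" "t = a i" by auto
    show "poly (cauchy_poly n b v) t = poly 0 t"
      using poly_cauchy_poly[of n "a i" b v] ab v i by simp
  qed
  then have "v j * (\<Prod>k\<in>{..<n} - {j}. b j - b k) = 0"
    using poly_cauchy_poly_node[OF j, of b v] by simp
  moreover have "(\<Prod>k\<in>{..<n} - {j}. b j - b k) \<noteq> 0"
    using inj_onD[OF assms(2)] j by auto
  ultimately show ?thesis by simp
qed

text \<open>This computes the meridian eigenvalue of the constructed representations. Subtracting
  the numerator from the product of the \<open>t - b k\<close> leaves a monic polynomial of degree
  \<open>n\<close> with the zeros \<open>a i\<close>, that is, the product of the
  \<open>t - a k\<close>; the claim is the case \<open>t = 0\<close>.\<close>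

lemma cauchy_solution_sum:
  fixes a b v :: "nat \<Rightarrow> complex"
  assumes a: "inj_on a {..<n}" and ab: "\<And>i j. i < n \<Longrightarrow> j < n \<Longrightarrow> a i \<noteq> b j" and n: "n > 0"
    and b0: "\<And>j. j < n \<Longrightarrow> b j \<noteq> 0"
    and v: "\<And>i. i < n \<Longrightarrow> (\<Sum>j<n. v j / (a i - b j)) = 1"
  shows "1 + (\<Sum>j<n. v j / b j) = (\<Prod>i<n. a i / b i)"
proof -
  have lead: "degree (\<Prod>k<n. [:- f k, 1:]) = n" "coeff (\<Prod>k<n. [:- f k, 1:]) n = 1" for f :: "nat \<Rightarrow> complex"
  proof -
    show deg: "degree (\<Prod>k<n. [:- f k, 1:]) = n" by (subst degree_prod_eq_sum_degree) auto
    show "coeff (\<Prod>k<n. [:- f k, 1:]) n = 1"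
      using lead_coeff_prod[of "\<lambda>k. [:- f k, 1:]" "{..<n}"] deg by simp
  qed
  have eq: "(\<Prod>k<n. [:- b k, 1:]) - cauchy_poly n b v = (\<Prod>k<n. [:- a k, 1:])"
  proof (rule poly_eqI_degree_lead_coeff[where n = n and A = "a ` {..<n}"])
    have "degree (cauchy_poly n b v) < n" using degree_cauchy_poly n by blast
    then show "coeff ((\<Prod>k<n. [:- b k, 1:]) - cauchy_poly n b v) n = coeff (\<Prod>k<n. [:- a k, 1:]) n"
      "degree ((\<Prod>k<n. [:- b k, 1:]) - cauchy_poly n b v) \<le> n"
      by (auto simp: lead coeff_eq_0 intro!: degree_diff_le)
    show "n \<le> card (a ` {..<n})" "degree (\<Prod>k<n. [:- a k, 1:]) \<le> n"
      by (simp_all add: card_image[OF a] lead)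
    fix t assume "t \<in> a ` {..<n}"
    then obtain i where i: "i < n" "t = a i" by auto
    have "(\<Prod>k<n. a i - a k) = 0" using i(1) by (auto intro!: prod_zero)
    then show "poly ((\<Prod>k<n. [:- b k, 1:]) - cauchy_poly n b v) t = poly (\<Prod>k<n. [:- a k, 1:]) t"
      using poly_cauchy_poly[of n "a i" b v] ab v i by (simp add: poly_prod)
  qed
  have "(\<Prod>k<n. - b k) * (1 + (\<Sum>j<n. v j / b j)) = (\<Prod>k<n. - a k)"
    using arg_cong[OF eq, of "\<lambda>f. poly f 0"] poly_cauchy_poly[of n 0 b v] b0
    by (simp add: poly_prod sum_negf algebra_simps)
  moreover have "(\<Prod>k<n. - a k) = (\<Prod>k<n. - b k) * (\<Prod>i<n. a i / b i)"
    unfolding prod.distrib[symmetric] using b0 by (intro prod.cong) auto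
  moreover have "(\<Prod>k<n. - b k) \<noteq> 0" using b0 by simp
  ultimately show ?thesis by (metis mult_left_cancel)
qed

text \<open>The identity block beside the Cauchy block carries the trivial summand of dimension
  \<open>N - n\<close>.\<close>

lemma invertible_cauchy:
  assumes "inj_on a {..<n}" "inj_on b {..<n}" and ab: "\<And>i j. i < n \<Longrightarrow> j < n \<Longrightarrow> a i \<noteq> b j" and nN: "n \<le> N"
  defines "P \<equiv> mat N N (\<lambda>(i, j). if i < n \<and> j < n then 1 / (a i - b j) else if i = j then 1 else (0 :: complex))"
  shows "\<exists>Q. Q \<in> carrier_mat N N \<and> P * Q = 1\<^sub>m N \<and> Q * P = 1\<^sub>m N"
proof -
  have c: "P \<in> carrier_mat N N" by (simp add: P_def)
  have "det P \<noteq> 0"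
  proof
    assume "det P = 0"
    then obtain v where v: "v \<in> carrier_vec N" "v \<noteq> 0\<^sub>v N" "P *\<^sub>v v = 0\<^sub>v N"
      using det_0_iff_vec_prod_zero[OF c] by blast
    have Pv: "(\<Sum>j<N. P $$ (i, j) * v $ j) = 0" if "i < N" for i
      using arg_cong[OF v(3), of "\<lambda>w. w $ i"] that v(1) c by (simp add: scalar_prod_def atLeast0LessThan)
    have "v $ j = 0" if j: "j < N" for j
    proof (cases "j < n")
      case True
      show ?thesis
      proof (rule cauchy_kernel[OF assms(1,2) ab _ True])
        fix i assume i: "i < n"
        have "(\<Sum>j<N. P $$ (i, j) * v $ j) = (\<Sum>j<n. P $$ (i, j) * v $ j)"
          by (rule sum.mono_neutral_right) (use nN i in \<open>auto simp: P_def\<close>)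
        also have "\<dots> = (\<Sum>j<n. v $ j / (a i - b j))"
          by (intro sum.cong) (use nN i in \<open>auto simp: P_def\<close>)
        finally show "(\<Sum>j<n. v $ j / (a i - b j)) = 0" using Pv[of i] i nN by simp
      qed
    next
      case False
      have "(\<Sum>k<N. P $$ (j, k) * v $ k) = (\<Sum>k<N. if k = j then v $ j else 0)"
        by (intro sum.cong) (use False j in \<open>auto simp: P_def\<close>)
      then show ?thesis using Pv[OF j] j by simp
    qed
    then have "v = 0\<^sub>v N" using v(1) by (intro eq_vecI) auto
    then show False using v(2) by simp
  qed
  from det_non_zero_imp_unit[OF c this, of "()"] show ?thesis
    by (auto simp: Units_def ring_mat_simps)
qed

section \<open>The representation with prescribed eigenvalues of the generators\<close>

lemma mat_diag_mult_vec:
  fixes f :: "nat \<Rightarrow> complex"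
  assumes "w \<in> carrier_vec n"
  shows "mat_diag n f *\<^sub>v w = vec n (\<lambda>i. f i * w $ i)"
proof (rule eq_vecI)
  fix i assume "i < dim_vec (vec n (\<lambda>i. f i * w $ i))"
  then have i: "i < n" by simp
  have "(mat_diag n f *\<^sub>v w) $ i = (\<Sum>j<n. (if i = j then f j else 0) * w $ j)"
    using i assms by (simp add: mat_diag_def scalar_prod_def atLeast0LessThan)
  also have "\<dots> = (\<Sum>j<n. if j = i then f i * w $ i else 0)" by (intro sum.cong) auto
  finally show "(mat_diag n f *\<^sub>v w) $ i = vec n (\<lambda>i. f i * w $ i) $ i" using i by simp
qed (simp add: mat_diag_def)

text \<open>The entries of \<open>P\<close> are chosen so that \<open>diag(a) P - P diag(b)\<close>
  is the all-ones block, which makes the difference of \<open>diag(a)\<close> and the conjugate of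
  \<open>diag(b)\<close> a matrix of rank one. For \<open>N = n\<close>, a nonzero invariant
  subspace contains a unit vector because the \<open>a i\<close> are distinct, then \<open>e\<close>
  because the rank one part kills no unit vector, then all unit vectors because \<open>e\<close> has
  no zero coordinate.\<close>

lemma torus_rep_construction:
  fixes p q n N :: nat and r s :: int and x y :: "nat \<Rightarrow> complex"
  assumes rs: "r * int p + s * int q = 1" and c0: "c \<noteq> 0" and n: "1 \<le> n" "n \<le> N"
    and pq: "p > 0" "q > 0"
    and x: "inj_on x {..<n}" "\<And>i. i < n \<Longrightarrow> x i ^ p = c"
    and y: "inj_on y {..<n}" "\<And>i. i < n \<Longrightarrow> y i ^ q = c"
    and no1: "\<And>i j. i < n \<Longrightarrow> j < n \<Longrightarrow> \<not> (x i = 1 \<and> y j = 1)"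
    and \<mu>: "\<mu> = (\<Prod>i<n. x i powi s * y i powi r)" "\<mu> \<noteq> 1"
  shows "\<exists>\<rho> e. KCH_rep (torus_knot_group p q) (torus_meridian p q r s) N \<rho> \<and>
    eigenvector (\<rho> (torus_meridian p q r s)) e \<mu> \<and>
    eigenvector (\<rho> (torus_longitude p q r s)) e (c * \<mu> powi (- (int p * int q))) \<and>
    (N = n \<longrightarrow> irreducible_rep (torus_knot_group p q) n \<rho>)"
proof -
  have x0: "x i \<noteq> 0" if "i < n" for i using x(2)[OF that] c0 pq by (auto simp: power_0_left)
  have y0: "y i \<noteq> 0" if "i < n" for i using y(2)[OF that] c0 pq by (auto simp: power_0_left)
  \<comment> \<open>\<open>r p + s q = 1\<close> recovers \<open>x i\<close> from
    \<open>x i powi s\<close>, so distinct \<open>x i\<close> have distinct powers.\<close>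
  have xr: "x i = c powi r * (x i powi s) ^ q" if "i < n" for i
  proof -
    have "x i = x i powi (int p * r + s * int q)" using rs by (simp add: mult.commute)
    also have "\<dots> = (x i powi int p) powi r * (x i powi s) powi int q"
      using x0[OF that] by (simp add: power_int_add power_int_mult)
    finally show ?thesis using x(2)[OF that] by simp
  qed
  have yr: "y i = (y i powi r) ^ p * c powi s" if "i < n" for i
  proof -
    have "y i = y i powi (r * int p + int q * s)" using rs by (simp add: mult.commute)
    also have "\<dots> = (y i powi r) powi int p * (y i powi int q) powi s"
      using y0[OF that] by (simp add: power_int_add power_int_mult)
    finally show ?thesis using y(2)[OF that] by simp
  qed
  define a where "a = (\<lambda>i. x i powi s)"
  define b where "b = (\<lambda>i. y i powi (- r))"
  have a0: "a i \<noteq> 0" and b0: "b i \<noteq> 0" if "i < n" for i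
    using x0[OF that] y0[OF that] by (auto simp: a_def b_def)
  have inj_a: "inj_on a {..<n}"
    using x(1) xr unfolding a_def inj_on_def by (metis lessThan_iff)
  have binv: "y i powi r = inverse (b i)" for i by (simp add: b_def power_int_minus)
  have inj_b: "inj_on b {..<n}"
    using y(1) yr unfolding inj_on_def binv by (metis lessThan_iff)
  \<comment> \<open>By the recovery formulas \<open>xr\<close> and \<open>yr\<close>, a coincidence
    \<open>a i = b j\<close> forces first \<open>x i = 1\<close> and then
    \<open>y j = 1\<close>.\<close>
  have ab: "a i \<noteq> b j" if ij: "i < n" "j < n" for i j
  proof
    assume eq: "a i = b j"
    have "x i = c powi r * (y j powi (- r)) ^ q" using xr[OF ij(1)] eq by (simp add: a_def b_def)
    also have "(y j powi (- r)) ^ q = (y j powi int q) powi (- r)"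
      by (simp add: power_int_mult[symmetric] mult.commute flip: power_int_of_nat)
    also have "\<dots> = c powi (- r)" using y(2)[OF ij(2)] by simp
    finally have "x i = 1" using c0 by (simp add: power_int_minus)
    then have "a i = 1" by (simp add: a_def)
    then have "y j powi r = 1" using eq binv by simp
    moreover have "c powi s = 1" using x(2)[OF ij(1)] \<open>x i = 1\<close> by simp
    ultimately have "y j = 1" using yr[OF ij(2)] by simp
    then show False using no1[OF ij] \<open>x i = 1\<close> by simp
  qed
  define x' where "x' = (\<lambda>i. if i < n then x i else 1)"
  define y' where "y' = (\<lambda>i. if i < n then y i else 1)"
  have x'0: "x' i \<noteq> 0" and y'0: "y' i \<noteq> 0" for i using x0 y0 by (auto simp: x'_def y'_def)
  define P where "P = mat N N (\<lambda>(i, j). if i < n \<and> j < n then 1 / (a i - b j) else if i = j then 1 else (0 :: complex))"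
  obtain Q where Q: "Q \<in> carrier_mat N N" "P * Q = 1\<^sub>m N" "Q * P = 1\<^sub>m N"
    using invertible_cauchy[OF inj_a inj_b ab n(2)] unfolding P_def by blast
  have P: "P \<in> carrier_mat N N" by (simp add: P_def)
  note PQ = P Q(1) Q(2) Q(3)
  have I: "1\<^sub>m N \<in> carrier_mat N N" "1\<^sub>m N \<in> carrier_mat N N" "1\<^sub>m N * 1\<^sub>m N = (1\<^sub>m N :: complex mat)" "1\<^sub>m N * 1\<^sub>m N = (1\<^sub>m N :: complex mat)"
    by auto
  have I_diag: "conj_diag N (1\<^sub>m N) (1\<^sub>m N) z = mat_diag N z" for z
    unfolding conj_diag_def left_mult_one_mat[OF mat_diag_dim] right_mult_one_mat[OF mat_diag_dim] ..
  define X' where "X' = mat_diag N x'"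
  define Y' where "Y' = conj_diag N P Q y'"
  have XYc: "X' \<in> carrier (GL N)" "Y' \<in> carrier (GL N)"
    unfolding X'_def Y'_def I_diag[symmetric] by (rule conj_diag_GL[OF I x'0], rule conj_diag_GL[OF PQ y'0])
  interpret GL: group "GL N" by (rule group_GL)
  have Xpow: "X' [^]\<^bsub>GL N\<^esub> (k :: int) = mat_diag N (\<lambda>i. x' i powi k)" for k
    using conj_diag_int_pow[OF I, of x' k, OF x'0] unfolding X'_def I_diag .
  have Ypow: "Y' [^]\<^bsub>GL N\<^esub> (k :: int) = conj_diag N P Q (\<lambda>i. y' i powi k)" for k
    unfolding Y'_def by (rule conj_diag_int_pow[OF PQ y'0])
  \<comment> \<open>The common value of \<open>x^p\<close> and \<open>y^q\<close> must survive
    conjugation by \<open>P\<close>; it does, being scalar on each of the two diagonal blocks of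
    \<open>P\<close>.\<close>
  have central: "conj_diag N P Q (\<lambda>i. if i < n then c else 1) = mat_diag N (\<lambda>i. if i < n then c else 1)"
  proof -
    let ?d = "\<lambda>i. if i < n then c else 1"
    have d: "mat_diag N ?d \<in> carrier_mat N N" by (simp add: mat_diag_dim)
    have "P * mat_diag N ?d = mat_diag N ?d * P"
      unfolding mat_diag_mult_left[OF P] mat_diag_mult_right[OF P]
      by (rule eq_matI) (auto simp: P_def)
    then have "conj_diag N P Q ?d = (mat_diag N ?d * P) * Q" by (simp add: conj_diag_def)
    also have "\<dots> = mat_diag N ?d" using assoc_mult_mat[OF d P Q(1)] Q(2) d by simp
    finally show ?thesis .
  qed
  have Xp: "X' [^]\<^bsub>GL N\<^esub> p = mat_diag N (\<lambda>i. if i < n then c else 1)"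
  proof -
    have "X' [^]\<^bsub>GL N\<^esub> p = mat_diag N (\<lambda>i. x' i powi int p)" using Xpow[of "int p"] by (simp add: int_pow_int)
    also have "(\<lambda>i. x' i powi int p) = (\<lambda>i. if i < n then c else 1)" using x(2) by (auto simp: x'_def)
    finally show ?thesis .
  qed
  have Yq: "Y' [^]\<^bsub>GL N\<^esub> q = mat_diag N (\<lambda>i. if i < n then c else 1)"
  proof -
    have "Y' [^]\<^bsub>GL N\<^esub> q = conj_diag N P Q (\<lambda>i. y' i powi int q)" using Ypow[of "int q"] by (simp add: int_pow_int)
    also have "(\<lambda>i. y' i powi int q) = (\<lambda>i. if i < n then c else 1)" using y(2) by (auto simp: y'_def)
    finally show ?thesis using central by simp
  qed
  define G where "G = torus_knot_group p q"
  define m where "m = torus_meridian p q r s"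
  define l where "l = torus_longitude p q r s"
  define gx where "gx = pres_gen (torus_relators p q) X"
  define gy where "gy = pres_gen (torus_relators p q) Y"
  note defs = G_def m_def l_def gx_def gy_def
  have grp: "group G" unfolding G_def torus_knot_group_def by (rule group_presented_group)
  obtain \<rho> where \<rho>: "\<rho> \<in> hom G (GL N)" "\<rho> gx = X'" "\<rho> gy = Y'"
    using torus_knot_group_hom[OF group_GL XYc, of p q] Xp Yq unfolding defs by auto
  interpret GL_rep G \<rho> N
    using grp \<rho> by (auto simp: GL_rep_def GL_rep_axioms_def)
  interpret rho: group_hom G "GL N" \<rho>
    using grp group_GL \<rho>(1) by (auto simp: group_hom_def group_hom_axioms_def)
  have gxy: "gx \<in> carrier G" "gy \<in> carrier G" by (simp_all add: defs torus_knot_group_def)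
  have m: "m = gx [^]\<^bsub>G\<^esub> s \<otimes>\<^bsub>G\<^esub> gy [^]\<^bsub>G\<^esub> r" by (simp add: defs torus_meridian_def)
  have l: "l = gx [^]\<^bsub>G\<^esub> p \<otimes>\<^bsub>G\<^esub> m [^]\<^bsub>G\<^esub> (- (int p * int q))" by (simp add: defs torus_longitude_def)
  have mc: "m \<in> carrier G" and lc: "l \<in> carrier G" using gxy unfolding l m by auto
  define a' where "a' = (\<lambda>i. x' i powi s)"
  define b' where "b' = (\<lambda>i. y' i powi (- r))"
  have a': "a' i = (if i < n then a i else 1)" and b': "b' i = (if i < n then b i else 1)" for i
    by (auto simp: a'_def b'_def a_def b_def x'_def y'_def)
  have b'0: "b' i \<noteq> 0" for i using b0 by (simp add: b')
  have A: "\<rho> (gx [^]\<^bsub>G\<^esub> s) = mat_diag N a'"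
    using rho.hom_int_pow[OF gxy(1)] \<rho>(2) Xpow by (simp add: a'_def int_pow_def)
  have Yk: "\<rho> (gy [^]\<^bsub>G\<^esub> k) = conj_diag N P Q (\<lambda>i. y' i powi k)" for k :: int
    using rho.hom_int_pow[OF gxy(2)] \<rho>(3) Ypow by simp
  have B: "\<rho> (gy [^]\<^bsub>G\<^esub> (- r)) = conj_diag N P Q b'" unfolding Yk b'_def ..
  have Binv: "\<rho> (gy [^]\<^bsub>G\<^esub> r) = conj_diag N P Q (\<lambda>i. inverse (b' i))"
    unfolding Yk b'_def by (simp add: power_int_minus)
  define E where "E = mat N N (\<lambda>(i, j). if i < n \<and> j < n then 1 else (0 :: complex))"
  have E: "E \<in> carrier_mat N N" by (simp add: E_def)
  have da: "mat_diag N u \<in> carrier_mat N N" for u :: "nat \<Rightarrow> complex" by (simp add: mat_diag_dim)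
  \<comment> \<open>On the Cauchy block this reads
    \<open>a i / (a i - b j) = b j / (a i - b j) + 1\<close>.\<close>
  have AP: "mat_diag N a' * P = P * mat_diag N b' + E"
    unfolding mat_diag_mult_left[OF P] mat_diag_mult_right[OF P]
  proof (rule eq_matI)
    fix i j assume "i < dim_row (mat N N (\<lambda>(i, j). P $$ (i, j) * b' j) + E)"
      "j < dim_col (mat N N (\<lambda>(i, j). P $$ (i, j) * b' j) + E)"
    then have ij: "i < N" "j < N" by (auto simp: E_def)
    show "mat N N (\<lambda>(i, j). a' i * P $$ (i, j)) $$ (i, j) = (mat N N (\<lambda>(i, j). P $$ (i, j) * b' j) + E) $$ (i, j)"
      using ij ab[of i j] by (auto simp: P_def E_def a' b' divide_simps)
  qed (auto simp: E_def)
  have AB: "mat_diag N a' = conj_diag N P Q b' + E * Q"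
  proof -
    have "mat_diag N a' = (mat_diag N a' * P) * Q"
      using assoc_mult_mat[OF da P Q(1)] Q(2) right_mult_one_mat[OF da] by simp
    also have "\<dots> = P * mat_diag N b' * Q + E * Q"
      unfolding AP by (rule add_mult_distrib_mat[OF mult_carrier_mat[OF P da] E Q(1)])
    finally show ?thesis by (simp add: conj_diag_def)
  qed
  \<comment> \<open>\<open>\<psi>\<close> is the functional of the rank one matrix
    \<open>E * Q\<close>. \<open>\<phi>\<close> is that of \<open>\<rho> m - 1\<close>, where the
    inverse of \<open>conj_diag N P Q b'\<close> contributes the factors
    \<open>inverse (b l)\<close>.\<close>
  define \<psi> where "\<psi> = (\<lambda>j. \<Sum>l<n. Q $$ (l, j))"
  define \<phi> where "\<phi> = (\<lambda>j. \<Sum>l<n. inverse (b l) * Q $$ (l, j))"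
  define e where "e = (\<lambda>i. if i < n then 1 else (0 :: complex))"
  have sumN: "(\<Sum>l<N. e l * f l) = (\<Sum>l<n. f l)" for f
  proof -
    have "(\<Sum>l<N. e l * f l) = (\<Sum>l<n. e l * f l)"
      by (rule sum.mono_neutral_right) (use n in \<open>auto simp: e_def\<close>)
    then show ?thesis by (simp add: e_def)
  qed
  have M: "\<rho> m = mat N N (\<lambda>(i, j). (if i = j then 1 else 0) + e i * \<phi> j)"
  proof -
    let ?D = "mat_diag N (\<lambda>i. inverse (b' i))"
    have cB: "conj_diag N P Q z \<in> carrier_mat N N" for z by (rule conj_diag_carrier[OF PQ])
    have EQ: "E * Q \<in> carrier_mat N N" by (rule mult_carrier_mat[OF E Q(1)])
    have "\<rho> m = mat_diag N a' * conj_diag N P Q (\<lambda>i. inverse (b' i))"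
      unfolding m using rep_mult[of "gx [^]\<^bsub>G\<^esub> s" "gy [^]\<^bsub>G\<^esub> r"] gxy A Binv by simp
    also have "\<dots> = conj_diag N P Q b' * conj_diag N P Q (\<lambda>i. inverse (b' i))
        + E * Q * conj_diag N P Q (\<lambda>i. inverse (b' i))"
      unfolding AB by (rule add_mult_distrib_mat[OF cB EQ cB])
    also have "conj_diag N P Q b' * conj_diag N P Q (\<lambda>i. inverse (b' i)) = 1\<^sub>m N"
      unfolding conj_diag_mult[OF PQ] using b'0 conj_diag_one[OF PQ] by simp
    also have "E * Q * conj_diag N P Q (\<lambda>i. inverse (b' i)) = E * (Q * (P * ?D * Q))"
      using assoc_mult_mat[OF E Q(1) cB] by (simp add: conj_diag_def)
    also have "Q * (P * ?D * Q) = ?D * Q"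
    proof -
      have PD: "P * ?D \<in> carrier_mat N N" by (rule mult_carrier_mat[OF P da])
      have "Q * (P * ?D * Q) = (Q * (P * ?D)) * Q" by (rule assoc_mult_mat[OF Q(1) PD Q(1), symmetric])
      also have "Q * (P * ?D) = ?D" using assoc_mult_mat[OF Q(1) P da] Q(3) left_mult_one_mat[OF da] by simp
      finally show ?thesis .
    qed
    also have "1\<^sub>m N + E * (?D * Q) = mat N N (\<lambda>(i, j). (if i = j then 1 else 0) + e i * \<phi> j)"
    proof (rule eq_matI)
      fix i j assume "i < dim_row (mat N N (\<lambda>(i, j). (if i = j then 1 else 0) + e i * \<phi> j))"
        "j < dim_col (mat N N (\<lambda>(i, j). (if i = j then 1 else 0) + e i * \<phi> j))"
      then have ij: "i < N" "j < N" by auto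
      have DQ: "?D * Q = mat N N (\<lambda>(i, j). inverse (b' i) * Q $$ (i, j))" by (rule mat_diag_mult_left[OF Q(1)])
      have "(E * (?D * Q)) $$ (i, j) = (\<Sum>l<N. E $$ (i, l) * (inverse (b' l) * Q $$ (l, j)))"
        unfolding DQ using ij E by (simp add: scalar_prod_def atLeast0LessThan)
      also have "\<dots> = (\<Sum>l<N. e l * (e i * (inverse (b' l) * Q $$ (l, j))))"
        using ij by (intro sum.cong) (auto simp: E_def e_def)
      also have "\<dots> = e i * (\<Sum>l<n. inverse (b' l) * Q $$ (l, j))"
        unfolding sumN by (simp add: sum_distrib_left)
      also have "(\<Sum>l<n. inverse (b' l) * Q $$ (l, j)) = \<phi> j" by (simp add: \<phi>_def b')
      finally show "(1\<^sub>m N + E * (?D * Q)) $$ (i, j)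
          = mat N N (\<lambda>(i, j). (if i = j then 1 else 0) + e i * \<phi> j) $$ (i, j)"
        using ij E DQ by simp
    qed (use E Q in auto)
    finally show ?thesis .
  qed
  have \<phi>e: "(\<Sum>i<N. \<phi> i * e i) = \<mu> - 1"
  proof -
    \<comment> \<open>The row sums of \<open>Q\<close> over the block solve the Cauchy system with
      right-hand side 1, as \<open>cauchy_solution_sum\<close> requires.\<close>
    define v where "v = (\<lambda>l. \<Sum>j<n. Q $$ (l, j))"
    have Pv: "(\<Sum>j<n. v j / (a i - b j)) = 1" if i: "i < n" for i
    proof -
      have "(\<Sum>j<n. v j / (a i - b j)) = (\<Sum>j<n. P $$ (i, j) * v j)"
        using i n by (intro sum.cong) (auto simp: P_def)
      also have "\<dots> = (\<Sum>j<N. P $$ (i, j) * v j)"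
        by (rule sum.mono_neutral_left) (use n i in \<open>auto simp: P_def\<close>)
      also have "\<dots> = (\<Sum>k<n. \<Sum>j<N. P $$ (i, j) * Q $$ (j, k))"
        unfolding v_def sum_distrib_left by (rule sum.swap)
      also have "\<dots> = (\<Sum>k<n. (P * Q) $$ (i, k))"
        using i n P Q(1) by (intro sum.cong) (auto simp: scalar_prod_def atLeast0LessThan)
      also have "\<dots> = (\<Sum>k<n. if k = i then 1 else 0)"
        unfolding Q(2) using i n by (intro sum.cong) auto
      finally show ?thesis using i by simp
    qed
    have "(\<Sum>i<N. \<phi> i * e i) = (\<Sum>i<N. e i * \<phi> i)" by (simp add: mult.commute)
    also have "\<dots> = (\<Sum>i<n. \<Sum>l<n. inverse (b l) * Q $$ (l, i))" unfolding sumN \<phi>_def ..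
    also have "\<dots> = (\<Sum>l<n. \<Sum>i<n. inverse (b l) * Q $$ (l, i))" by (rule sum.swap)
    also have "\<dots> = (\<Sum>l<n. v l / b l)" by (simp add: v_def sum_distrib_left divide_inverse mult.commute)
    finally have "1 + (\<Sum>i<N. \<phi> i * e i) = 1 + (\<Sum>l<n. v l / b l)" by simp
    also have "\<dots> = (\<Prod>i<n. a i / b i)"
      by (rule cauchy_solution_sum[OF inj_a ab _ b0 Pv]) (use n in auto)
    also have "\<dots> = \<mu>"
      unfolding \<mu>(1) by (intro prod.cong) (auto simp: a_def b_def power_int_minus divide_inverse)
    finally show ?thesis by (simp add: algebra_simps)
  qed
  have kch: "KCH_rep G m N \<rho>"
    using rank_one_perturbation_diagonalizable[OF M \<phi>e \<mu>(2)] n \<rho>(1) by (simp add: KCH_rep_def)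
  define ev where "ev = vec N e"
  have evc: "ev \<in> carrier_vec N" by (simp add: ev_def)
  have ev0: "ev \<noteq> 0\<^sub>v N"
  proof
    assume "ev = 0\<^sub>v N"
    then have "ev $ 0 = 0" using n by simp
    then show False using n by (simp add: ev_def e_def)
  qed
  have Mev: "\<rho> m *\<^sub>v ev = \<mu> \<cdot>\<^sub>v ev"
  proof (rule eq_vecI)
    fix i assume "i < dim_vec (\<mu> \<cdot>\<^sub>v ev)"
    then have i: "i < N" by (simp add: ev_def)
    have "(\<rho> m *\<^sub>v ev) $ i = (\<Sum>j<N. ((if i = j then 1 else 0) + e i * \<phi> j) * e j)"
      using i unfolding M by (simp add: scalar_prod_def atLeast0LessThan ev_def)
    also have "\<dots> = (\<Sum>j<N. (if i = j then e j else 0) + e i * (\<phi> j * e j))"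
      by (intro sum.cong) (auto simp: algebra_simps)
    also have "\<dots> = e i + e i * (\<mu> - 1)"
      using i by (simp add: sum.distrib \<phi>e flip: sum_distrib_left)
    finally show "(\<rho> m *\<^sub>v ev) $ i = (\<mu> \<cdot>\<^sub>v ev) $ i" using i by (simp add: ev_def algebra_simps)
  qed (simp add: M ev_def)
  have \<mu>0: "\<mu> \<noteq> 0" using x0 y0 by (auto simp: \<mu>(1))
  have Lev: "\<rho> l *\<^sub>v ev = (c * \<mu> powi (- (int p * int q))) \<cdot>\<^sub>v ev"
  proof -
    let ?k = "\<mu> powi (- (int p * int q))"
    have "\<rho> l *\<^sub>v ev = \<rho> (gx [^]\<^bsub>G\<^esub> p) *\<^sub>v (\<rho> (m [^]\<^bsub>G\<^esub> (- (int p * int q))) *\<^sub>v ev)"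
      unfolding l using rep_mult_vec[OF _ _ evc] gxy mc by simp
    also have "\<dots> = ?k \<cdot>\<^sub>v (\<rho> (gx [^]\<^bsub>G\<^esub> p) *\<^sub>v ev)"
      using eig_int_pow[OF mc evc Mev \<mu>0, of "- (int p * int q)"] evc gxy by (simp add: mult_mat_vec[of _ N N])
    also have "\<rho> (gx [^]\<^bsub>G\<^esub> p) *\<^sub>v ev = c \<cdot>\<^sub>v ev"
    proof -
      have "\<rho> (gx [^]\<^bsub>G\<^esub> p) = mat_diag N (\<lambda>i. if i < n then c else 1)"
        using rho.hom_nat_pow[OF gxy(1)] \<rho>(2) Xp by simp
      moreover have "mat_diag N (\<lambda>i. if i < n then c else 1) *\<^sub>v ev = c \<cdot>\<^sub>v ev"
      proof (rule eq_vecI)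
        fix i assume "i < dim_vec (c \<cdot>\<^sub>v ev)"
        then have i: "i < N" by (simp add: ev_def)
        then show "(mat_diag N (\<lambda>i. if i < n then c else 1) *\<^sub>v ev) $ i = (c \<cdot>\<^sub>v ev) $ i"
          unfolding mat_diag_mult_vec[OF evc] by (simp add: ev_def e_def)
      qed (simp add: mat_diag_def ev_def)
      ultimately show ?thesis by simp
    qed
    finally show ?thesis by (simp add: smult_smult_assoc mult.commute)
  qed
  have eigs: "eigenvector (\<rho> m) ev \<mu>" "eigenvector (\<rho> l) ev (c * \<mu> powi (- (int p * int q)))"
    using evc ev0 Mev Lev carrier_rep[OF mc] carrier_rep[OF lc] by (auto simp: eigenvector_def)
  have irr: "irreducible_rep G n \<rho>" if Nn: "N = n"
    unfolding irreducible_rep_def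
  proof (intro conjI allI impI)
    show "1 \<le> n" by (rule n(1))
    fix W assume sub: "VectorSpace.subspace class_ring W (module_vec TYPE(complex) n)"
      and inv: "\<forall>g\<in>carrier G. \<forall>w\<in>W. \<rho> g *\<^sub>v w \<in> W"
    have Wc: "W \<subseteq> carrier_vec n" and W0: "0\<^sub>v n \<in> W"
      and Wadd: "\<And>v w. v \<in> W \<Longrightarrow> w \<in> W \<Longrightarrow> v + w \<in> W"
      and Wsmult: "\<And>k v. v \<in> W \<Longrightarrow> k \<cdot>\<^sub>v v \<in> W"
      using sub unfolding VectorSpace.subspace_def LinearCombinations.submodule_def
      by (auto simp: module_vec_simps class_ring_simps)
    have WA: "mat_diag n a *\<^sub>v w \<in> W" if "w \<in> W" for w
    proof -
      have "mat_diag N a' = mat_diag n a" unfolding mat_diag_def Nn by (rule eq_matI) (auto simp: a')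
      then show ?thesis using inv that A gxy by (metis int_pow_closed)
    qed
    note Avec = mat_diag_mult_vec[of _ n a]
    \<comment> \<open>\<open>W\<close> is stable under \<open>diag(a) - a k\<close>. Applying these
      factors for all \<open>k \<noteq> i\<close> isolates coordinate \<open>i\<close>.\<close>
    have filt: "vec n (\<lambda>i. w $ i * (\<Prod>k\<in>S. a i - a k)) \<in> W" if "finite S" "w \<in> W" for S w
      using that(1)
    proof (induction S rule: finite_induct)
      case empty
      have "vec n (\<lambda>i. w $ i * (\<Prod>k\<in>{}. a i - a k)) = w"
        using that(2) Wc by (intro eq_vecI) auto
      then show ?case using that(2) by simp
    next
      case (insert k S)
      let ?w = "vec n (\<lambda>i. w $ i * (\<Prod>k\<in>S. a i - a k))"
      have "mat_diag n a *\<^sub>v ?w + (- a k) \<cdot>\<^sub>v ?w \<in> W"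
        using insert.IH by (intro Wadd WA Wsmult)
      also have "mat_diag n a *\<^sub>v ?w + (- a k) \<cdot>\<^sub>v ?w = vec n (\<lambda>i. w $ i * (\<Prod>k\<in>insert k S. a i - a k))"
        by (subst Avec, simp, intro eq_vecI) (use insert.hyps in \<open>auto simp: algebra_simps\<close>)
      finally show ?case .
    qed
    have unit: "unit_vec n i \<in> W" if w: "w \<in> W" "i < n" "w $ i \<noteq> 0" for w i
    proof -
      let ?c = "w $ i * (\<Prod>k\<in>{..<n} - {i}. a i - a k)"
      have c: "?c \<noteq> 0" using w inj_onD[OF inj_a] by auto
      have "(1 / ?c) \<cdot>\<^sub>v vec n (\<lambda>j. w $ j * (\<Prod>k\<in>{..<n} - {i}. a j - a k)) \<in> W"
        by (intro Wsmult filt w) simp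
      also have "(1 / ?c) \<cdot>\<^sub>v vec n (\<lambda>j. w $ j * (\<Prod>k\<in>{..<n} - {i}. a j - a k)) = unit_vec n i"
      proof (rule eq_vecI)
        fix j assume "j < dim_vec (unit_vec n i :: complex vec)"
        then have j: "j < n" by simp
        have "(\<Prod>k\<in>{..<n} - {i}. a j - a k) = 0" if "j \<noteq> i"
          using that j by (auto intro!: prod_zero bexI[of _ j])
        then show "((1 / ?c) \<cdot>\<^sub>v vec n (\<lambda>j. w $ j * (\<Prod>k\<in>{..<n} - {i}. a j - a k))) $ j = unit_vec n i $ j"
          using j w(2) c by (cases "j = i") auto
      qed simp
      finally show ?thesis .
    qed
    show "W = {0\<^sub>v n} \<or> W = carrier_vec n"
    proof (rule disjCI)
      assume "W \<noteq> carrier_vec n"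
      show "W = {0\<^sub>v n}"
      proof (rule ccontr)
        assume "W \<noteq> {0\<^sub>v n}"
        then obtain w where w: "w \<in> W" "w \<noteq> 0\<^sub>v n" using W0 by blast
        then obtain i where i: "i < n" "w $ i \<noteq> 0"
          using Wc by (metis carrier_vecD eq_vecI index_zero_vec subsetD)
        have ui: "unit_vec n i \<in> W" using unit[OF w(1) i] .
        have PQn: "P \<in> carrier_mat n n" "Q \<in> carrier_mat n n" "P * Q = 1\<^sub>m n" "Q * P = 1\<^sub>m n"
          using PQ Nn by simp_all
        have Bc: "conj_diag n P Q b' \<in> carrier_mat n n" by (rule conj_diag_carrier[OF PQn])
        have BW: "conj_diag n P Q b' *\<^sub>v unit_vec n i \<in> W"
          using inv ui B gxy Nn by (metis int_pow_closed)
        have EQ: "E * Q \<in> carrier_mat n n" using mult_carrier_mat[OF E Q(1)] Nn by simp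
        have mult_unit: "(F *\<^sub>v unit_vec n i) $ j = F $$ (j, i)" if "F \<in> carrier_mat n n" "j < n" for F :: "complex mat" and j
          using that i(1) by simp
        have EQi: "(E * Q) *\<^sub>v unit_vec n i = \<psi> i \<cdot>\<^sub>v ev"
        proof (rule eq_vecI)
          fix j assume "j < dim_vec (\<psi> i \<cdot>\<^sub>v ev)"
          then have j: "j < n" using Nn by (simp add: ev_def)
          have "((E * Q) *\<^sub>v unit_vec n i) $ j = (E * Q) $$ (j, i)" by (rule mult_unit[OF EQ j])
          also have "\<dots> = (\<Sum>l<n. E $$ (j, l) * Q $$ (l, i))"
            using E Q(1) i(1) j Nn by (simp add: scalar_prod_def atLeast0LessThan)
          also have "\<dots> = \<psi> i" using j Nn by (simp add: \<psi>_def E_def)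
          finally show "((E * Q) *\<^sub>v unit_vec n i) $ j = (\<psi> i \<cdot>\<^sub>v ev) $ j" using j Nn by (simp add: ev_def e_def)
        qed (use EQ Nn in \<open>auto simp: ev_def\<close>)
        have Aui: "mat_diag N a' *\<^sub>v unit_vec n i = conj_diag n P Q b' *\<^sub>v unit_vec n i + \<psi> i \<cdot>\<^sub>v ev"
          using add_mult_distrib_mat_vec[OF Bc EQ, of "unit_vec n i"] EQi AB[unfolded Nn] Nn by simp
        have An: "mat_diag N a' *\<^sub>v unit_vec n i = a i \<cdot>\<^sub>v unit_vec n i"
        proof -
          have "mat_diag N a' = mat_diag n a" unfolding mat_diag_def Nn by (rule eq_matI) (auto simp: a')
          then have "mat_diag N a' *\<^sub>v unit_vec n i = vec n (\<lambda>j. a j * unit_vec n i $ j)" using Avec by simp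
          also have "\<dots> = a i \<cdot>\<^sub>v unit_vec n i" using i(1) by (intro eq_vecI) auto
          finally show ?thesis .
        qed
        \<comment> \<open>Otherwise the unit vector would be an eigenvector of
          \<open>conj_diag n P Q b'\<close> for the value \<open>a i\<close>, which is none of the
          \<open>b j\<close>.\<close>
        have "\<psi> i \<noteq> 0"
        proof
          assume "\<psi> i = 0"
          then have "\<psi> i \<cdot>\<^sub>v ev = 0\<^sub>v n" using evc Nn by (intro eq_vecI) auto
          then have eq: "conj_diag n P Q b' *\<^sub>v unit_vec n i = a i \<cdot>\<^sub>v unit_vec n i"
            using Aui An mult_mat_vec_carrier[OF Bc, of "unit_vec n i"] by simp
          define z where "z = Q *\<^sub>v unit_vec n i"
          have zc: "z \<in> carrier_vec n" using PQn(2) by (simp add: z_def)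
          have dn: "mat_diag n b' \<in> carrier_mat n n" by (simp add: mat_diag_dim)
          have "mat_diag n b' *\<^sub>v z = Q *\<^sub>v (conj_diag n P Q b' *\<^sub>v unit_vec n i)"
          proof -
            have "conj_diag n P Q b' *\<^sub>v unit_vec n i = P *\<^sub>v (mat_diag n b' *\<^sub>v z)"
              unfolding conj_diag_def z_def
              using assoc_mult_mat_vec[OF mult_carrier_mat[OF PQn(1) dn] PQn(2), of "unit_vec n i"]
                assoc_mult_mat_vec[OF PQn(1) dn zc] z_def by simp
            moreover have "mat_diag n b' *\<^sub>v z \<in> carrier_vec n" by (rule mult_mat_vec_carrier[OF dn zc])
            ultimately show ?thesis
              using assoc_mult_mat_vec[OF PQn(2,1), of "mat_diag n b' *\<^sub>v z"] PQn(4) by simp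
          qed
          also have "\<dots> = a i \<cdot>\<^sub>v z" unfolding eq z_def using PQn(2) by (simp add: mult_mat_vec[of _ n n])
          finally have bz: "mat_diag n b' *\<^sub>v z = a i \<cdot>\<^sub>v z" .
          have "z $ j = 0" if j: "j < n" for j
          proof -
            have "b j * z $ j = a i * z $ j"
              using bz[unfolded mat_diag_mult_vec[OF zc], THEN arg_cong, of "\<lambda>w. w $ j"] j zc by (simp add: b')
            then show ?thesis using ab[OF i(1) j] by auto
          qed
          then have "z = 0\<^sub>v n" using zc by (intro eq_vecI) auto
          moreover have "P *\<^sub>v z = unit_vec n i"
            unfolding z_def using assoc_mult_mat_vec[OF PQn(1,2), of "unit_vec n i"] PQn(3) by simp
          moreover have "P *\<^sub>v 0\<^sub>v n = 0\<^sub>v n"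
            by (rule eq_vecI) (use PQn(1) in \<open>auto simp: scalar_prod_def\<close>)
          ultimately have "unit_vec n i = (0\<^sub>v n :: complex vec)" by simp
          then have "unit_vec n i $ i = (0 :: complex)" using i(1) by simp
          then show False using i(1) by simp
        qed
        have "ev = (1 / \<psi> i) \<cdot>\<^sub>v (a i \<cdot>\<^sub>v unit_vec n i + (- 1) \<cdot>\<^sub>v (conj_diag n P Q b' *\<^sub>v unit_vec n i))"
        proof (rule eq_vecI)
          fix j assume "j < dim_vec ((1 / \<psi> i) \<cdot>\<^sub>v (a i \<cdot>\<^sub>v unit_vec n i + (- 1) \<cdot>\<^sub>v (conj_diag n P Q b' *\<^sub>v unit_vec n i)))"
          then have j: "j < n" using Bc by simp
          have "(a i \<cdot>\<^sub>v unit_vec n i) $ j = (conj_diag n P Q b' *\<^sub>v unit_vec n i + \<psi> i \<cdot>\<^sub>v ev) $ j"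
            using Aui An by simp
          then show "ev $ j = ((1 / \<psi> i) \<cdot>\<^sub>v (a i \<cdot>\<^sub>v unit_vec n i + (- 1) \<cdot>\<^sub>v (conj_diag n P Q b' *\<^sub>v unit_vec n i))) $ j"
            using j Bc evc Nn \<open>\<psi> i \<noteq> 0\<close> by (simp add: field_simps)
        qed (use Bc evc Nn in auto)
        also have "\<dots> \<in> W" by (intro Wsmult Wadd ui BW)
        finally have evW: "ev \<in> W" .
        have uW: "unit_vec n j \<in> W" if "j < n" for j
          using unit[OF evW that] that Nn by (simp add: ev_def e_def)
        have "v \<in> W" if v: "v \<in> carrier_vec n" for v
        proof -
          have "vec n (\<lambda>i. if i < k then v $ i else 0) \<in> W" if "k \<le> n" for k
            using that
          proof (induction k)
            case 0
            have "vec n (\<lambda>i. if i < 0 then v $ i else 0) = 0\<^sub>v n" by (intro eq_vecI) auto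
            then show ?case using W0 by simp
          next
            case (Suc k)
            have "vec n (\<lambda>i. if i < k then v $ i else 0) + v $ k \<cdot>\<^sub>v unit_vec n k \<in> W"
              using Suc uW by (intro Wadd Wsmult) auto
            also have "vec n (\<lambda>i. if i < k then v $ i else 0) + v $ k \<cdot>\<^sub>v unit_vec n k
                = vec n (\<lambda>i. if i < Suc k then v $ i else 0)"
              using Suc.prems by (intro eq_vecI) (auto simp: less_Suc_eq)
            finally show ?case .
          qed
          from this[of n] have "vec n (\<lambda>i. if i < n then v $ i else 0) \<in> W" by simp
          moreover have "vec n (\<lambda>i. if i < n then v $ i else 0) = v" using v by (intro eq_vecI) auto
          ultimately show ?thesis by simp
        qed
        then show False using \<open>W \<noteq> carrier_vec n\<close> Wc by blast
      qed
    qed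
  qed
  show ?thesis using kch eigs irr unfolding defs by blast
qed

section \<open>Choice of the eigenvalues\<close>

text \<open>\<open>A\<close> and \<open>B\<close> are the eigenvalues of \<open>x\<close> and \<open>y\<close>.  The eigenvalues of \<open>x\<^sup>s\<close> and \<open>y\<^sup>-\<^sup>r\<close> are disjoint unless
  \<open>1\<close> belongs to both \<open>A\<close> and \<open>B\<close>.\<close>

definition torus_data :: "nat \<Rightarrow> nat \<Rightarrow> int \<Rightarrow> int \<Rightarrow> nat \<Rightarrow> complex \<Rightarrow> complex \<Rightarrow> bool" where
  "torus_data p q r s n c \<mu> \<longleftrightarrow> (\<exists>A B. A \<subseteq> {w. w ^ p = c} \<and> B \<subseteq> {w. w ^ q = c} \<and>
     card A = n \<and> card B = n \<and> \<not> (1 \<in> A \<and> 1 \<in> B) \<and> \<mu> = \<Prod>A powi s * \<Prod>B powi r)"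

lemma prod_powi: "(\<Prod>i\<in>A. f i powi k) = (\<Prod>i\<in>A. f i :: complex) powi k"
  by (induction A rule: infinite_finite_induct) (auto simp: power_int_mult_distrib)

lemma ex_enumeration:
  assumes "card A = n" "n \<ge> 1"
  obtains f :: "nat \<Rightarrow> 'a" where "inj_on f {..<n}" "f ` {..<n} = A"
proof -
  have "finite A" using assms card_ge_0_finite by force
  then obtain f where "bij_betw f {0..<card A} A" using ex_bij_betw_nat_finite by blast
  then show ?thesis using that assms by (auto simp: bij_betw_def atLeast0LessThan)
qed

lemma torus_data_rep:
  assumes rs: "r * int p + s * int q = 1" and c0: "c \<noteq> 0" and n: "1 \<le> n" "n \<le> N"
    and pq: "p > 0" "q > 0" and data: "torus_data p q r s n c \<mu>" and \<mu>: "\<mu> \<noteq> 1"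
  shows "\<exists>\<rho> e. KCH_rep (torus_knot_group p q) (torus_meridian p q r s) N \<rho> \<and>
    eigenvector (\<rho> (torus_meridian p q r s)) e \<mu> \<and>
    eigenvector (\<rho> (torus_longitude p q r s)) e (c * \<mu> powi (- (int p * int q))) \<and>
    (N = n \<longrightarrow> irreducible_rep (torus_knot_group p q) n \<rho>)"
proof -
  obtain A B where AB: "A \<subseteq> {w. w ^ p = c}" "B \<subseteq> {w. w ^ q = c}" "card A = n" "card B = n"
    "\<not> (1 \<in> A \<and> 1 \<in> B)" "\<mu> = \<Prod>A powi s * \<Prod>B powi r"
    using data unfolding torus_data_def by blast
  obtain x where x: "inj_on x {..<n}" "x ` {..<n} = A" using ex_enumeration[OF AB(3) n(1)] .
  obtain y where y: "inj_on y {..<n}" "y ` {..<n} = B" using ex_enumeration[OF AB(4) n(1)] .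
  have "\<mu> = (\<Prod>i<n. x i powi s * y i powi r)"
    unfolding AB(6) prod.distrib prod_powi using prod.reindex[OF x(1), of "\<lambda>w. w"] prod.reindex[OF y(1), of "\<lambda>w. w"] x(2) y(2)
    by simp
  moreover have "x i ^ p = c" "y i ^ q = c" if "i < n" for i using x(2) y(2) AB(1,2) that by blast+
  moreover have "\<not> (x i = 1 \<and> y j = 1)" if "i < n" "j < n" for i j
    using x(2) y(2) AB(5) that by (metis imageI lessThan_iff)
  ultimately show ?thesis
    using torus_rep_construction[OF rs c0 n pq x(1) _ y(1)] \<mu> by blast
qed

lemma ex_nth_root:
  fixes c :: complex
  assumes "n > 0"
  obtains z where "z ^ n = c"
proof (cases "c = 0")
  case True
  then show ?thesis using that[of 0] assms by simp
next
  case False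
  then have "{z. z ^ n = c} \<noteq> {}" using card_nth_roots[OF False assms] assms by (metis card.empty less_irrefl)
  then show ?thesis using that by blast
qed

lemma minus_one_pow_pred_self: "((-1 :: complex) ^ (p - 1)) ^ p = 1"
  unfolding power_mult[symmetric] by (rule neg_one_even_power) (cases p; simp)

text \<open>The roots of \<open>c\<close> are roots of unity scaled by \<open>\<gamma> ^ q\<close>
  and \<open>\<gamma> ^ p\<close>. If the chosen roots of unity have the products
  \<open>\<zeta> ^ q\<close> and \<open>\<zeta> ^ p\<close>, the meridian eigenvalue is
  \<open>\<gamma> ^ n * \<zeta>\<close> to the power \<open>r p + s q = 1\<close>; this dictates
  \<open>\<zeta> = \<mu> / \<gamma> ^ n\<close>. As \<open>c \<noteq> 1\<close>, the number 1 is not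
  a root of \<open>c\<close>.\<close>

lemma torus_data_generic:
  assumes pq: "1 \<le> p" "p < q" and rs: "r * int p + s * int q = 1" and n: "1 \<le> n" "n \<le> p"
    and c: "c \<noteq> 0" "c \<noteq> 1" and \<mu>: "\<mu> \<noteq> 0"
    and lt: "n < p \<Longrightarrow> c ^ n = \<mu> ^ (p * q)" and eq: "n = p \<Longrightarrow> \<mu> ^ q = (-1) ^ (p - 1) * c"
  shows "torus_data p q r s n c \<mu>"
proof -
  obtain \<gamma> where \<gamma>: "\<gamma> ^ (p * q) = c" using ex_nth_root[of "p * q" c] pq by auto
  have \<gamma>0: "\<gamma> \<noteq> 0" using \<gamma> c pq by (auto simp: power_0_left)
  define \<zeta> where "\<zeta> = \<mu> / \<gamma> ^ n"
  have \<zeta>0: "\<zeta> \<noteq> 0" using \<mu> \<gamma>0 by (simp add: \<zeta>_def)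
  have \<zeta>q: "\<zeta> ^ q = (-1) ^ (p - 1)" if "n = p"
    using eq[OF that] \<gamma> c that by (simp add: \<zeta>_def power_divide power_mult[symmetric])
  have \<zeta>: "\<zeta> ^ (p * q) = 1"
  proof (cases "n = p")
    case True
    then show ?thesis using minus_one_pow_pred_self[of p] \<zeta>q by (simp add: mult.commute[of p] power_mult)
  next
    case False
    have "\<zeta> ^ (p * q) = \<mu> ^ (p * q) / (\<gamma> ^ (p * q)) ^ n"
      by (simp add: \<zeta>_def power_divide power_mult[symmetric] mult.commute)
    then show ?thesis using lt False n c \<gamma> \<mu> by auto
  qed
  \<comment> \<open>For \<open>n = p\<close> all \<open>p\<close>-th roots of unity must be taken,
    and \<open>eq\<close> is the condition that their product is \<open>\<zeta> ^ q\<close>.\<close>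
  obtain S where S: "S \<subseteq> {w. w ^ p = 1}" "card S = n" "\<Prod>S = \<zeta> ^ q"
  proof (cases "n = p")
    case True
    show ?thesis
      by (rule that[of "{w. w ^ p = 1}"]) (use True \<zeta>q pq prod_roots_unity card_roots_unity_eq in auto)
  next
    case False
    then show ?thesis
      using ex_roots_unity_prod[of n p "\<zeta> ^ q"] n \<zeta> that by (auto simp: power_mult[symmetric] mult.commute)
  qed
  obtain T where T: "T \<subseteq> {w. w ^ q = 1}" "card T = n" "\<Prod>T = \<zeta> ^ p"
    using ex_roots_unity_prod[of n q "\<zeta> ^ p"] n pq \<zeta> by (auto simp: power_mult[symmetric])
  let ?A = "(\<lambda>w. \<gamma> ^ q * w) ` S" and ?B = "(\<lambda>w. \<gamma> ^ p * w) ` T"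
  have inj: "inj_on (\<lambda>w. \<gamma> ^ k * w) U" for k U using \<gamma>0 by (auto intro: inj_onI)
  have A: "?A \<subseteq> {w. w ^ p = c}" and B: "?B \<subseteq> {w. w ^ q = c}"
    using S(1) T(1) \<gamma> by (auto simp: power_mult_distrib power_mult[symmetric] mult.commute[of q])
  have pA: "\<Prod>?A = \<gamma> ^ (q * n) * \<zeta> ^ q" and pB: "\<Prod>?B = \<gamma> ^ (p * n) * \<zeta> ^ p"
    using S(2,3) T(2,3) by (simp_all add: prod.reindex[OF inj] prod.distrib power_mult)
  have "\<Prod>?A powi s * \<Prod>?B powi r = (\<gamma> ^ n * \<zeta>) powi (r * int p + s * int q)"
  proof -
    have "\<Prod>?A = (\<gamma> ^ n * \<zeta>) powi int q" "\<Prod>?B = (\<gamma> ^ n * \<zeta>) powi int p"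
      unfolding pA pB by (simp_all add: power_mult_distrib power_mult[symmetric] mult.commute)
    then have "\<Prod>?A powi s * \<Prod>?B powi r = (\<gamma> ^ n * \<zeta>) powi (int q * s) * (\<gamma> ^ n * \<zeta>) powi (int p * r)"
      by (simp only: power_int_mult)
    also have "\<dots> = (\<gamma> ^ n * \<zeta>) powi (int q * s + int p * r)"
      using \<gamma>0 \<zeta>0 by (subst power_int_add) auto
    also have "int q * s + int p * r = r * int p + s * int q" by simp
    finally show ?thesis .
  qed
  then have prod: "\<mu> = \<Prod>?A powi s * \<Prod>?B powi r" using rs \<gamma>0 by (simp add: \<zeta>_def)
  have "1 \<notin> ?A" using A c(2) by force
  then have no1: "\<not> (1 \<in> ?A \<and> 1 \<in> ?B)" by blast
  have card: "card ?A = n" "card ?B = n" using S(2) T(2) card_image[OF inj] by metis+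
  show ?thesis
    unfolding torus_data_def
    by (rule exI[of _ ?A], rule exI[of _ ?B]) (intro conjI A B card no1 prod)
qed

text \<open>The one-dimensional representation with meridian \<open>\<mu>\<close> sends
  \<open>x\<close> to \<open>\<mu> ^ q\<close> and \<open>y\<close> to \<open>\<mu> ^ p\<close>; if
  both were 1, so would be \<open>\<mu>\<close>.\<close>

lemma torus_data_one:
  assumes rs: "r * int p + s * int q = 1" and \<mu>: "\<mu> \<noteq> 0" "\<mu> \<noteq> 1"
  shows "torus_data p q r s 1 (\<mu> ^ (p * q)) \<mu>"
proof -
  have e: "\<mu> = (\<mu> ^ q) powi s * (\<mu> ^ p) powi r"
  proof -
    have "(\<mu> powi int q) powi s * (\<mu> powi int p) powi r = \<mu> powi (int q * s + int p * r)"
      using \<mu> by (simp add: power_int_add power_int_mult)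
    also have "int q * s + int p * r = 1" using rs by (simp add: mult.commute)
    finally show ?thesis by simp
  qed
  have "\<not> (1 = \<mu> ^ q \<and> 1 = \<mu> ^ p)" using e \<mu>(2) by auto
  then show ?thesis
    unfolding torus_data_def
    by (intro exI[of _ "{\<mu> ^ q}"] exI[of _ "{\<mu> ^ p}"])
      (use e in \<open>auto simp: power_mult[symmetric] mult.commute\<close>)
qed

text \<open>For \<open>c = 1\<close> and \<open>n = p\<close> the eigenvalues of \<open>x\<close>
  are all \<open>p\<close>-th roots of unity, 1 among them, so those of \<open>y\<close> must be
  \<open>p\<close> nontrivial \<open>q\<close>-th roots of unity with product
  \<open>\<mu> ^ p\<close>. For \<open>q > p + 2\<close> any product can be reached; for
  \<open>q = p + 2\<close> one nontrivial root is omitted; for \<open>q = p + 1\<close> the set is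
  forced, which is where exceptional eigenvalues arise.\<close>

lemma torus_data_special:
  assumes pq: "2 \<le> p" "p < q" and cop: "coprime p q" and rs: "r * int p + s * int q = 1"
    and \<mu>: "\<mu> \<noteq> 0" "\<mu> \<noteq> 1" "\<mu> ^ q = (-1) ^ (p - 1)" and ne: "\<not> exceptional_eigenvalue p q p \<mu>"
  shows "torus_data p q r s p 1 \<mu>"
proof -
  let ?R = "{w :: complex. w ^ q = 1}"
  have cR: "card ?R = q" and finR: "finite ?R" using pq by (auto intro: card_roots_unity_eq finite_nth_roots)
  have pR: "\<Prod>?R = (-1) ^ (q - 1)" using pq by (intro prod_roots_unity) simp
  have \<mu>p: "(\<mu> ^ p) ^ q = 1"
    using \<mu>(3) minus_one_pow_pred_self[of p] by (metis mult.commute power_mult)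
  have "\<exists>B. B \<subseteq> ?R - {1} \<and> card B = p \<and> \<Prod>B = \<mu> ^ p"
  proof -
    consider "p + 2 < q" | "q = p + 2" | "q = p + 1" using pq by linarith
    then show ?thesis
    proof cases
      case 1
      show ?thesis by (rule ex_nontrivial_roots_unity_prod[OF pq(1) 1 \<mu>p])
    next
      case 2
      have odd: "odd p" using cop 2 by (metis coprime_common_divisor dvd_add dvd_refl even_add odd_one)
      \<comment> \<open>The root to omit: \<open>q\<close> is odd, so all \<open>q\<close>-th roots
        of unity have product 1 and removing 1 and \<open>\<omega>\<close> leaves
        \<open>inverse \<omega>\<close>. That \<open>\<omega> \<noteq> 1\<close> uses that
        \<open>p\<close> is odd.\<close>
      define \<omega> where "\<omega> = inverse (\<mu> ^ p)"
      have q1: "\<Prod>?R = 1" unfolding pR using odd 2 by simp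
      have "\<mu> ^ p \<noteq> 1"
      proof
        assume "\<mu> ^ p = 1"
        moreover have "\<mu> ^ p * \<mu> ^ 2 = 1" using \<mu>(3) odd 2 by (simp flip: power_add)
        ultimately have "\<mu> ^ 2 = 1" by simp
        then have "\<mu> = -1" using \<mu>(2) by (simp add: power2_eq_1_iff)
        then show False using \<open>\<mu> ^ p = 1\<close> odd by simp
      qed
      then have \<omega>: "\<omega> \<noteq> 1" "\<omega> \<in> ?R" using \<mu>p by (auto simp: \<omega>_def power_inverse)
      have w0: "\<omega> \<noteq> 0" using \<mu>(1) by (simp add: \<omega>_def)
      have "card (?R - {1, \<omega>}) = p" using \<omega> cR 2 by (subst card_Diff_subset) auto
      moreover have "\<Prod>?R = 1 * (\<omega> * \<Prod>(?R - {1, \<omega>}))"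
      proof -
        have "\<Prod>?R = 1 * \<Prod>(?R - {1})" using finR by (intro prod.remove) auto
        also have "\<Prod>(?R - {1}) = \<omega> * \<Prod>(?R - {1} - {\<omega>})" using finR \<omega> by (intro prod.remove) auto
        also have "?R - {1} - {\<omega>} = ?R - {1, \<omega>}" by auto
        finally show ?thesis .
      qed
      then have "\<Prod>(?R - {1, \<omega>}) = \<mu> ^ p" using q1 w0 \<mu>(1) by (simp add: \<omega>_def field_simps)
      ultimately show ?thesis by (intro exI[of _ "?R - {1, \<omega>}"]) auto
    next
      case 3
      have "(- \<mu>) ^ q = (-1) ^ q * \<mu> ^ q" by (rule power_minus)
      also have "\<dots> = 1" unfolding \<mu>(3) using 3 pq by (cases p) auto
      finally have "\<mu> = -1" using ne 3 pq unfolding exceptional_eigenvalue_def by auto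
      moreover have "card (?R - {1}) = p" using cR 3 by (subst card_Diff_subset) auto
      moreover have "\<Prod>(?R - {1}) = \<Prod>?R" using finR prod.remove[of ?R 1 "\<lambda>w. w"] by simp
      ultimately show ?thesis using pR 3 by (intro exI[of _ "?R - {1}"]) auto
    qed
  qed
  then obtain B where B: "B \<subseteq> ?R - {1}" "card B = p" "\<Prod>B = \<mu> ^ p" by blast
  let ?A = "{w :: complex. w ^ p = 1}"
  have A: "card ?A = p" "\<Prod>?A = \<mu> ^ q"
    using pq \<mu>(3) card_roots_unity_eq[of p] prod_roots_unity[of p] by auto
  have "\<mu> = (\<mu> ^ q) powi s * (\<mu> ^ p) powi r"
  proof -
    have "(\<mu> powi int q) powi s * (\<mu> powi int p) powi r = \<mu> powi (int q * s + int p * r)"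
      using \<mu> by (simp add: power_int_add power_int_mult)
    also have "int q * s + int p * r = 1" using rs by (simp add: mult.commute)
    finally show ?thesis by simp
  qed
  then show ?thesis
    unfolding torus_data_def using A B by (intro exI[of _ ?A] exI[of _ B]) auto
qed

lemma ex_torus_data:
  assumes pq: "1 \<le> p" "p < q" and cop: "coprime p q" and rs: "r * int p + s * int q = 1"
    and n: "1 \<le> n" "n \<le> p" and \<mu>: "\<mu> \<noteq> 0" "\<mu> \<noteq> 1" and ne: "\<not> exceptional_eigenvalue p q n \<mu>"
  shows "\<exists>c. c \<noteq> 0 \<and> torus_data p q r s n c \<mu>"
proof -
  consider "n = 1" | "2 \<le> n" "n < p" | "2 \<le> n" "n = p" using n by linarith
  then show ?thesis
  proof cases
    case 1
    then show ?thesis using torus_data_one[OF rs \<mu>] \<mu> by (intro exI[of _ "\<mu> ^ (p * q)"]) simp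
  next
    case 2
    \<comment> \<open>As \<open>n \<ge> 2\<close>, there is a choice between several roots, which
      allows the value 1 to be avoided.\<close>
    have "\<exists>c. c ^ n = \<mu> ^ (p * q) \<and> c \<noteq> 1"
    proof (cases "\<mu> ^ (p * q) = 1")
      case True
      have "\<not> {c :: complex. c ^ n = 1} \<subseteq> {1}"
      proof
        assume "{c :: complex. c ^ n = 1} \<subseteq> {1}"
        from card_mono[OF _ this] show False using card_roots_unity_eq[of n] 2 by simp
      qed
      then show ?thesis using True by auto
    next
      case False
      obtain c where "c ^ n = \<mu> ^ (p * q)" using ex_nth_root[of n "\<mu> ^ (p * q)"] n by auto
      then show ?thesis using False by (intro exI[of _ c]) auto
    qed
    then obtain c where c: "c ^ n = \<mu> ^ (p * q)" "c \<noteq> 1" by blast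
    have c0: "c \<noteq> 0" using c(1) \<mu>(1) n by (metis One_nat_def not_one_le_zero power_0_left power_not_zero)
    have "torus_data p q r s n c \<mu>"
      by (rule torus_data_generic[OF pq rs n c0 c(2) \<mu>(1)]) (use c 2 in auto)
    then show ?thesis using c0 by blast
  next
    case 3
    \<comment> \<open>For \<open>n = p\<close> there is no freedom: all \<open>p\<close>-th roots of
      \<open>c\<close> are eigenvalues of \<open>x\<close>, and their product determines
      \<open>c\<close>.\<close>
    define c where "c = (-1) ^ (p - 1) * \<mu> ^ q"
    have c0: "c \<noteq> 0" using \<mu>(1) by (simp add: c_def)
    have \<mu>q: "\<mu> ^ q = (-1) ^ (p - 1) * c" by (simp add: c_def flip: mult.assoc power_add)
    show ?thesis
    proof (cases "c = 1")
      case True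
      then have "torus_data p q r s p 1 \<mu>"
        using torus_data_special[OF _ pq(2) cop rs \<mu>] \<mu>q ne 3 by simp
      then show ?thesis using 3 by (intro exI[of _ 1]) simp
    next
      case False
      have "torus_data p q r s n c \<mu>"
        by (rule torus_data_generic[OF pq rs n c0 False \<mu>(1)]) (use \<mu>q 3 in auto)
      then show ?thesis using c0 by blast
    qed
  qed
qed

text \<open>The condition on \<open>y\<close> serves to exclude \<open>c = 1\<close>, for which the
  curve equations give \<open>y ^ q = 1\<close>, \<open>y ^ q = -1\<close> or
  \<open>y ^ (p * q) = 1\<close>. It removes only finitely many points from the curves.\<close>

lemma torus_curve_point_KCH_pair:
  assumes pq: "1 \<le> p" "p < q" and rs: "r * int p + s * int q = 1" and N: "p \<le> N"
    and z: "x \<noteq> 0" "y \<noteq> 0" "y ^ (2 * p * q) \<noteq> 1"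
    and curve: "x * y ^ (p * q - q) = - ((-1) ^ p) \<or> (\<exists>n\<in>{1..p - 1}. x ^ n * y ^ ((n - 1) * p * q) = 1)"
  shows "(x, y) \<in> KCH_pairs (torus_knot_group p q) (torus_meridian p q r s) (torus_longitude p q r s) N"
proof -
  define c where "c = x * y ^ (p * q)"
  have c0: "c \<noteq> 0" using z by (simp add: c_def)
  have y1: "y \<noteq> 1" using z(3) by auto
  have ypq: "y ^ (p * q) \<noteq> 1"
  proof
    assume "y ^ (p * q) = 1"
    then have "(y ^ (p * q)) ^ 2 = 1" by simp
    then show False using z(3) by (simp add: power_mult[symmetric] ac_simps)
  qed
  have "\<exists>n. 1 \<le> n \<and> n \<le> p \<and> torus_data p q r s n c y"
    using curve
  proof
    assume a: "x * y ^ (p * q - q) = - ((-1) ^ p)"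
    have "c = (x * y ^ (p * q - q)) * y ^ q" using pq by (simp add: c_def power_add[symmetric])
    then have c: "c = (-1) ^ (p - 1) * y ^ q" unfolding a using pq(1) by (cases p) auto
    have yq: "y ^ q = (-1) ^ (p - 1) * c" by (simp add: c flip: mult.assoc power_add)
    have c1: "c \<noteq> 1"
    proof
      assume "c = 1"
      then have "(y ^ q) ^ (2 * p) = 1" using yq by (simp add: power_mult[symmetric] mult.commute)
      then show False using z(3) by (simp add: power_mult[symmetric] ac_simps)
    qed
    have "torus_data p q r s p c y"
      by (rule torus_data_generic[OF pq rs pq(1) _ c0 c1 z(2)]) (use yq in auto)
    then show ?thesis using pq by blast
  next
    assume "\<exists>n\<in>{1..p - 1}. x ^ n * y ^ ((n - 1) * p * q) = 1"
    then obtain n where n: "1 \<le> n" "n \<le> p - 1" "x ^ n * y ^ ((n - 1) * p * q) = 1" by auto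
    have "c ^ n = x ^ n * y ^ ((n - 1) * p * q) * y ^ (p * q)"
      using n(1) by (cases n) (auto simp: c_def power_mult_distrib power_mult[symmetric] power_add algebra_simps)
    then have c: "c ^ n = y ^ (p * q)" using n(3) by simp
    then have c1: "c \<noteq> 1" using ypq by auto
    have "torus_data p q r s n c y"
      by (rule torus_data_generic[OF pq rs n(1) _ c0 c1 z(2)]) (use c n pq in auto)
    then show ?thesis using n by (intro exI[of _ n]) auto
  qed
  then obtain n where n: "1 \<le> n" "n \<le> p" "torus_data p q r s n c y" by blast
  have "c * y powi (- (int p * int q)) = x"
    using z(2) by (simp add: c_def power_int_minus flip: of_nat_mult)
  then obtain \<rho> e where "KCH_rep (torus_knot_group p q) (torus_meridian p q r s) N \<rho>"
    "eigenvector (\<rho> (torus_meridian p q r s)) e y" "eigenvector (\<rho> (torus_longitude p q r s)) e x"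
    using torus_data_rep[OF rs c0 n(1) _ _ _ n(3) y1, of N] n(2) N pq by auto
  then show ?thesis unfolding KCH_pairs_def using y1 by blast
qed

section \<open>Laurent polynomials and monomial curves\<close>

lemma powi_sum_eq_poly:
  fixes t :: complex
  assumes "\<And>k. k \<in> K \<Longrightarrow> m \<le> e k" "t \<noteq> 0"
  shows "(\<Sum>k\<in>K. c k * t powi e k) * t powi (- m) = poly (\<Sum>k\<in>K. monom (c k) (nat (e k - m))) t"
proof -
  have "c k * t powi e k * t powi (- m) = c k * t ^ nat (e k - m)" if "k \<in> K" for k
  proof -
    have "t powi e k * t powi (- m) = t powi int (nat (e k - m))"
      using assms that by (simp add: power_int_add[symmetric])
    then show ?thesis unfolding power_int_of_nat by (simp add: mult.assoc)
  qed
  then show ?thesis unfolding sum_distrib_right poly_sum poly_monom by (rule sum.cong[OF HOL.refl])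
qed

text \<open>The exponents \<open>e k\<close> of different indices may coincide, so the conclusion
  concerns the values of the sum and not the coefficients.\<close>

lemma powi_sum_identity:
  fixes t :: complex
  assumes "finite K" "infinite T" "\<And>t. t \<in> T \<Longrightarrow> t \<noteq> 0 \<and> (\<Sum>k\<in>K. c k * t powi e k) = 0" "t \<noteq> 0"
  shows "(\<Sum>k\<in>K. c k * t powi e k) = 0"
proof -
  define m where "m = Min (insert 0 (e ` K))"
  have m: "m \<le> e k" if "k \<in> K" for k using that assms(1) by (simp add: m_def)
  let ?f = "\<Sum>k\<in>K. monom (c k) (nat (e k - m))"
  have "poly ?f t = 0" if "t \<in> T" for t
    using powi_sum_eq_poly[of K m e t c, OF m] assms(3)[OF that] by simp
  then have "T \<subseteq> {t. poly ?f t = 0}" by blast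
  then have "?f = 0" using assms(2) poly_roots_finite finite_subset by blast
  then show ?thesis using powi_sum_eq_poly[of K m e t c, OF m assms(4)] assms(4) by simp
qed

lemma powi_sum_coeffs_0:
  fixes c :: "int \<Rightarrow> complex"
  assumes "finite A" "infinite T" "\<And>t. t \<in> T \<Longrightarrow> t \<noteq> 0 \<and> (\<Sum>a\<in>A. c a * t powi a) = 0" "a \<in> A"
  shows "c a = 0"
proof -
  define m where "m = Min A"
  have m: "m \<le> a" if "a \<in> A" for a using that assms(1) by (simp add: m_def)
  let ?f = "\<Sum>a\<in>A. monom (c a) (nat (a - m))"
  have "poly ?f t = 0" if "t \<in> T" for t
    using powi_sum_eq_poly[of A m "\<lambda>a. a" t c, OF m] assms(3)[OF that] by simp
  then have "T \<subseteq> {t. poly ?f t = 0}" by blast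
  then have f0: "?f = 0" using assms(2) poly_roots_finite finite_subset by blast
  have "coeff ?f (nat (a - m)) = (\<Sum>b\<in>A. if b = a then c b else 0)"
    unfolding coeff_sum using m assms(4) by (intro sum.cong) (auto simp: nat_eq_iff)
  also have "\<dots> = c a" using assms by simp
  finally show ?thesis using f0 by simp
qed

text \<open>With two nonzero terms, division by the lowest occurring power leaves a nonconstant
  polynomial with nonzero constant term, whose roots are therefore nonzero.\<close>

lemma powi_sum_root:
  fixes c :: "int \<Rightarrow> complex"
  assumes "finite A" "a \<in> A" "b \<in> A" "a \<noteq> b" "c a \<noteq> 0" "c b \<noteq> 0"
  shows "\<exists>t. t \<noteq> 0 \<and> (\<Sum>a\<in>A. c a * t powi a) = 0"
proof -
  define B where "B = {a \<in> A. c a \<noteq> 0}"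
  have B: "finite B" "a \<in> B" "b \<in> B" using assms by (auto simp: B_def)
  have AB: "(\<Sum>a\<in>A. c a * t powi a) = (\<Sum>a\<in>B. c a * t powi a)" for t
    unfolding B_def by (rule sum.mono_neutral_right) (use assms(1) in auto)
  define m where "m = Min B"
  have m: "m \<le> a" if "a \<in> B" for a using that B by (simp add: m_def)
  have mB: "m \<in> B" using B Min_in unfolding m_def by blast
  let ?f = "\<Sum>a\<in>B. monom (c a) (nat (a - m))"
  have coeff: "coeff ?f (nat (a - m)) = c a" if "a \<in> B" for a
  proof -
    have "coeff ?f (nat (a - m)) = (\<Sum>b\<in>B. if b = a then c b else 0)"
      unfolding coeff_sum using m that by (intro sum.cong) (auto simp: nat_eq_iff)
    then show ?thesis using B that by simp
  qed
  obtain d where d: "d \<in> B" "d \<noteq> m" using B assms(4) by metis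
  then have dm: "d > m" using m by force
  have "\<not> (\<exists>a l. a \<noteq> 0 \<and> l = 0 \<and> ?f = pCons a l)"
  proof
    assume "\<exists>a l. a \<noteq> 0 \<and> l = 0 \<and> ?f = pCons a l"
    then obtain a where "?f = [:a:]" by auto
    then have "coeff ?f (nat (d - m)) = 0" using dm by (simp add: coeff_pCons split: nat.splits)
    then show False using coeff[OF d(1)] d(1) by (simp add: B_def)
  qed
  then obtain t where t: "poly ?f t = 0" using fundamental_theorem_of_algebra_alt by blast
  have "coeff ?f 0 \<noteq> 0" using coeff[OF mB] mB by (simp add: B_def)
  then have "t \<noteq> 0" using t by (auto simp: poly_0_coeff_0)
  then show ?thesis using powi_sum_eq_poly[of B m "\<lambda>a. a" t c, OF m] t AB by auto
qed

section \<open>Laurent polynomials in two variables as functions on the torus\<close>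

definition lam_coeff :: "laurent2 \<Rightarrow> int \<Rightarrow> complex \<Rightarrow> complex" where
  "lam_coeff F a y = (\<Sum>b\<in>snd ` Poly_Mapping.keys F. Poly_Mapping.lookup F (a, b) * y powi b)"

lemma laurent_eval_lam_coeff:
  "laurent_eval F (x, y) = (\<Sum>a\<in>fst ` Poly_Mapping.keys F. lam_coeff F a y * x powi a)"
proof -
  have "laurent_eval F (x, y) = (\<Sum>k\<in>fst ` Poly_Mapping.keys F \<times> snd ` Poly_Mapping.keys F.
      Poly_Mapping.lookup F k * fst (x, y) powi fst k * snd (x, y) powi snd k)"
    by (rule laurent_eval_superset) (force)+
  then show ?thesis
    by (simp add: lam_coeff_def sum.cartesian_product[symmetric] sum_distrib_right sum_distrib_left ac_simps case_prod_unfold)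
      (simp add: sum.cartesian_product case_prod_unfold ac_simps)
qed

lemma finite_lam_coeff_roots:
  assumes "(a, b) \<in> Poly_Mapping.keys F"
  shows "finite {y. y \<noteq> 0 \<and> lam_coeff F a y = 0}"
proof (rule ccontr)
  assume inf: "infinite {y. y \<noteq> 0 \<and> lam_coeff F a y = 0}"
  have "Poly_Mapping.lookup F (a, b) = 0"
    by (rule powi_sum_coeffs_0[OF _ inf, of "snd ` Poly_Mapping.keys F"])
      (use assms in \<open>force simp: lam_coeff_def\<close>)+
  then show False using assms by (simp add: in_keys_iff)
qed

lemma infinite_nonzero_diff: "finite A \<Longrightarrow> infinite (UNIV - {0} - A :: complex set)"
  by (simp add: infinite_UNIV_char_0)

text \<open>For fixed \<open>y\<close>, infinitely many zeros in \<open>x\<close> annihilate the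
  value at \<open>y\<close> of each coefficient of a power of \<open>lam\<close>; infinitely many
  \<open>y\<close> then annihilate the coefficient itself.\<close>

lemma laurent_eq_0I:
  assumes YS: "infinite YS" "0 \<notin> YS"
    and XS: "\<And>y. y \<in> YS \<Longrightarrow> infinite {x. x \<noteq> 0 \<and> laurent_eval F (x, y) = 0}"
  shows "F = 0"
proof (rule ccontr)
  assume "F \<noteq> 0"
  then obtain a b where ab: "(a, b) \<in> Poly_Mapping.keys F"
    by (metis keys_eq_empty ex_in_conv surj_pair)
  have "lam_coeff F a y = 0" if "y \<in> YS" for y
    by (rule powi_sum_coeffs_0[OF _ XS[OF that], of "fst ` Poly_Mapping.keys F"])
      (use ab in \<open>force simp: laurent_eval_lam_coeff\<close>)+
  then have "YS \<subseteq> {y. y \<noteq> 0 \<and> lam_coeff F a y = 0}" using YS(2) by auto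
  then show False using finite_lam_coeff_roots[OF ab] YS(1) finite_subset by blast
qed

lemma laurent_eval_minus [simp]: "laurent_eval (- F) z = - laurent_eval F z"
  using laurent_eval_add[of F "- F" z] by (simp add: eq_neg_iff_add_eq_0 add.commute)

lemma laurent_eval_diff: "laurent_eval (F - G) z = laurent_eval F z - laurent_eval G z"
  using laurent_eval_add[of F "- G" z] by simp

lemma laurent_eqI:
  assumes "\<And>z. z \<in> torus2 \<Longrightarrow> laurent_eval F z = laurent_eval G z"
  shows "F = G"
proof -
  have "F - G = 0"
  proof (rule laurent_eq_0I[of "UNIV - {0}"])
    fix y :: complex assume "y \<in> UNIV - {0}"
    then have "{x. x \<noteq> 0 \<and> laurent_eval (F - G) (x, y) = 0} = UNIV - {0}"
      using assms by (auto simp: laurent_eval_diff torus2_def)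
    then show "infinite {x. x \<noteq> 0 \<and> laurent_eval (F - G) (x, y) = 0}"
      using infinite_nonzero_diff[of "{}"] by simp
  qed (use infinite_nonzero_diff[of "{}"] in auto)
  then show ?thesis by simp
qed

lemma laurent_eval_prod:
  "z \<in> torus2 \<Longrightarrow> laurent_eval (\<Prod>i\<in>I. f i) z = (\<Prod>i\<in>I. laurent_eval (f i) z)"
  by (induction I rule: infinite_finite_induct) (auto simp: laurent_eval_1 laurent_eval_mult)

lemma laurent_eval_power:
  "z \<in> torus2 \<Longrightarrow> laurent_eval (F ^ n) z = laurent_eval F z ^ n"
  by (induction n) (auto simp: laurent_eval_1 laurent_eval_mult)

lemma laurent_eval_lam [simp]: "laurent_eval lam z = fst z"
  and laurent_eval_mu [simp]: "laurent_eval mu z = snd z"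
  by (simp_all add: lam_def mu_def laurent_eval_single)

lemma laurent_single_unit:
  assumes "c \<noteq> 0"
  shows "(Poly_Mapping.single k c :: laurent2) dvd 1"
proof
  show "1 = (Poly_Mapping.single k c :: laurent2) * Poly_Mapping.single (- k) (1 / c)"
    using assms by (simp add: mult_single)
qed

text \<open>Two different exponents of \<open>lam\<close> give a zero over all but finitely many
  \<open>y\<close>; a single exponent of \<open>lam\<close> with two exponents of \<open>mu\<close>
  gives a whole line of zeros. Only a monomial remains. The criterion replaces factorization into
  irreducibles below: a non-unit is recognised by its infinitely many zeros.\<close>

lemma finite_zero_locus_imp_unit:
  assumes fin: "finite (zero_locus {F})"
  shows "F dvd 1"
proof -
  have F0: "F \<noteq> 0"
  proof
    assume "F = 0"
    then have "zero_locus {F} = torus2" by (auto simp: zero_locus_def)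
    then have "finite (torus2 :: (complex \<times> complex) set)" using fin by simp
    then show False
      unfolding torus2_def using infinite_nonzero_diff[of "{}"] by (auto simp: finite_cartesian_product_iff)
  qed
  then obtain a b where ab: "(a, b) \<in> Poly_Mapping.keys F"
    by (metis keys_eq_empty ex_in_conv surj_pair)
  let ?K = "Poly_Mapping.keys F"
  have fst: "a' = a" if "(a', b') \<in> ?K" for a' b'
  proof (rule ccontr)
    assume ne: "a' \<noteq> a"
    let ?Y = "UNIV - {0} - ({y. y \<noteq> 0 \<and> lam_coeff F a y = 0} \<union> {y. y \<noteq> 0 \<and> lam_coeff F a' y = 0})"
    have "\<exists>x. (x, y) \<in> zero_locus {F}" if "y \<in> ?Y" for y
    proof -
      have "\<exists>x. x \<noteq> 0 \<and> (\<Sum>a\<in>fst ` ?K. lam_coeff F a y * x powi a) = 0"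
        by (rule powi_sum_root[of _ a a']) (use that ab ne \<open>(a', b') \<in> ?K\<close> in force)+
      then show ?thesis using that by (auto simp: zero_locus_def torus2_def laurent_eval_lam_coeff)
    qed
    then have "?Y \<subseteq> snd ` zero_locus {F}" by (force)
    then have "finite ?Y" using fin finite_subset by blast
    then show False
      using infinite_nonzero_diff finite_lam_coeff_roots[OF ab] finite_lam_coeff_roots[OF that] by blast
  qed
  have snd: "b' = b" if "(a', b') \<in> ?K" for a' b'
  proof (rule ccontr)
    assume ne: "b' \<noteq> b"
    have keys': "(a, b') \<in> ?K" using that fst[OF that] by blast
    have "\<exists>y. y \<noteq> 0 \<and> (\<Sum>b\<in>snd ` ?K. Poly_Mapping.lookup F (a, b) * y powi b) = 0"
      by (rule powi_sum_root[of _ b b']) (use imageI[OF keys', of snd] imageI[OF ab, of snd] ab keys' ne in \<open>auto simp: in_keys_iff\<close>)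
    then obtain y where y: "y \<noteq> 0" "lam_coeff F a y = 0" by (auto simp: lam_coeff_def)
    have "fst k = a" if "k \<in> ?K" for k using fst[of "fst k" "snd k"] that by simp
    moreover have "a \<in> fst ` ?K" using imageI[OF ab, of fst] by simp
    ultimately have "fst ` ?K = {a}" by blast
    then have "laurent_eval F (x, y) = 0" for x using y by (simp add: laurent_eval_lam_coeff)
    then have "UNIV - {0} \<subseteq> fst ` zero_locus {F}" using y by (force simp: zero_locus_def torus2_def)
    then have "finite (UNIV - {0} :: complex set)" using fin finite_subset by blast
    then show False using infinite_nonzero_diff[of "{}"] by simp
  qed
  have "k = (a, b)" if "k \<in> ?K" for k
    using that by (cases k) (metis fst snd)
  then have "?K = {(a, b)}" using ab by blast
  then have "F = Poly_Mapping.single (a, b) (Poly_Mapping.lookup F (a, b))"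
    by (intro poly_mapping_eqI) (metis in_keys_iff lookup_single_eq lookup_single_not_eq singletonD)
  then show ?thesis using laurent_single_unit ab by (metis in_keys_iff)
qed

section \<open>Monomial curves and their intersections\<close>

definition monomial_curve :: "nat \<times> nat \<times> complex \<Rightarrow> (complex \<times> complex) set" where
  "monomial_curve = (\<lambda>(n, m, \<kappa>). {z \<in> torus2. fst z ^ n * snd z ^ m = \<kappa>})"

definition laurent_binomial :: "nat \<times> nat \<times> complex \<Rightarrow> laurent2" where
  "laurent_binomial = (\<lambda>(n, m, \<kappa>). lam ^ n * mu ^ m - Poly_Mapping.single 0 \<kappa>)"

text \<open>Coprime exponents make the curve a coset of a one-parameter subgroup, hence irreducible.
  \<open>n > 0\<close> makes the curve meet every line of constant \<open>y\<close> and allows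
  division by the binomial with respect to \<open>lam\<close>.\<close>

definition primitive_triple :: "nat \<times> nat \<times> complex \<Rightarrow> bool" where
  "primitive_triple = (\<lambda>(n, m, \<kappa>). n > 0 \<and> coprime n m \<and> \<kappa> \<noteq> 0)"

lemma laurent_eval_binomial:
  "z \<in> torus2 \<Longrightarrow> laurent_eval (laurent_binomial (n, m, \<kappa>)) z = fst z ^ n * snd z ^ m - \<kappa>"
  by (simp add: laurent_binomial_def laurent_eval_diff laurent_eval_mult laurent_eval_power laurent_eval_single)

lemma zero_locus_binomial: "zero_locus {laurent_binomial i} = monomial_curve i"
  by (cases i) (auto simp: zero_locus_def monomial_curve_def laurent_eval_binomial)

text \<open>Division by the base point leads to the subgroup \<open>a^n b^m = 1\<close>, which for
  coprime exponents is the image of \<open>t \<mapsto> (t^-m, t^n)\<close>.\<close>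

lemma monomial_curve_param:
  fixes x0 y0 :: complex
  assumes co: "coprime n m" and z0: "(x0, y0) \<in> monomial_curve (n, m, \<kappa>)"
  shows "monomial_curve (n, m, \<kappa>) = (\<lambda>t. (x0 * t powi (- int m), y0 * t ^ n)) ` (UNIV - {0})"
proof (intro equalityI subsetI)
  have xy0: "x0 \<noteq> 0" "y0 \<noteq> 0" "x0 ^ n * y0 ^ m = \<kappa>"
    using z0 by (auto simp: monomial_curve_def torus2_def)
  fix z assume z: "z \<in> monomial_curve (n, m, \<kappa>)"
  obtain x y where xy: "z = (x, y)" by force
  have xy1: "x \<noteq> 0" "y \<noteq> 0" "x ^ n * y ^ m = \<kappa>"
    using z unfolding xy by (auto simp: monomial_curve_def torus2_def)
  define a b where "a = x / x0" and "b = y / y0"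
  have ab0: "a \<noteq> 0" "b \<noteq> 0" using xy0 xy1 by (auto simp: a_def b_def)
  have "a ^ n * b ^ m = 1"
    using xy0 xy1 by (auto simp: a_def b_def power_divide)
  then have ab: "a powi int n * b powi int m = 1" by simp
  obtain u w :: int where uw: "u * int n + w * int m = 1"
    using bezout_int[of "int n" "int m"] co by (metis coprime_imp_gcd_eq_1 coprime_int_iff)
  \<comment> \<open>The Bezout coefficients invert the parametrization: for \<open>a = t^-m\<close>
    and \<open>b = t^n\<close> this product is \<open>t\<close>.\<close>
  define t where "t = a powi (- w) * b powi u"
  have t0: "t \<noteq> 0" using ab0 by (simp add: t_def)
  have bm: "b powi int m = a powi (- int n)"
    using ab ab0 by (simp add: power_int_minus field_simps)
  have an: "a powi int n = b powi (- int m)"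
    using ab ab0 by (simp add: power_int_minus field_simps)
  have "t powi (- int m) = a powi (w * int m) * (b powi int m) powi (- u)"
    unfolding t_def power_int_mult_distrib power_int_mult[symmetric] by (simp add: mult.commute)
  also have "\<dots> = a powi (w * int m + int n * u)"
    unfolding bm power_int_mult[symmetric] using ab0 by (simp add: power_int_add)
  finally have "t powi (- int m) = a" using uw by (simp add: algebra_simps)
  moreover have "t powi (int n) = (a powi int n) powi (- w) * b powi (u * int n)"
    unfolding t_def power_int_mult_distrib power_int_mult[symmetric] by (simp add: mult.commute)
  then have "t powi (int n) = b powi (int m * w + u * int n)"
    unfolding an power_int_mult[symmetric] using ab0 by (simp add: power_int_add)
  then have "t ^ n = b" using uw by (simp add: algebra_simps)
  ultimately show "z \<in> (\<lambda>t. (x0 * t powi (- int m), y0 * t ^ n)) ` (UNIV - {0})"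
    using t0 xy0 unfolding xy by (intro image_eqI[of _ _ t]) (auto simp: a_def b_def)
next
  fix z assume "z \<in> (\<lambda>t. (x0 * t powi (- int m), y0 * t ^ n)) ` (UNIV - {0})"
  then obtain t where t: "t \<noteq> 0" "z = (x0 * t powi (- int m), y0 * t ^ n)" by auto
  have "(t powi (- int m)) ^ n * (t ^ n) ^ m = 1"
    using t(1) by (simp add: power_int_minus power_mult[symmetric] mult.commute power_inverse)
  then have "(x0 * t powi (- int m)) ^ n * (y0 * t ^ n) ^ m = x0 ^ n * y0 ^ m"
    by (simp add: power_mult_distrib)
  then show "z \<in> monomial_curve (n, m, \<kappa>)"
    using z0 t by (auto simp: monomial_curve_def torus2_def)
qed

lemma ex_monomial_curve_point:
  assumes "n > 0" "\<kappa> \<noteq> 0" "y \<noteq> 0"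
  shows "\<exists>x. (x, y) \<in> monomial_curve (n, m, \<kappa>)"
proof -
  have "card {x. x ^ n = \<kappa> / y ^ m} = n" using assms by (intro card_nth_roots) auto
  then have "{x. x ^ n = \<kappa> / y ^ m} \<noteq> {}" using assms(1) by (metis card.empty less_irrefl)
  then obtain x where "x ^ n = \<kappa> / y ^ m" by blast
  moreover then have "x \<noteq> 0" using assms by (auto simp: power_0_left)
  ultimately show ?thesis using assms by (auto simp: monomial_curve_def torus2_def)
qed

lemma infinite_monomial_curve:
  assumes "primitive_triple i" shows "infinite (monomial_curve i)"
proof
  assume fin: "finite (monomial_curve i)"
  obtain n m \<kappa> where i: "i = (n, m, \<kappa>)" by (cases i)
  have "UNIV - {0} \<subseteq> snd ` monomial_curve i"
    using ex_monomial_curve_point[of n \<kappa> _ m] assms unfolding i primitive_triple_def by force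
  from finite_subset[OF this finite_imageI[OF fin]] show False
    using infinite_nonzero_diff[of "{}"] by simp
qed

text \<open>Pulled back along the parametrization, \<open>F\<close> becomes a Laurent polynomial in
  \<open>t\<close> with infinitely many zeros.\<close>

lemma laurent_vanishes_on_curve:
  assumes i: "primitive_triple i" and T: "infinite T" "T \<subseteq> monomial_curve i"
    and F: "\<And>z. z \<in> T \<Longrightarrow> laurent_eval F z = 0"
    and z: "z \<in> monomial_curve i"
  shows "laurent_eval F z = 0"
proof -
  obtain n m \<kappa> where i': "i = (n, m, \<kappa>)" by (cases i)
  obtain x0 y0 where z0: "z = (x0, y0)" by force
  have xy: "x0 \<noteq> 0" "y0 \<noteq> 0" using z unfolding i' z0 by (auto simp: monomial_curve_def torus2_def)
  define f where "f = (\<lambda>t. (x0 * t powi (- int m), y0 * t ^ n))"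
  have curve: "monomial_curve i = f ` (UNIV - {0})"
    unfolding f_def i' by (rule monomial_curve_param) (use i z in \<open>auto simp: primitive_triple_def i' z0\<close>)
  let ?K = "Poly_Mapping.keys F"
  let ?c = "\<lambda>k :: int \<times> int. Poly_Mapping.lookup F k * x0 powi fst k * y0 powi snd k"
  \<comment> \<open>Different keys of \<open>F\<close> can lead to the same exponent of
    \<open>t\<close>, hence the appeal to \<open>powi_sum_identity\<close> below.\<close>
  let ?e = "\<lambda>k :: int \<times> int. - int m * fst k + int n * snd k"
  have eval: "laurent_eval F (f t) = (\<Sum>k\<in>?K. ?c k * t powi ?e k)" if t: "t \<noteq> 0" for t
    unfolding laurent_eval_def f_def
  proof (intro sum.cong HOL.refl)
    fix k :: "int \<times> int"
    have "(t ^ n) powi snd k = t powi (int n * snd k)"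
      by (simp add: power_int_mult)
    then show "Poly_Mapping.lookup F k * fst (x0 * t powi - int m, y0 * t ^ n) powi fst k *
         snd (x0 * t powi - int m, y0 * t ^ n) powi snd k = ?c k * t powi ?e k"
      using t by (simp add: power_int_mult_distrib power_int_mult[symmetric] power_int_add[symmetric])
  qed
  define U where "U = {t. t \<noteq> 0 \<and> f t \<in> T}"
  have "T \<subseteq> f ` U" using T(2) unfolding curve U_def by blast
  then have "infinite U" using T(1) finite_subset by blast
  have "t \<noteq> 0 \<and> (\<Sum>k\<in>?K. ?c k * t powi ?e k) = 0" if "t \<in> U" for t
  proof -
    have "t \<noteq> 0" "f t \<in> T" using that by (auto simp: U_def)
    then show ?thesis using eval[of t] F[of "f t"] by simp
  qed
  from powi_sum_identity[OF finite_keys \<open>infinite U\<close> this one_neq_zero]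
  have "(\<Sum>k\<in>?K. ?c k * 1 powi ?e k) = 0" .
  moreover have "f 1 = z" by (simp add: f_def z0)
  ultimately show ?thesis using eval[of 1] by simp
qed

text \<open>An infinite intersection makes the first curve a part of the second. Moving a common
  point along the first curve to \<open>t = 2\<close> then compares two powers of 2; so the
  exponents are proportional and, being coprime, equal.\<close>

lemma finite_monomial_curve_Int:
  assumes i: "primitive_triple i" and j: "primitive_triple j" and "i \<noteq> j"
  shows "finite (monomial_curve i \<inter> monomial_curve j)"
proof (rule ccontr)
  assume inf: "infinite (monomial_curve i \<inter> monomial_curve j)"
  obtain n m \<kappa> where i': "i = (n, m, \<kappa>)" by (cases i)
  obtain n' m' \<kappa>' where j': "j = (n', m', \<kappa>')" by (cases j)
  obtain x0 y0 where z0: "(x0, y0) \<in> monomial_curve i" "(x0, y0) \<in> monomial_curve j"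
  proof -
    obtain z where "z \<in> monomial_curve i \<inter> monomial_curve j"
      using infinite_imp_nonempty[OF inf] by blast
    then show ?thesis using that[of "fst z" "snd z"] by simp
  qed
  have xy: "x0 \<noteq> 0" "y0 \<noteq> 0" using z0 unfolding i' by (auto simp: monomial_curve_def torus2_def)
  have sub: "monomial_curve i \<subseteq> monomial_curve j"
  proof
    have j0: "laurent_eval (laurent_binomial j) z = 0 \<longleftrightarrow> z \<in> monomial_curve j" if "z \<in> torus2" for z
      using that unfolding zero_locus_binomial[symmetric] by (simp add: zero_locus_def)
    have tor: "monomial_curve k \<subseteq> torus2" for k by (cases k) (auto simp: monomial_curve_def)
    fix z assume z: "z \<in> monomial_curve i"
    have "laurent_eval (laurent_binomial j) z = 0"
      by (rule laurent_vanishes_on_curve[OF i inf Int_lower1 _ z]) (use j0 tor in blast)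
    then show "z \<in> monomial_curve j" using j0 tor z by blast
  qed
  define a b where "a = x0 * 2 powi (- int m)" and "b = y0 * 2 ^ n"
  have "(a, b) \<in> monomial_curve j"
  proof -
    have "coprime n m" using i by (simp add: i' primitive_triple_def)
    from monomial_curve_param[OF this z0(1)[unfolded i']]
    have "(a, b) \<in> monomial_curve i"
      unfolding i' a_def b_def by (auto intro!: image_eqI[of _ _ 2])
    then show ?thesis using sub by blast
  qed
  then have "a ^ n' * b ^ m' = x0 ^ n' * y0 ^ m'"
    using z0(2) unfolding j' by (simp add: monomial_curve_def)
  then have "x0 ^ n' * y0 ^ m' * ((2 powi (- int m)) ^ n' * (2 ^ n) ^ m') = x0 ^ n' * y0 ^ m'"
    unfolding a_def b_def power_mult_distrib by (simp only: mult_ac)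
  then have "(2 powi (- int m)) ^ n' * (2 ^ n) ^ m' = (1::complex)" using xy by simp
  then have "(2::complex) ^ (n * m') = 2 ^ (m * n')"
    by (simp add: power_int_minus power_inverse power_mult[symmetric] field_simps)
  then have "of_nat (2 ^ (n * m')) = (of_nat (2 ^ (m * n')) :: complex)" by simp
  then have "n * m' = m * n'" unfolding of_nat_eq_iff by simp
  then have "n * m' = n' * m" by (simp add: mult.commute)
  moreover have "coprime n m" "coprime n' m'" using i j unfolding i' j' by (auto simp: primitive_triple_def)
  ultimately have "n = n'" "m = m'"
    using coprime_crossproduct_nat[of n m n' m'] by (auto simp: mult.commute coprime_commute)
  moreover then have "\<kappa> = \<kappa>'" using z0 unfolding i' j' by (auto simp: monomial_curve_def)
  ultimately show False using \<open>i \<noteq> j\<close> i' j' by simp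
qed

section \<open>Division with remainder by a binomial\<close>

lemma lam_mu_power: "lam ^ i * mu ^ j = Poly_Mapping.single (int i, int j) 1"
  by (rule laurent_eqI) (simp add: laurent_eval_mult laurent_eval_power laurent_eval_single)

lemma binomial_mult_single:
  "laurent_binomial (n, m, \<kappa>) * Poly_Mapping.single (a, b) c
    = Poly_Mapping.single (a + int n, b + int m) c - Poly_Mapping.single (a, b) (\<kappa> * c)"
  unfolding laurent_binomial_def
  by (simp add: lam_mu_power left_diff_distrib mult_single add.commute)

lemma dvd_diff_trans:
  fixes d :: "'a :: comm_ring_1"
  assumes "d dvd a - b" "d dvd b - c"
  shows "d dvd a - c"
  using dvd_add[OF assms] by simp

lemma binomial_dvd_shift:
  "laurent_binomial (n, m, \<kappa>) dvd
    Poly_Mapping.single (a + int n * int j, b + int m * int j) c - Poly_Mapping.single (a, b) (\<kappa> ^ j * c)"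
proof (induction j arbitrary: c)
  case (Suc j)
  have "laurent_binomial (n, m, \<kappa>) dvd
      Poly_Mapping.single (a + int n * int j, b + int m * int j) (\<kappa> * c)
      - Poly_Mapping.single (a, b) (\<kappa> ^ j * (\<kappa> * c))" by (rule Suc.IH)
  moreover have "laurent_binomial (n, m, \<kappa>) dvd
      Poly_Mapping.single (a + int n * int j + int n, b + int m * int j + int m) c
      - Poly_Mapping.single (a + int n * int j, b + int m * int j) (\<kappa> * c)"
    unfolding binomial_mult_single[symmetric] by simp
  ultimately have "laurent_binomial (n, m, \<kappa>) dvd
      Poly_Mapping.single (a + int n * int j + int n, b + int m * int j + int m) c
      - Poly_Mapping.single (a, b) (\<kappa> ^ j * (\<kappa> * c))"
    by (rule dvd_diff_trans[rotated])
  moreover have "a + int n * int j + int n = a + int n * int (Suc j)"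
    "b + int m * int j + int m = b + int m * int (Suc j)" "\<kappa> ^ j * (\<kappa> * c) = \<kappa> ^ Suc j * c"
    by (simp_all add: algebra_simps)
  ultimately show ?case by (simp only:)
qed simp

text \<open>Modulo the binomial, \<open>lam^n mu^m\<close> is the nonzero constant
  \<open>\<kappa>\<close>, so the exponent of \<open>lam\<close> can be moved by multiples of
  \<open>n\<close> in both directions.\<close>

lemma binomial_reduce:
  assumes "n > 0" "\<kappa> \<noteq> 0"
  shows "\<exists>R. laurent_binomial (n, m, \<kappa>) dvd F - R \<and> fst ` Poly_Mapping.keys R \<subseteq> {0..<int n}"
proof (induction F rule: laurent_induct)
  case zero
  show ?case by (intro exI[of _ 0]) simp
next
  case (add k c F)
  obtain R where R: "laurent_binomial (n, m, \<kappa>) dvd F - R" "fst ` Poly_Mapping.keys R \<subseteq> {0..<int n}"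
    using add by blast
  obtain a b where k: "k = (a, b)" by force
  have "\<exists>b' c'. laurent_binomial (n, m, \<kappa>) dvd Poly_Mapping.single k c - Poly_Mapping.single (a mod int n, b') c'"
  proof (cases "a div int n \<ge> 0")
    case True
    define j where "j = nat (a div int n)"
    have kj: "k = (a mod int n + int n * int j, b - int m * int j + int m * int j)"
      using True by (simp add: j_def k)
    show ?thesis
      using binomial_dvd_shift[of n m \<kappa> "a mod int n" j "b - int m * int j" c] unfolding kj by blast
  next
    case False
    define j where "j = nat (- (a div int n))"
    have j: "a mod int n = a + int n * int j"
      using False by (simp add: j_def minus_mult_div_eq_mod[symmetric])
    have "laurent_binomial (n, m, \<kappa>) dvd Poly_Mapping.single (a + int n * int j, b + int m * int j) (c / \<kappa> ^ j) - Poly_Mapping.single k c"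
      using binomial_dvd_shift[of n m \<kappa> a j b "c / \<kappa> ^ j"] assms(2) unfolding k by simp
    then show ?thesis unfolding j by (metis dvd_minus_iff minus_diff_eq)
  qed
  then obtain b' c' where s: "laurent_binomial (n, m, \<kappa>) dvd Poly_Mapping.single k c - Poly_Mapping.single (a mod int n, b') c'"
    by blast
  have "laurent_binomial (n, m, \<kappa>) dvd (Poly_Mapping.single k c + F) - (Poly_Mapping.single (a mod int n, b') c' + R)"
    using dvd_add[OF s R(1)] by (simp add: algebra_simps)
  moreover have "fst ` Poly_Mapping.keys (Poly_Mapping.single (a mod int n, b') c' + R) \<subseteq> {0..<int n}"
  proof -
    have "Poly_Mapping.keys (Poly_Mapping.single (a mod int n, b') c' + R) \<subseteq> insert (a mod int n, b') (Poly_Mapping.keys R)"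
      using keys_add[of "Poly_Mapping.single (a mod int n, b') c'" R] by (auto split: if_splits)
    moreover have "a mod int n \<in> {0..<int n}" using assms(1) by simp
    ultimately show ?thesis using R(2) by fastforce
  qed
  ultimately show ?case by blast
qed

text \<open>The remainder of \<open>F\<close> has degree below \<open>n\<close> in
  \<open>lam\<close>, but over every \<open>y\<close> it vanishes at the \<open>n\<close> points of
  the curve; so it is 0.\<close>

lemma binomial_dvd:
  assumes "n > 0" "\<kappa> \<noteq> 0"
    and F: "\<And>z. z \<in> monomial_curve (n, m, \<kappa>) \<Longrightarrow> laurent_eval F z = 0"
  shows "laurent_binomial (n, m, \<kappa>) dvd F"
proof -
  obtain R where R: "laurent_binomial (n, m, \<kappa>) dvd F - R" "fst ` Poly_Mapping.keys R \<subseteq> {0..<int n}"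
    using binomial_reduce[OF assms(1,2)] by blast
  obtain K where K: "F - R = laurent_binomial (n, m, \<kappa>) * K" using R(1) by blast
  have R0: "laurent_eval R z = 0" if "z \<in> monomial_curve (n, m, \<kappa>)" for z
  proof -
    have z: "z \<in> torus2" "laurent_eval (laurent_binomial (n, m, \<kappa>)) z = 0"
      using that unfolding zero_locus_binomial[symmetric] by (auto simp: zero_locus_def)
    show ?thesis
      using arg_cong[OF K, of "\<lambda>F. laurent_eval F z"] F[OF that] z
      by (simp add: laurent_eval_diff laurent_eval_mult)
  qed
  have "R = 0"
  proof (rule laurent_eq_0I[of "UNIV - {0}"])
    fix y :: complex assume y: "y \<in> UNIV - {0}"
    define f where "f = (\<Sum>a\<in>fst ` Poly_Mapping.keys R. monom (lam_coeff R a y) (nat a))"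
    have f: "poly f x = laurent_eval R (x, y)" for x
      unfolding f_def poly_sum laurent_eval_lam_coeff poly_monom
      by (intro sum.cong) (use R(2) in \<open>force simp: power_int_def\<close>)+
    have T: "card {x. x ^ n = \<kappa> / y ^ m} = n" "finite {x. x ^ n = \<kappa> / y ^ m}"
      using assms y by (auto intro: card_nth_roots finite_nth_roots)
    have "poly f x = 0" if "x ^ n = \<kappa> / y ^ m" for x
    proof -
      have "x \<noteq> 0" using that assms y by (auto simp: power_0_left)
      then have "(x, y) \<in> monomial_curve (n, m, \<kappa>)"
        using that y by (auto simp: monomial_curve_def torus2_def)
      then show ?thesis using R0 f by simp
    qed
    then have sub: "{x. x ^ n = \<kappa> / y ^ m} \<subseteq> {x. poly f x = 0}" by blast
    have "f = 0"
    proof (rule ccontr)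
      assume f0: "f \<noteq> 0"
      have "n \<le> card {x. poly f x = 0}"
        using card_mono[OF poly_roots_finite[OF f0] sub] T by simp
      also have "\<dots> \<le> degree f" by (rule card_poly_roots_bound[OF f0])
      also have "degree f \<le> n - 1"
        unfolding f_def by (intro degree_sum_le order.trans[OF degree_monom_le]) (use R(2) in force)+
      finally show False using assms(1) by simp
    qed
    then have "{x. x \<noteq> 0 \<and> laurent_eval R (x, y) = 0} = UNIV - {0}" using f by auto
    then show "infinite {x. x \<noteq> 0 \<and> laurent_eval R (x, y) = 0}"
      using infinite_nonzero_diff[of "{}"] by simp
  qed (use infinite_nonzero_diff[of "{}"] in auto)
  then show ?thesis using R(1) by simp
qed

text \<open>Zeros on an infinite part of the curve suffice, so the finitely many intersection points
  with other curves can be ignored below.\<close>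

lemma primitive_binomial_dvd:
  assumes i: "primitive_triple i" and T: "infinite T" "T \<subseteq> monomial_curve i"
    and F: "\<And>z. z \<in> T \<Longrightarrow> laurent_eval F z = 0"
  shows "laurent_binomial i dvd F"
proof (cases i)
  case (fields n m \<kappa>)
  then show ?thesis
    using binomial_dvd[of n \<kappa> m F] i laurent_vanishes_on_curve[OF i T F]
    unfolding primitive_triple_def by blast
qed

section \<open>Squarefree products of binomials\<close>

lemma monomial_curve_torus2: "monomial_curve i \<subseteq> torus2"
  by (cases i) (auto simp: monomial_curve_def)

lemma laurent_eval_binomial_eq_0:
  "z \<in> torus2 \<Longrightarrow> laurent_eval (laurent_binomial i) z = 0 \<longleftrightarrow> z \<in> monomial_curve i"
  unfolding zero_locus_binomial[symmetric] by (simp add: zero_locus_def)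

lemma zero_locus_binomial_prod:
  assumes "finite I"
  shows "zero_locus {\<Prod>i\<in>I. laurent_binomial i} = (\<Union>i\<in>I. monomial_curve i)"
proof -
  have "z \<in> zero_locus {\<Prod>i\<in>I. laurent_binomial i} \<longleftrightarrow> z \<in> (\<Union>i\<in>I. monomial_curve i)" if "z \<in> torus2" for z
    using that assms by (simp add: zero_locus_def laurent_eval_prod laurent_eval_binomial_eq_0)
  then show ?thesis using monomial_curve_torus2 by (fastforce simp: zero_locus_def)
qed

text \<open>Away from the finitely many points shared with the other curves, the product already
  split off does not vanish on curve \<open>j\<close>, so the cofactor \<open>H\<close>
  does.\<close>

lemma binomial_prod_dvd:
  assumes "finite I" "\<And>i. i \<in> I \<Longrightarrow> primitive_triple i"
    and "\<And>z i. i \<in> I \<Longrightarrow> z \<in> monomial_curve i \<Longrightarrow> laurent_eval F z = 0"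
  shows "(\<Prod>i\<in>I. laurent_binomial i) dvd F"
  using assms
proof (induction I arbitrary: F rule: finite_induct)
  case (insert j I)
  from insert.IH[of F] insert.prems obtain H where H: "F = (\<Prod>i\<in>I. laurent_binomial i) * H" by blast
  let ?E = "\<Union>i\<in>I. monomial_curve i \<inter> monomial_curve j"
  have fin: "finite ?E"
    using insert by (intro finite_UN_I finite_monomial_curve_Int) auto
  have pj: "primitive_triple j" using insert.prems by simp
  have "laurent_binomial j dvd H"
  proof (rule primitive_binomial_dvd[OF pj])
    show "infinite (monomial_curve j - ?E)" using fin infinite_monomial_curve[OF pj] by simp
    fix z assume z: "z \<in> monomial_curve j - ?E"
    then have zt: "z \<in> torus2" using monomial_curve_torus2 by blast
    have "laurent_eval F z = 0" using insert.prems z by blast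
    then have "(\<Prod>i\<in>I. laurent_eval (laurent_binomial i) z) * laurent_eval H z = 0"
      unfolding H by (simp add: laurent_eval_mult[OF zt] laurent_eval_prod[OF zt])
    moreover have "(\<Prod>i\<in>I. laurent_eval (laurent_binomial i) z) \<noteq> 0"
      using insert.hyps(1) z laurent_eval_binomial_eq_0[OF zt] by auto
    ultimately show "laurent_eval H z = 0" by simp
  qed auto
  then obtain K where "H = laurent_binomial j * K" by blast
  then show ?case using insert.hyps H by (simp add: ac_simps)
qed simp

lemma infinite_curve_piece:
  assumes "finite I" "infinite T" "T \<subseteq> (\<Union>i\<in>I. monomial_curve i)"
  shows "\<exists>i\<in>I. infinite (T \<inter> monomial_curve i)"
proof (rule ccontr)
  assume "\<not> ?thesis"
  then have "finite (\<Union>i\<in>I. T \<inter> monomial_curve i)" using assms(1) by blast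
  moreover have "T = (\<Union>i\<in>I. T \<inter> monomial_curve i)" using assms(3) by blast
  ultimately show False using assms(2) by simp
qed

lemma zero_locus_dvd: "F dvd G \<Longrightarrow> zero_locus {F} \<subseteq> zero_locus {G}"
  by (auto simp: zero_locus_def laurent_eval_mult elim!: dvdE)

text \<open>A non-unit whose square divides the product has infinitely many zeros on one of the
  curves, so the square of that binomial divides the product. After one cancellation the binomial
  divides the product of the others, and its curve would lie in their union.\<close>

lemma squarefree_binomial_prod:
  assumes I: "finite I" "\<And>i. i \<in> I \<Longrightarrow> primitive_triple i"
  shows "squarefree (\<Prod>i\<in>I. laurent_binomial i)"
  unfolding squarefree_def
proof (intro allI impI)
  let ?P = "\<Prod>i\<in>I. laurent_binomial i"
  fix G assume G: "G ^ 2 dvd ?P"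
  show "G dvd 1"
  proof (rule finite_zero_locus_imp_unit, rule ccontr)
    assume inf: "infinite (zero_locus {G})"
    have "G dvd G ^ 2" by simp
    then have "G dvd ?P" using G by (rule dvd_trans)
    then have "zero_locus {G} \<subseteq> (\<Union>i\<in>I. monomial_curve i)"
      using zero_locus_dvd zero_locus_binomial_prod[OF I(1)] by metis
    from infinite_curve_piece[OF I(1) inf this] obtain i where
      i: "i \<in> I" "infinite (zero_locus {G} \<inter> monomial_curve i)" by blast
    have pi: "primitive_triple i" using I i by blast
    have "laurent_binomial i dvd G"
      by (rule primitive_binomial_dvd[OF pi i(2)]) (auto simp: zero_locus_def)
    then have "laurent_binomial i ^ 2 dvd ?P" using G dvd_power_same dvd_trans by blast
    then obtain K where "?P = laurent_binomial i ^ 2 * K" by blast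
    then have K: "laurent_binomial i * (\<Prod>j\<in>I - {i}. laurent_binomial j) = laurent_binomial i * (laurent_binomial i * K)"
      using I(1) i(1) by (simp add: prod.remove power2_eq_square mult.assoc)
    \<comment> \<open>The common factor is cancelled by evaluation: it is nonzero off curve
      \<open>i\<close>, so \<open>?D\<close> vanishes there, which already forces
      \<open>?D = 0\<close>.\<close>
    let ?D = "(\<Prod>j\<in>I - {i}. laurent_binomial j) - laurent_binomial i * K"
    have D0: "laurent_eval ?D z = 0" if "z \<in> torus2 - monomial_curve i" for z
    proof -
      have z: "z \<in> torus2" "laurent_eval (laurent_binomial i) z \<noteq> 0"
        using that laurent_eval_binomial_eq_0 by auto
      show ?thesis
        using arg_cong[OF K, of "\<lambda>F. laurent_eval F z"] z
        by (simp add: laurent_eval_diff laurent_eval_mult)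
    qed
    have "?D = 0"
    proof (rule laurent_eq_0I[of "UNIV - {0}"])
      fix y :: complex assume y: "y \<in> UNIV - {0}"
      obtain n m \<kappa> where i': "i = (n, m, \<kappa>)" by (cases i)
      have fin: "finite {x. x ^ n = \<kappa> / y ^ m}"
        using pi unfolding i' primitive_triple_def by (auto intro: finite_nth_roots)
      have "UNIV - {0} - {x. x ^ n = \<kappa> / y ^ m} \<subseteq> {x. x \<noteq> 0 \<and> laurent_eval ?D (x, y) = 0}"
      proof
        fix x assume "x \<in> UNIV - {0} - {x. x ^ n = \<kappa> / y ^ m}"
        then have "(x, y) \<in> torus2 - monomial_curve i"
          using y by (auto simp: i' monomial_curve_def torus2_def)
        from D0[OF this] show "x \<in> {x. x \<noteq> 0 \<and> laurent_eval ?D (x, y) = 0}"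
          using \<open>x \<in> _\<close> by simp
      qed
      then show "infinite {x. x \<noteq> 0 \<and> laurent_eval ?D (x, y) = 0}"
        using infinite_nonzero_diff[OF fin] finite_subset by blast
    qed (use infinite_nonzero_diff[of "{}"] in auto)
    then have D: "(\<Prod>j\<in>I - {i}. laurent_binomial j) = laurent_binomial i * K" by simp
    have "laurent_binomial i dvd (\<Prod>j\<in>I - {i}. laurent_binomial j)" unfolding D by simp
    then have "monomial_curve i \<subseteq> (\<Union>j\<in>I - {i}. monomial_curve j)"
      using zero_locus_dvd zero_locus_binomial zero_locus_binomial_prod[of "I - {i}"] I(1)
      by (metis finite_Diff)
    then have "monomial_curve i = (\<Union>j\<in>I - {i}. monomial_curve i \<inter> monomial_curve j)" by blast
    moreover have "finite (\<Union>j\<in>I - {i}. monomial_curve i \<inter> monomial_curve j)"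
      using I i by (intro finite_UN_I finite_monomial_curve_Int) auto
    ultimately show False using infinite_monomial_curve[OF pi] by simp
  qed
qed

text \<open>From left to right, \<open>F\<close> is a multiple of the product. A cofactor with
  infinitely many zeros would have them on one of the curves and repeat its binomial; so the zeros
  are finite in number and the cofactor is a unit.\<close>

lemma squarefree_eq_binomial_prod:
  assumes I: "finite I" "\<And>i. i \<in> I \<Longrightarrow> primitive_triple i"
  shows "squarefree F \<and> zero_locus {F} = (\<Union>i\<in>I. monomial_curve i)
    \<longleftrightarrow> unit_equiv F (\<Prod>i\<in>I. laurent_binomial i)" (is "?L \<longleftrightarrow> unit_equiv F ?P")
proof
  assume L: ?L
  have "?P dvd F"
    by (rule binomial_prod_dvd[OF I]) (use L in \<open>auto simp: zero_locus_def\<close>)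
  then obtain H where H: "F = ?P * H" by blast
  have "H dvd 1"
  proof (rule finite_zero_locus_imp_unit, rule ccontr)
    assume inf: "infinite (zero_locus {H})"
    have "zero_locus {H} \<subseteq> (\<Union>i\<in>I. monomial_curve i)"
      using L zero_locus_dvd[of H F] H by simp
    from infinite_curve_piece[OF I(1) inf this] obtain i where
      i: "i \<in> I" "infinite (zero_locus {H} \<inter> monomial_curve i)" by blast
    have pi: "primitive_triple i" using I i by blast
    have "laurent_binomial i dvd H"
      by (rule primitive_binomial_dvd[OF pi i(2)]) (auto simp: zero_locus_def)
    moreover have "laurent_binomial i dvd ?P" using I(1) i(1) by (rule dvd_prodI)
    ultimately have "laurent_binomial i ^ 2 dvd F" unfolding H power2_eq_square by (rule mult_dvd_mono[rotated])
    then have "laurent_binomial i dvd 1" using L squarefreeD by blast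
    then have "zero_locus {laurent_binomial i} \<subseteq> zero_locus {1}" by (rule zero_locus_dvd)
    then have "monomial_curve i = {}" unfolding zero_locus_binomial by (auto simp: zero_locus_def laurent_eval_1)
    then show False using infinite_monomial_curve[OF pi] by simp
  qed
  then show "unit_equiv F ?P" unfolding unit_equiv_def using H by (auto simp: mult.commute)
next
  assume "unit_equiv F ?P"
  then obtain u w where u: "1 = u * w" "F = u * ?P" unfolding unit_equiv_def by blast
  have "F * w = (u * w) * ?P" unfolding u(2) by (simp only: ac_simps)
  then have "?P = F * w" unfolding u(1)[symmetric] by simp
  then have dvd: "F dvd ?P" by (rule dvdI)
  have "?P dvd F" unfolding u(2) by simp
  note dvd = dvd this
  then have "zero_locus {F} = zero_locus {?P}" using zero_locus_dvd by blast
  moreover have "squarefree F"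
    using squarefree_binomial_prod[OF I] dvd(1) unfolding squarefree_def by (meson dvd_trans)
  ultimately show ?L using zero_locus_binomial_prod[OF I(1)] by simp
qed

section \<open>The Zariski topology on unions of monomial curves\<close>

lemma closedin_zariski: "closedin zariski Z \<longleftrightarrow> (\<exists>S. Z = zero_locus S)"
proof
  assume "closedin zariski Z"
  then have "Z \<subseteq> torus2" "openin zariski (torus2 - Z)" by (auto simp: closedin_def topspace_zariski)
  then obtain S where "torus2 - Z = torus2 - zero_locus S" unfolding openin_zariski by blast
  moreover have "zero_locus S \<subseteq> torus2" by (auto simp: zero_locus_def)
  ultimately show "\<exists>S. Z = zero_locus S" using \<open>Z \<subseteq> torus2\<close> by blast
next
  assume "\<exists>S. Z = zero_locus S"
  then show "closedin zariski Z" by (auto simp: closedin_def topspace_zariski openin_zariski zero_locus_def)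
qed

lemma closedin_zariski_finite:
  assumes "finite Z" "Z \<subseteq> torus2"
  shows "closedin zariski Z"
proof -
  have pt: "closedin zariski {z}" if "z \<in> torus2" for z
  proof -
    have "{z} = zero_locus {Poly_Mapping.single (1, 0) 1 - Poly_Mapping.single 0 (fst z),
        Poly_Mapping.single (0, 1) 1 - Poly_Mapping.single 0 (snd z)}"
      using that by (auto simp: zero_locus_def laurent_eval_diff laurent_eval_single prod_eq_iff)
    then show ?thesis unfolding closedin_zariski by blast
  qed
  have "closedin zariski (\<Union>z\<in>Z. {z})"
    by (rule closedin_Union) (use assms pt in auto)
  then show ?thesis by simp
qed

lemma closedin_monomial_curve: "closedin zariski (monomial_curve i)"
  unfolding closedin_zariski using zero_locus_binomial by metis

text \<open>In other words, the curve carries the cofinite topology; the irreducibility and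
  dimension statements below rest on this.\<close>

lemma closedin_infinite_on_curve:
  assumes i: "primitive_triple i" and Z: "closedin zariski Z" "infinite (Z \<inter> monomial_curve i)"
  shows "monomial_curve i \<subseteq> Z"
proof
  obtain S where S: "Z = zero_locus S" using Z(1) closedin_zariski by blast
  fix z assume z: "z \<in> monomial_curve i"
  have "laurent_eval F z = 0" if "F \<in> S" for F
    by (rule laurent_vanishes_on_curve[OF i Z(2) _ _ z]) (use that S in \<open>auto simp: zero_locus_def\<close>)
  then show "z \<in> Z" using subsetD[OF monomial_curve_torus2 z] unfolding S by (auto simp: zero_locus_def)
qed

lemma irreducible_closed_monomial_curve:
  assumes i: "primitive_triple i"
  shows "irreducible_closed zariski (monomial_curve i)"
  unfolding irreducible_closed_def
proof (intro conjI allI impI)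
  show "monomial_curve i \<noteq> {}" using infinite_monomial_curve[OF i] by auto
  fix A B assume AB: "closedin zariski A" "closedin zariski B" "monomial_curve i = A \<union> B"
  then have "infinite A \<or> infinite B" using infinite_monomial_curve[OF i] by simp
  moreover have "A \<inter> monomial_curve i = A" "B \<inter> monomial_curve i = B" using AB(3) by auto
  ultimately have "monomial_curve i \<subseteq> A \<or> monomial_curve i \<subseteq> B"
    using closedin_infinite_on_curve[OF i] AB(1,2) by metis
  then show "monomial_curve i = A \<or> monomial_curve i = B" using AB(3) by blast
qed (rule closedin_monomial_curve)

text \<open>All subsets of a finite subset of the torus are closed, so a proper nonempty part and
  its complement would decompose \<open>Z\<close>.\<close>

lemma irreducible_closed_finite:
  assumes "irreducible_closed zariski Z" "finite Z" "W \<subseteq> Z" "W \<noteq> {}"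
  shows "W = Z"
proof -
  have "Z \<subseteq> torus2" using assms(1) closedin_subset unfolding irreducible_closed_def topspace_zariski[symmetric] by blast
  then have "closedin zariski W" "closedin zariski (Z - W)"
    using assms by (auto intro!: closedin_zariski_finite dest: finite_subset)
  moreover have "Z = W \<union> (Z - W)" using assms by blast
  ultimately have "Z = W \<or> Z = Z - W" using assms(1) unfolding irreducible_closed_def by blast
  then show ?thesis using assms by blast
qed

text \<open>A point of the curve gives a chain of length 1. In a longer chain the set
  \<open>C 1\<close> is a proper closed subset of the curve, hence finite, and has no proper
  nonempty subset \<open>C 0\<close> below it.\<close>

lemma krull_dim_monomial_curve:
  assumes i: "primitive_triple i"
  shows "krull_dim zariski (monomial_curve i) = 1"
proof -
  let ?Z = "monomial_curve i"
  let ?chain = "\<lambda>k (C :: nat \<Rightarrow> (complex \<times> complex) set).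
    (\<forall>i\<le>k. irreducible_closed zariski (C i) \<and> C i \<subseteq> ?Z) \<and> (\<forall>i<k. C i \<subset> C (Suc i))"
  obtain z where z: "z \<in> ?Z" using infinite_imp_nonempty[OF infinite_monomial_curve[OF i]] by blast
  have irr_z: "irreducible_closed zariski {z}"
    unfolding irreducible_closed_def
  proof (intro conjI allI impI)
    show "closedin zariski {z}" using subsetD[OF monomial_curve_torus2 z] by (intro closedin_zariski_finite) auto
    fix A B assume "{z} = A \<union> B"
    then show "{z} = A \<or> {z} = B" by (metis Un_singleton_iff)
  qed simp
  have "{z} \<noteq> ?Z" using infinite_monomial_curve[OF i] by (metis finite.emptyI finite.insertI)
  then have zZ: "{z} \<subset> ?Z" using z by blast
  define C where "C = (\<lambda>j :: nat. if j = 0 then {z} else ?Z)"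
  have chain: "?chain 1 C"
    unfolding C_def
  proof (intro conjI allI impI)
    fix j :: nat
    show "irreducible_closed zariski (if j = 0 then {z} else ?Z)"
      by (cases "j = 0") (simp_all only: if_True if_False irr_z irreducible_closed_monomial_curve[OF i] simp_thms)
    show "(if j = 0 then {z} else ?Z) \<subseteq> ?Z"
      using z by (cases "j = 0") simp_all
    assume "j < 1"
    then show "(if j = 0 then {z} else ?Z) \<subset> (if Suc j = 0 then {z} else ?Z)"
      using zZ by simp
  qed
  have "\<exists>C. ?chain 1 C" by (rule exI[of _ C], rule chain)
  then have "enat 1 = enat 1 \<and> (\<exists>C. ?chain 1 C)" by (rule conjI[OF HOL.refl])
  then have ge: "enat 1 \<in> {enat k | k. \<exists>C. ?chain k C}"
    unfolding mem_Collect_eq by (rule exI[of "\<lambda>k. enat 1 = enat k \<and> (\<exists>C. ?chain k C)" 1])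
  have le: "k \<le> 1" if C: "?chain k C" for k C
  proof (rule ccontr)
    assume "\<not> k \<le> 1"
    then have k: "0 \<le> k" "1 \<le> k" "2 \<le> k" "0 < k" "1 < k" by auto
    have irr: "irreducible_closed zariski (C 0)" "irreducible_closed zariski (C 1)" "C 2 \<subseteq> ?Z"
      using C k by blast+
    have sub: "C 0 \<subset> C 1" "C 1 \<subset> C 2"
      using conjunct2[OF C, rule_format, OF k(4)] conjunct2[OF C, rule_format, OF k(5)]
      by (simp_all add: numeral_2_eq_2)
    have "finite (C 1)"
    proof (rule ccontr)
      assume "infinite (C 1)"
      moreover have "C 1 \<inter> ?Z = C 1" using sub irr(3) by blast
      ultimately have "?Z \<subseteq> C 1"
        using closedin_infinite_on_curve[OF i, of "C 1"] irr(2) unfolding irreducible_closed_def by metis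
      then show False using sub irr(3) by blast
    qed
    from irreducible_closed_finite[OF irr(2) this, of "C 0"] show False
      using sub irr(1) unfolding irreducible_closed_def by blast
  qed
  have "Sup {enat k | k. \<exists>C. ?chain k C} = 1"
  proof (rule antisym)
    show "Sup {enat k | k. \<exists>C. ?chain k C} \<le> 1"
      by (rule Sup_least) (use le in \<open>auto simp: one_enat_def\<close>)
    show "1 \<le> Sup {enat k | k. \<exists>C. ?chain k C}"
      using Sup_upper[OF ge] by (simp add: one_enat_def)
  qed
  then show ?thesis unfolding krull_dim_def .
qed

section \<open>Components and dimension of a union of curves\<close>

lemma irreducible_closed_subset_UN:
  assumes "finite I" "irreducible_closed T Z" "\<And>i. i \<in> I \<Longrightarrow> closedin T (C i)" "Z \<subseteq> (\<Union>i\<in>I. C i)"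
  shows "\<exists>i\<in>I. Z \<subseteq> C i"
  using assms
proof (induction I rule: finite_induct)
  case empty
  then show ?case by (auto simp: irreducible_closed_def)
next
  case (insert j I)
  have "closedin T (Z \<inter> C j)" "closedin T (Z \<inter> (\<Union>i\<in>I. C i))"
    using insert by (auto simp: irreducible_closed_def intro!: closedin_Int closedin_Union)
  moreover have "Z = (Z \<inter> C j) \<union> (Z \<inter> (\<Union>i\<in>I. C i))" using insert.prems by auto
  ultimately have "Z = Z \<inter> C j \<or> Z = Z \<inter> (\<Union>i\<in>I. C i)"
    using insert.prems(1) unfolding irreducible_closed_def by blast
  then show ?case
  proof
    assume "Z = Z \<inter> C j"
    then show ?thesis by blast
  next
    assume "Z = Z \<inter> (\<Union>i\<in>I. C i)"
    then have "Z \<subseteq> (\<Union>i\<in>I. C i)" by blast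
    then show ?thesis using insert by blast
  qed
qed

text \<open>An irreducible set in the union lies in a single curve. No curve lies in another one,
  since different curves meet in finite sets, so each curve is maximal.\<close>

lemma irreducible_component_curves:
  assumes I: "finite I" "\<And>i. i \<in> I \<Longrightarrow> primitive_triple i"
  shows "irreducible_component zariski (\<Union>i\<in>I. monomial_curve i) Z \<longleftrightarrow> Z \<in> monomial_curve ` I"
    (is "irreducible_component zariski ?V Z \<longleftrightarrow> _")
proof
  assume Z: "irreducible_component zariski ?V Z"
  then obtain i where i: "i \<in> I" "Z \<subseteq> monomial_curve i"
    using irreducible_closed_subset_UN[OF I(1), of zariski Z monomial_curve] closedin_monomial_curve
    unfolding irreducible_component_def by blast
  then have "monomial_curve i = Z"
    using Z irreducible_closed_monomial_curve[OF I(2)] unfolding irreducible_component_def by blast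
  then show "Z \<in> monomial_curve ` I" using i by blast
next
  assume "Z \<in> monomial_curve ` I"
  then obtain i where i: "i \<in> I" "Z = monomial_curve i" by blast
  show "irreducible_component zariski ?V Z"
    unfolding irreducible_component_def
  proof (intro conjI allI impI)
    show "irreducible_closed zariski Z" "Z \<subseteq> ?V" using i irreducible_closed_monomial_curve[OF I(2)] by auto
    fix Z' assume Z': "irreducible_closed zariski Z'" "Z' \<subseteq> ?V" "Z \<subseteq> Z'"
    then obtain j where j: "j \<in> I" "Z' \<subseteq> monomial_curve j"
      using irreducible_closed_subset_UN[OF I(1), of zariski Z' monomial_curve] closedin_monomial_curve by blast
    have "monomial_curve j \<inter> monomial_curve i = monomial_curve i" using i j Z' by blast
    then have "i = j"
      using finite_monomial_curve_Int[of j i] infinite_monomial_curve[of i] I(2) i j by metis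
    then show "Z' = Z" using i j Z' by blast
  qed
qed

lemma dim_part_curves:
  assumes I: "finite I" "\<And>i. i \<in> I \<Longrightarrow> primitive_triple i"
  shows "dim_part zariski 1 (\<Union>i\<in>I. monomial_curve i) = (\<Union>i\<in>I. monomial_curve i)"
    and "dim_part zariski 2 (\<Union>i\<in>I. monomial_curve i) = {}"
proof -
  have "{Z. irreducible_component zariski (\<Union>i\<in>I. monomial_curve i) Z \<and> krull_dim zariski Z = d}
      = (if d = 1 then monomial_curve ` I else {})" for d
    using krull_dim_monomial_curve[OF I(2)] by (auto simp: irreducible_component_curves[OF I])
  then show "dim_part zariski 1 (\<Union>i\<in>I. monomial_curve i) = (\<Union>i\<in>I. monomial_curve i)"
    "dim_part zariski 2 (\<Union>i\<in>I. monomial_curve i) = {}"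
    unfolding dim_part_def by auto
qed

text \<open>Removing finitely many points leaves infinitely many on each curve, and a closed set
  containing these contains the curve.\<close>

lemma closure_of_cofinite_curves:
  assumes I: "finite I" "\<And>i. i \<in> I \<Longrightarrow> primitive_triple i"
    and S: "S \<subseteq> (\<Union>i\<in>I. monomial_curve i)" "finite ((\<Union>i\<in>I. monomial_curve i) - S)"
  shows "zariski closure_of S = (\<Union>i\<in>I. monomial_curve i)"
proof (rule closure_of_unique[OF S(1)])
  show "closedin zariski (\<Union>i\<in>I. monomial_curve i)"
    using I(1) closedin_monomial_curve by (intro closedin_Union) auto
  fix T assume T: "S \<subseteq> T" "closedin zariski T"
  show "(\<Union>i\<in>I. monomial_curve i) \<subseteq> T"
  proof (intro UN_least closedin_infinite_on_curve T(2))
    fix i assume i: "i \<in> I"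
    show "primitive_triple i" using i I by blast
    have "monomial_curve i - ((\<Union>i\<in>I. monomial_curve i) - S) \<subseteq> T \<inter> monomial_curve i"
      using T(1) i by blast
    moreover have "infinite (monomial_curve i - ((\<Union>i\<in>I. monomial_curve i) - S))"
      using S(2) infinite_monomial_curve[of i] I i by simp
    ultimately show "infinite (T \<inter> monomial_curve i)" using finite_subset by blast
  qed
qed

lemma is_A_polynomial_curves:
  assumes I: "finite I" "\<And>i. i \<in> I \<Longrightarrow> primitive_triple i"
    and S: "KCH_pairs G m l n \<subseteq> (\<Union>i\<in>I. monomial_curve i)"
      "finite ((\<Union>i\<in>I. monomial_curve i) - KCH_pairs G m l n)"
  shows "is_A_polynomial G m l n F \<longleftrightarrow> unit_equiv F (\<Prod>i\<in>I. laurent_binomial i)"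
proof -
  have cl: "zariski closure_of KCH_pairs G m l n = (\<Union>i\<in>I. monomial_curve i)"
    by (rule closure_of_cofinite_curves[OF I S])
  have d: "dim_part zariski 1 (\<Union>i\<in>I. monomial_curve i) = (\<Union>i\<in>I. monomial_curve i)"
    "dim_part zariski 2 (\<Union>i\<in>I. monomial_curve i) = {}"
    by (rule dim_part_curves[OF I]; assumption)+
  show ?thesis
    unfolding is_A_polynomial_def Let_def cl d simp_thms
    by (rule squarefree_eq_binomial_prod[OF I])
qed

section \<open>The curves of the torus knot\<close>

text \<open>For \<open>d = gcd n m\<close>, the polynomial \<open>lam^n mu^m - 1\<close> is the
  product of the binomials \<open>lam^(n/d) mu^(m/d) - w\<close> over the \<open>d\<close>-th roots
  of unity \<open>w\<close>; these have coprime exponents.\<close>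

definition factor_curves :: "nat \<Rightarrow> nat \<Rightarrow> (nat \<times> nat \<times> complex) set" where
  "factor_curves n m = (\<lambda>w. (n div gcd n m, m div gcd n m, w)) ` {w. w ^ gcd n m = 1}"

definition torus_curves :: "nat \<Rightarrow> nat \<Rightarrow> (nat \<times> nat \<times> complex) set" where
  "torus_curves p q = insert (1, p * q - q, - ((-1) ^ p)) (\<Union>n\<in>{1..p - 1}. factor_curves n ((n - 1) * p * q))"

lemma finite_factor_curves: "n > 0 \<Longrightarrow> finite (factor_curves n m)"
  unfolding factor_curves_def by (intro finite_imageI finite_nth_roots) simp

lemma primitive_factor_curves:
  assumes "n > 0" "i \<in> factor_curves n m"
  shows "primitive_triple i"
proof -
  obtain w where i: "i = (n div gcd n m, m div gcd n m, w)" "w ^ gcd n m = 1"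
    using assms(2) by (auto simp: factor_curves_def)
  have "gcd n m > 0" using assms(1) by simp
  moreover have "w \<noteq> 0" using i(2) \<open>gcd n m > 0\<close> by (auto simp: power_0_left)
  moreover have "coprime (n div gcd n m) (m div gcd n m)" using assms(1) by (intro div_gcd_coprime) simp
  moreover have "n div gcd n m > 0" using assms(1) by (simp add: div_greater_zero_iff dvd_imp_le)
  ultimately show ?thesis by (simp add: i(1) primitive_triple_def)
qed

lemma prod_factor_curves:
  assumes "n > 0"
  shows "(\<Prod>i\<in>factor_curves n m. laurent_binomial i) = lam ^ n * mu ^ m - 1"
proof (rule laurent_eqI)
  fix z :: "complex \<times> complex" assume z: "z \<in> torus2"
  let ?d = "gcd n m"
  have d: "?d > 0" using assms by simp
  have inj: "inj_on (\<lambda>w :: complex. (n div ?d, m div ?d, w)) A" for A by (auto intro: inj_onI)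
  have "laurent_eval (\<Prod>i\<in>factor_curves n m. laurent_binomial i) z
      = (\<Prod>w\<in>{w. w ^ ?d = 1}. fst z ^ (n div ?d) * snd z ^ (m div ?d) - w)"
    unfolding factor_curves_def laurent_eval_prod[OF z] prod.reindex[OF inj] comp_def
    by (simp add: laurent_eval_binomial[OF z])
  also have "\<dots> = (fst z ^ (n div ?d) * snd z ^ (m div ?d)) ^ ?d - 1"
    by (rule prod_nth_roots[OF d]) simp
  also have "\<dots> = fst z ^ n * snd z ^ m - 1"
    by (simp add: power_mult_distrib power_mult[symmetric])
  finally show "laurent_eval (\<Prod>i\<in>factor_curves n m. laurent_binomial i) z = laurent_eval (lam ^ n * mu ^ m - 1) z"
    by (simp add: laurent_eval_diff laurent_eval_mult[OF z] laurent_eval_power[OF z] laurent_eval_1)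
qed

text \<open>The ratio of the exponents survives the splitting; it distinguishes the curves that come
  from different factors.\<close>

lemma factor_curves_slope:
  assumes "(a, b, w) \<in> factor_curves n m"
  shows "a * m = b * n"
proof -
  have ab: "a = n div gcd n m" "b = m div gcd n m" using assms by (auto simp: factor_curves_def)
  have "a * m = a * (b * gcd n m)" "b * n = b * (a * gcd n m)" unfolding ab by simp_all
  then show ?thesis by (simp only: ac_simps)
qed

lemma finite_torus_curves: "finite (torus_curves p q)"
  unfolding torus_curves_def by (auto intro: finite_factor_curves)

lemma primitive_torus_curves: "i \<in> torus_curves p q \<Longrightarrow> primitive_triple i"
  unfolding torus_curves_def
  by (elim insertE UN_E) (simp add: primitive_triple_def, rule primitive_factor_curves[rotated], auto)

lemma prod_torus_curves:
  assumes p: "p \<ge> 1" and q: "q \<ge> 1"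
  shows "(\<Prod>i\<in>torus_curves p q. laurent_binomial i) = (lam * mu ^ (p * q - q) + (-1) ^ p) *
                (\<Prod>n = 1..p - 1. lam ^ n * mu ^ ((n - 1) * p * q) - 1)"
proof -
  let ?C = "\<lambda>n. factor_curves n ((n - 1) * p * q)"
  have slope: "a * (n - 1) * (p * q) = b * n" if "(a, b, w) \<in> ?C n" for a b w n
    using factor_curves_slope[OF that] by (simp only: ac_simps)
  have a0: "a > 0" if "(a, b, w) \<in> ?C n" "n \<ge> 1" for a b w n
    using primitive_factor_curves[OF _ that(1)] that(2) by (simp add: primitive_triple_def)
  \<comment> \<open>The ratios \<open>(n - 1) p q / n\<close> are distinct for distinct
    \<open>n\<close>; so no binomial is shared, and the product over the union is the product of the
    factors.\<close>
  have disj: "?C n \<inter> ?C n' = {}" if n: "n \<ge> 1" "n' \<ge> 1" "n \<noteq> n'" for n n'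
  proof (rule ccontr)
    assume "?C n \<inter> ?C n' \<noteq> {}"
    then obtain a b w where abw: "(a, b, w) \<in> ?C n" "(a, b, w) \<in> ?C n'" by (metis Int_emptyI prod_cases3)
    obtain k k' where k: "n = Suc k" "n' = Suc k'" using n by (metis Suc_le_D One_nat_def)
    have "a * k * (p * q) = b * n" "a * k' * (p * q) = b * n'"
      using slope[OF abw(1)] slope[OF abw(2)] k by simp_all
    then have "a * k * (p * q) * n' = a * k' * (p * q) * n" by (simp add: mult_ac)
    moreover have "a * p * q > 0" using a0[OF abw(1)] n p q by simp
    ultimately have "k * n' = k' * n" using p q a0[OF abw(1)] n by simp
    then show False using k n by simp
  qed
  \<comment> \<open>The ratio \<open>(p - 1) q\<close> of this triple equals
    \<open>(n - 1) p q / n\<close> only for \<open>n = p\<close>.\<close>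
  have notin: "(1, p * q - q, - ((-1) ^ p)) \<notin> (\<Union>n\<in>{1..p - 1}. ?C n)"
  proof
    assume "(1, p * q - q, - ((-1) ^ p)) \<in> (\<Union>n\<in>{1..p - 1}. ?C n)"
    then obtain n where n: "1 \<le> n" "n \<le> p - 1" "(1, p * q - q, - ((-1) ^ p)) \<in> ?C n" by auto
    obtain k where k: "n = Suc k" using n by (metis Suc_le_D One_nat_def)
    obtain j where j: "p = Suc j" using p by (metis Suc_le_D One_nat_def)
    have "k * (p * q) = (p * q - q) * n" using slope[OF n(3)] k by simp
    then have "(k * p) * q = (j * n) * q" using j by (simp add: algebra_simps)
    then have "k * p = j * n" using q by simp
    then show False using n k j by simp
  qed
  have "(\<Prod>i\<in>torus_curves p q. laurent_binomial i)
      = laurent_binomial (1, p * q - q, - ((-1) ^ p)) * (\<Prod>i\<in>(\<Union>n\<in>{1..p - 1}. ?C n). laurent_binomial i)"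
    unfolding torus_curves_def by (rule prod.insert[OF _ notin]) (auto intro: finite_factor_curves)
  also have "(\<Prod>i\<in>(\<Union>n\<in>{1..p - 1}. ?C n). laurent_binomial i) = (\<Prod>n = 1..p - 1. \<Prod>i\<in>?C n. laurent_binomial i)"
    by (rule prod.UNION_disjoint) (use disj in \<open>auto intro: finite_factor_curves\<close>)
  also have "\<dots> = (\<Prod>n = 1..p - 1. lam ^ n * mu ^ ((n - 1) * p * q) - 1)"
    by (intro prod.cong prod_factor_curves) auto
  also have "laurent_binomial (1, p * q - q, - ((-1) ^ p)) = lam * mu ^ (p * q - q) + (-1) ^ p"
  proof (rule laurent_eqI)
    fix z :: "complex \<times> complex" assume z: "z \<in> torus2"
    have "laurent_eval ((-1) ^ p) z = (-1) ^ p"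
      by (simp add: laurent_eval_power[OF z] laurent_eval_1)
    then show "laurent_eval (laurent_binomial (1, p * q - q, - ((-1) ^ p))) z
       = laurent_eval (lam * mu ^ (p * q - q) + (-1) ^ p) z"
      by (simp add: laurent_eval_binomial[OF z] laurent_eval_add laurent_eval_mult[OF z] laurent_eval_power[OF z])
  qed
  finally show ?thesis .
qed

lemma UN_torus_curves:
  assumes p: "p \<ge> 1" and q: "q \<ge> 1"
  shows "(\<Union>i\<in>torus_curves p q. monomial_curve i) = {(x, y). x \<noteq> 0 \<and> y \<noteq> 0 \<and>
    (x * y ^ (p * q - q) = - ((-1) ^ p) \<or> (\<exists>n\<in>{1..p - 1}. x ^ n * y ^ ((n - 1) * p * q) = 1))}"
    (is "_ = ?S")
proof -
  have "(\<Union>i\<in>torus_curves p q. monomial_curve i) = zero_locus {\<Prod>i\<in>torus_curves p q. laurent_binomial i}"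
    by (rule zero_locus_binomial_prod[OF finite_torus_curves, symmetric])
  also have "\<dots> = ?S"
  proof -
    have "laurent_eval (\<Prod>i\<in>torus_curves p q. laurent_binomial i) (x, y) =
        (x * y ^ (p * q - q) + (-1) ^ p) * (\<Prod>n = 1..p - 1. x ^ n * y ^ ((n - 1) * p * q) - 1)"
      if "x \<noteq> 0" "y \<noteq> 0" for x y
    proof -
      have z: "(x, y) \<in> torus2" using that by (simp add: torus2_def)
      show ?thesis unfolding prod_torus_curves[OF p q]
        by (simp add: laurent_eval_add laurent_eval_mult[OF z] laurent_eval_power[OF z] laurent_eval_prod[OF z]
          laurent_eval_diff laurent_eval_1)
    qed
    then show ?thesis
      by (auto simp: zero_locus_def torus2_def eq_neg_iff_add_eq_0)
  qed
  finally show ?thesis .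
qed

text \<open>Every binomial involves \<open>lam\<close>, so a curve has finitely many points over
  each \<open>y\<close>. This bounds the set of points at which no representation is
  constructed.\<close>

lemma finite_torus_curves_fibre:
  assumes "finite A"
  shows "finite {z \<in> (\<Union>i\<in>torus_curves p q. monomial_curve i). snd z \<in> A}"
proof -
  have "finite {x. (x, y) \<in> monomial_curve i}" if "i \<in> torus_curves p q" for i y
  proof (cases i)
    case (fields n m \<kappa>)
    have "n > 0" using primitive_torus_curves[OF that] fields by (simp add: primitive_triple_def)
    moreover have "{x. (x, y) \<in> monomial_curve i} \<subseteq> {x. x ^ n = \<kappa> / y ^ m}"
      using fields by (auto simp: monomial_curve_def torus2_def)
    ultimately show ?thesis using finite_nth_roots finite_subset by blast
  qed
  then have "finite (\<Union>y\<in>A. \<Union>i\<in>torus_curves p q. (\<lambda>x. (x, y)) ` {x. (x, y) \<in> monomial_curve i})"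
    using assms finite_torus_curves by blast
  then show ?thesis by (rule finite_subset[rotated]) force
qed

theorem theorem1p3:
  fixes p q :: nat and r s :: int
  assumes "1 \<le> p" "p < q" "coprime p q" "r * int p + s * int q = 1"
  shows "(\<forall>n \<mu>0. 1 \<le> n \<and> n \<le> p \<and> \<mu>0 \<noteq> 0 \<and> \<mu>0 \<noteq> 1 \<and> \<not> exceptional_eigenvalue p q n \<mu>0 \<longrightarrow>
            (\<exists>\<rho>. KCH_rep (torus_knot_group p q) (torus_meridian p q r s) n \<rho> \<and>
                 irreducible_rep (torus_knot_group p q) n \<rho> \<and>
                 eigenvalue (\<rho> (torus_meridian p q r s)) \<mu>0))
       \<and> (\<forall>F. is_stable_A_polynomial (torus_knot_group p q)
                (torus_meridian p q r s) (torus_longitude p q r s) F \<longleftrightarrow>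
              unit_equiv F ((lam * mu ^ (p * q - q) + (-1) ^ p) *
                (\<Prod>n = 1..p - 1. lam ^ n * mu ^ ((n - 1) * p * q) - 1)))"
proof (intro conjI allI impI)
  note pq = assms(1,2) and cop = assms(3) and rs = assms(4)
  fix n \<mu>0
  assume h: "1 \<le> n \<and> n \<le> p \<and> \<mu>0 \<noteq> 0 \<and> \<mu>0 \<noteq> 1 \<and> \<not> exceptional_eigenvalue p q n \<mu>0"
  then obtain c where c: "c \<noteq> 0" "torus_data p q r s n c \<mu>0"
    using ex_torus_data[OF pq cop rs] by blast
  have "\<exists>\<rho> e. KCH_rep (torus_knot_group p q) (torus_meridian p q r s) n \<rho> \<and>
    eigenvector (\<rho> (torus_meridian p q r s)) e \<mu>0 \<and>
    eigenvector (\<rho> (torus_longitude p q r s)) e (c * \<mu>0 powi (- (int p * int q))) \<and>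
    (n = n \<longrightarrow> irreducible_rep (torus_knot_group p q) n \<rho>)"
    by (rule torus_data_rep[OF rs c(1) _ _ _ _ c(2)]) (use h pq in auto)
  then show "\<exists>\<rho>. KCH_rep (torus_knot_group p q) (torus_meridian p q r s) n \<rho> \<and>
                 irreducible_rep (torus_knot_group p q) n \<rho> \<and>
                 eigenvalue (\<rho> (torus_meridian p q r s)) \<mu>0"
    unfolding eigenvalue_def by blast
next
  note pq = assms(1,2) and cop = assms(3) and rs = assms(4)
  fix F
  let ?A = "is_A_polynomial (torus_knot_group p q) (torus_meridian p q r s) (torus_longitude p q r s)"
  let ?P = "(lam * mu ^ (p * q - q) + (-1) ^ p) * (\<Prod>n = 1..p - 1. lam ^ n * mu ^ ((n - 1) * p * q) - 1)"
  let ?V = "\<Union>i\<in>torus_curves p q. monomial_curve i"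
  have q1: "1 \<le> q" using pq by simp
  note V = UN_torus_curves[OF pq(1) q1]
  \<comment> \<open>In every degree \<open>N \<ge> p\<close> the pairs fill \<open>?V\<close> up to
    finitely many points, so the A-polynomial is constant from degree \<open>p\<close> on.\<close>
  have A: "?A N F \<longleftrightarrow> unit_equiv F ?P" if N: "p \<le> N" for N
  proof -
    let ?K = "KCH_pairs (torus_knot_group p q) (torus_meridian p q r s) (torus_longitude p q r s) N"
    have "?K \<subseteq> ?V"
    proof
      fix z assume "z \<in> ?K"
      then obtain x y \<rho> e where z: "z = (x, y)" "KCH_rep (torus_knot_group p q) (torus_meridian p q r s) N \<rho>"
        "y \<noteq> 1" "eigenvector (\<rho> (torus_meridian p q r s)) e y" "eigenvector (\<rho> (torus_longitude p q r s)) e x"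
        unfolding KCH_pairs_def by blast
      from torus_KCH_pair_on_curves[OF pq(1) q1 cop rs z(2-5)] show "z \<in> ?V"
        unfolding V z(1) by simp
    qed
    \<comment> \<open>The points that may be missing lie over the \<open>2pq\<close>-th roots of
      unity.\<close>
    moreover have "finite (?V - ?K)"
    proof (rule finite_subset)
      show "finite {z \<in> ?V. snd z \<in> {y. y ^ (2 * p * q) = 1}}"
        using pq by (intro finite_torus_curves_fibre finite_nth_roots) simp
      show "?V - ?K \<subseteq> {z \<in> ?V. snd z \<in> {y. y ^ (2 * p * q) = 1}}"
      proof
        fix z assume z: "z \<in> ?V - ?K"
        obtain x y where xy: "z = (x, y)" by force
        have "y ^ (2 * p * q) = 1"
        proof (rule ccontr)
          assume "y ^ (2 * p * q) \<noteq> 1"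
          moreover have "x \<noteq> 0" "y \<noteq> 0"
            "x * y ^ (p * q - q) = - ((-1) ^ p) \<or> (\<exists>n\<in>{1..p - 1}. x ^ n * y ^ ((n - 1) * p * q) = 1)"
            using z unfolding V xy by auto
          ultimately show False using torus_curve_point_KCH_pair[OF pq rs N] z unfolding xy by blast
        qed
        then show "z \<in> {z \<in> ?V. snd z \<in> {y. y ^ (2 * p * q) = 1}}" using z xy by simp
      qed
    qed
    ultimately have "?A N F \<longleftrightarrow> unit_equiv F (\<Prod>i\<in>torus_curves p q. laurent_binomial i)"
      by (intro is_A_polynomial_curves finite_torus_curves primitive_torus_curves)
    then show ?thesis unfolding prod_torus_curves[OF pq(1) q1] .
  qed
  have "(\<forall>\<^sub>F N in sequentially. ?A N F) \<longleftrightarrow> (\<forall>\<^sub>F N :: nat in sequentially. unit_equiv F ?P)"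
    by (rule eventually_cong[OF eventually_mono[OF eventually_ge_at_top[of p] A]])
  then show "is_stable_A_polynomial (torus_knot_group p q) (torus_meridian p q r s) (torus_longitude p q r s) F
      \<longleftrightarrow> unit_equiv F ?P"
    unfolding is_stable_A_polynomial_def by simp
qed

end
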